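(* (1) For an ideal $I\subset D_{\{0\}}$, $\mathcal{E}(h_{(\mathbf{0,1})}(I),\mathcal{W}_{\mathrm{loc}})=\mathcal{E}(h_{(\mathbf{0,1})}(\hat D I),\mathcal{W}_{\mathrm{loc}})$. (2) If $\mathbf{k}=\mathbb{C}$ and $I\subset\mathcal{D}_0$ is an ideal, then $\mathcal{E}(h_{(\mathbf{0,1})}(I),\mathcal{W}_{\mathrm{loc}})=\mathcal{E}(h_{(\mathbf{0,1})}(\hat D I),\mathcal{W}_{\mathrm{loc}})$.
   Context: Fix $n\ge 1$, a field $\mathbf{k}$ and $x=(x_1,\dots,x_n)$. $\mathbf{k}[x]_0$ is the localization of $\mathbf{k}[x]$ at $0\in\mathbf{k}^n$; $\hat O=\mathbf{k}[[x]]$; when $\mathbf{k}=\mathbb{C}$, $\mathcal{O}_0$ is the ring of convergent power series. $D_{\{0\}},\mathcal{D}_0,\hat D$ are the rings of differential operators with coefficients in $\mathbf{k}[x]_0,\mathcal{O}_0,\hat O$ (generated by the coefficients and $\partial_1,\dots,\partial_n$ with $\partial_ic-c\partial_i=\partial c/\partial x_i$). For $\mathcal{R}$ one of these with coefficient ring $\mathcal{C}$, $h_{(\mathbf{0,1})}(\mathcal{R})$ is the $\mathbf{k}$-algebra generated by $\mathcal{C}$, $\partial_1,\dots,\partial_n$ and a variable $h$, with $\partial_ic-c\partial_i=\frac{\partial c}{\partial x_i}h$ as only nontrivial commutation relations. Ideals are left ideals. For $P=\sum c_{\alpha,\beta}x^\alpha\partial^\beta\in\mathcal{R}$ with $d=\max\{|\beta|:c_{\alpha,\beta}\ne0\}$,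 $h_{(\mathbf{0,1})}(P)=\sum c_{\alpha,\beta}x^\alpha\partial^\beta h^{d-|\beta|}$; for an ideal $J\subset\mathcal{R}$, $h_{(\mathbf{0,1})}(J)$ is the ideal of $h_{(\mathbf{0,1})}(\mathcal{R})$ generated by all $h_{(\mathbf{0,1})}(P)$, $P\in J$. $\mathcal{W}_{\mathrm{loc}}=\{w=(u,v)\in\mathbb{R}^{2n}:u_i\le0,\ u_i+v_i\ge0\ \forall i\}$. For $A=h_{(\mathbf{0,1})}(\mathcal{R})$ and $P=\sum c_{\alpha,\beta,k}x^\alpha\partial^\beta h^k\in A$, $\mathrm{ord}^w(P)=\max\{u\cdot\alpha+v\cdot\beta:c_{\alpha,\beta,k}\neq0\}$, $F^w_m=\{\mathrm{ord}^w\le m\}$, $\mathrm{gr}^w(A)=\bigoplus_mF^w_m/F^w_{<m}$, $\mathrm{in}_w(P)$ is the class of $P$ in $F^w_m/F^w_{<m}$, $m=\mathrm{ord}^w(P)$ ($\mathrm{in}_w(0)=0$), and for an ideal $J\subset A$, $\mathrm{in}_w(J)$ is the ideal of $\mathrm{gr}^w(A)$ generated by all $\mathrm{in}_w(P)$, $P\in J$. Put $M(w)=\{i:u_i<0\}$, $P(w)=\{i:u_i+v_i>0\}$. Then $\mathrm{gr}^w(A)$ is identified with the ring of polynomials in $h$, $\partial_i$ ($i\notin P(w)$) and commutative variables $\xi_i$ ($i\in P(w)$, the class of $\partial_i$), with $[\partial_i,a]=\frac{\partial a}{\partial x_i}h$ and with coefficients in $\mathbf{k}[[x_i:i\notin M(w)]][x_i:i\in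 M(w)]$ if $\mathcal{R}=\hat D$, $\mathbb{C}\{x_i:i\notin M(w)\}[x_i:i\in M(w)]$ if $\mathcal{R}=\mathcal{D}_0$, $\{f/g:f\in\mathbf{k}[x],\ g\in\mathbf{k}[x_i:i\notin M(w)],\ g(0)\ne0\}$ if $\mathcal{R}=D_{\{0\}}$. For an ideal $J\subset A$, $w\sim w'$ iff $\mathrm{gr}^w(A)=\mathrm{gr}^{w'}(A)$ (i.e. $M(w)=M(w')$ and $P(w)=P(w')$) and $\mathrm{in}_w(J)=\mathrm{in}_{w'}(J)$; $\mathcal{E}(J,\mathcal{W}_{\mathrm{loc}})$ is the set of equivalence classes on $\mathcal{W}_{\mathrm{loc}}$. *)

theory Defs
  imports "HOL-Algebra.AbelCoset" "HOL-Analysis.Infinite_Sum" "HOL-Library.Function_Algebras"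
begin

text \<open>
  Throughout, \<open>'n\<close> is the index type of the variables \<open>x\<^sub>i\<close> and \<open>n = CARD('n) \<ge> 1\<close>.
  Addition and zero on function types are pointwise (\<open>Function_Algebras\<close>); the pointwise
  product and the pointwise one of that theory are never used here.
\<close>

type_synonym 'n expo = "'n \<Rightarrow> nat"

definition deg :: "'n::finite expo \<Rightarrow> nat" where
  "deg \<alpha> = (\<Sum>i\<in>UNIV. \<alpha> i)"

text \<open>\<open>f \<alpha>\<close> is the coefficient of \<open>x\<^sup>\<alpha>\<close>.\<close>

type_synonym ('k, 'n) mfps = "'n expo \<Rightarrow> 'k"

definition mfps_one :: "('k::field, 'n::finite) mfps" where
  "mfps_one = (\<lambda>\<alpha>. if \<alpha> = 0 then 1 else 0)"

definition mfps_mult :: "('k::field, 'n::finite) mfps \<Rightarrow> ('k, 'n) mfps \<Rightarrow> ('k, 'n) mfps" where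
  "mfps_mult f g = (\<lambda>\<alpha>. \<Sum>(\<alpha>1, \<alpha>2)\<in>{(\<alpha>1, \<alpha>2). \<alpha>1 + \<alpha>2 = \<alpha>}. f \<alpha>1 * g \<alpha>2)"

text \<open>The iterated partial derivative \<open>\<partial>\<^sup>\<gamma>\<close>, from
  \<open>\<partial>\<^sup>\<gamma> x\<^sup>\<alpha>\<^sup>+\<^sup>\<gamma> = (\<Prod>\<^sub>i (\<alpha>\<^sub>i + 1) \<dots> (\<alpha>\<^sub>i + \<gamma>\<^sub>i)) x\<^sup>\<alpha>\<close> (no divided powers).\<close>

definition mfps_deriv :: "'n::finite expo \<Rightarrow> ('k::field, 'n) mfps \<Rightarrow> ('k, 'n) mfps" where
  "mfps_deriv \<gamma> f =
     (\<lambda>\<alpha>. of_nat (\<Prod>i\<in>UNIV. pochhammer (\<alpha> i + 1) (\<gamma> i)) * f (\<alpha> + \<gamma>))"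

definition polynomials :: "('k::field, 'n::finite) mfps set" where
  "polynomials = {f. finite {\<alpha>. f \<alpha> \<noteq> 0}}"

text \<open>The localization of \<open>k[x]\<close> at the origin, as a subring of \<open>k[[x]]\<close>: the series \<open>p / q\<close>
  with polynomials \<open>p\<close>, \<open>q\<close> and \<open>q(0) \<noteq> 0\<close>.\<close>

definition local_fractions :: "('k::field, 'n::finite) mfps set" where
  "local_fractions = {f. \<exists>p\<in>polynomials. \<exists>q\<in>polynomials. q 0 \<noteq> 0 \<and> mfps_mult q f = p}"

definition convergent_series :: "(complex, 'n::finite) mfps set" where
  "convergent_series = {f. \<exists>r>0. (\<lambda>\<alpha>. norm (f \<alpha>) * r ^ deg \<alpha>) summable_on UNIV}"

definition formal_series :: "('k::field, 'n::finite) mfps set" where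
  "formal_series = UNIV"

text \<open>
  An operator is given by its normal form \<open>\<Sum>\<^sub>\<beta> P \<beta> \<cdot> \<partial>\<^sup>\<beta>\<close> with coefficients on the left. The
  relations \<open>\<partial>\<^sub>i c - c \<partial>\<^sub>i = \<partial>c/\<partial>x\<^sub>i\<close> amount to the Leibniz rule
  \<open>\<partial>\<^sup>\<beta> c = \<Sum>\<^sub>\<gamma>\<^sub>\<le>\<^sub>\<beta> (\<beta> choose \<gamma>) (\<partial>\<^sup>\<gamma> c) \<partial>\<^sup>\<beta>\<^sup>-\<^sup>\<gamma>\<close>, which gives the product. Operators are formal:
  in positive characteristic they are not identified with endomorphisms of the coefficient ring.
\<close>

type_synonym ('k, 'n) dop = "'n expo \<Rightarrow> ('k, 'n) mfps"

definition multi_choose :: "'n::finite expo \<Rightarrow> 'n expo \<Rightarrow> nat" where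
  "multi_choose \<beta> \<gamma> = (\<Prod>i\<in>UNIV. \<beta> i choose \<gamma> i)"

definition dop_mult :: "('k::field, 'n::finite) dop \<Rightarrow> ('k, 'n) dop \<Rightarrow> ('k, 'n) dop" where
  "dop_mult P Q = (\<lambda>\<delta> \<alpha>.
     \<Sum>(\<beta>, \<beta>', \<gamma>)\<in>{(\<beta>, \<beta>', \<gamma>). P \<beta> \<noteq> 0 \<and> Q \<beta>' \<noteq> 0 \<and> \<gamma> \<le> \<beta> \<and> (\<beta> - \<gamma>) + \<beta>' = \<delta>}.
       of_nat (multi_choose \<beta> \<gamma>) * mfps_mult (P \<beta>) (mfps_deriv \<gamma> (Q \<beta>')) \<alpha>)"

definition dop_ring :: "('k::field, 'n::finite) mfps set \<Rightarrow> ('k, 'n) dop ring" where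
  "dop_ring C =
     \<lparr>carrier = {P. finite {\<beta>. P \<beta> \<noteq> 0} \<and> (\<forall>\<beta>. P \<beta> \<in> C)},
      monoid.mult = dop_mult,
      monoid.one = (\<lambda>\<beta>. if \<beta> = 0 then mfps_one else 0),
      zero = 0,
      add = (+)\<rparr>"

text \<open>
  The homogenized algebra: normal forms \<open>\<Sum>\<^sub>\<beta>\<^sub>,\<^sub>k P \<beta> k \<cdot> \<partial>\<^sup>\<beta> h\<^sup>k\<close> with \<open>h\<close> central and
  \<open>\<partial>\<^sub>i c - c \<partial>\<^sub>i = (\<partial>c/\<partial>x\<^sub>i) h\<close>, so that each derivative in the Leibniz rule carries a factor \<open>h\<close>.
\<close>

type_synonym ('k, 'n) hop = "'n expo \<Rightarrow> nat \<Rightarrow> ('k, 'n) mfps"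

definition hop_mult :: "('k::field, 'n::finite) hop \<Rightarrow> ('k, 'n) hop \<Rightarrow> ('k, 'n) hop" where
  "hop_mult P Q = (\<lambda>\<delta> l \<alpha>.
     \<Sum>(\<beta>, k, \<beta>', k', \<gamma>)\<in>{(\<beta>, k, \<beta>', k', \<gamma>). P \<beta> k \<noteq> 0 \<and> Q \<beta>' k' \<noteq> 0 \<and> \<gamma> \<le> \<beta>
         \<and> (\<beta> - \<gamma>) + \<beta>' = \<delta> \<and> k + k' + deg \<gamma> = l}.
       of_nat (multi_choose \<beta> \<gamma>) * mfps_mult (P \<beta> k) (mfps_deriv \<gamma> (Q \<beta>' k')) \<alpha>)"

definition hop_one :: "('k::field, 'n::finite) hop" where
  "hop_one = (\<lambda>\<beta> k. if \<beta> = 0 \<and> k = 0 then mfps_one else 0)"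

definition hop_ring :: "('k::field, 'n::finite) mfps set \<Rightarrow> ('k, 'n) hop ring" where
  "hop_ring C =
     \<lparr>carrier = {P. finite {(\<beta>, k). P \<beta> k \<noteq> 0} \<and> (\<forall>\<beta> k. P \<beta> k \<in> C)},
      monoid.mult = hop_mult,
      monoid.one = hop_one,
      zero = 0,
      add = (+)\<rparr>"

definition left_ideal :: "'a set \<Rightarrow> ('a, 'm) ring_scheme \<Rightarrow> bool" where
  "left_ideal J A \<longleftrightarrow> additive_subgroup J A \<and> (\<forall>a\<in>carrier A. \<forall>x\<in>J. a \<otimes>\<^bsub>A\<^esub> x \<in> J)"

definition gen_left_ideal :: "('a, 'm) ring_scheme \<Rightarrow> 'a set \<Rightarrow> 'a set" where
  "gen_left_ideal A S = \<Inter>{J. left_ideal J A \<and> S \<subseteq> J}"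

text \<open>For \<open>P = 0\<close> the maximum in \<open>dop_order\<close> is meaningless, but \<open>homogenize 0 = 0\<close>.\<close>

definition dop_order :: "('k::field, 'n::finite) dop \<Rightarrow> nat" where
  "dop_order P = Max {deg \<beta> | \<beta>. P \<beta> \<noteq> 0}"

definition homogenize :: "('k::field, 'n::finite) dop \<Rightarrow> ('k, 'n) hop" where
  "homogenize P = (\<lambda>\<beta> k. if deg \<beta> + k = dop_order P then P \<beta> else 0)"

definition homogenize_ideal ::
  "('k::field, 'n::finite) mfps set \<Rightarrow> ('k, 'n) dop set \<Rightarrow> ('k, 'n) hop set" where
  "homogenize_ideal C J = gen_left_ideal (hop_ring C) (homogenize ` J)"

type_synonym 'n weight = "('n \<Rightarrow> real) \<times> ('n \<Rightarrow> real)"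

definition W_loc :: "'n::finite weight set" where
  "W_loc = {(u, v). \<forall>i. u i \<le> 0 \<and> u i + v i \<ge> 0}"

definition M_set :: "'n::finite weight \<Rightarrow> 'n set" where
  "M_set w = {i. fst w i < 0}"

definition P_set :: "'n::finite weight \<Rightarrow> 'n set" where
  "P_set w = {i. fst w i + snd w i > 0}"

definition wt :: "'n::finite weight \<Rightarrow> 'n expo \<Rightarrow> 'n expo \<Rightarrow> real" where
  "wt w \<alpha> \<beta> = (\<Sum>i\<in>UNIV. fst w i * real (\<alpha> i)) + (\<Sum>i\<in>UNIV. snd w i * real (\<beta> i))"

definition weights_of :: "'n::finite weight \<Rightarrow> ('k::field, 'n) hop \<Rightarrow> real set" where
  "weights_of w P = {wt w \<alpha> \<beta> | \<alpha> \<beta> k. P \<beta> k \<alpha> \<noteq> 0}"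

text \<open>For \<open>w \<in> W_loc\<close> and \<open>P \<noteq> 0\<close> in \<open>hop_ring C\<close> the (in general infinite) set \<open>weights_of w P\<close>
  does have a greatest element.\<close>

definition w_ord :: "'n::finite weight \<Rightarrow> ('k::field, 'n) hop \<Rightarrow> real" where
  "w_ord w P = (GREATEST m. m \<in> weights_of w P)"

definition filt ::
  "'n::finite weight \<Rightarrow> ('k::field, 'n) hop ring \<Rightarrow> real \<Rightarrow> ('k, 'n) hop set" where
  "filt w A m = {P \<in> carrier A. \<forall>m'\<in>weights_of w P. m' \<le> m}"

text \<open>
  The class of \<open>P \<in> filt w A m\<close> modulo the operators all of whose weights are \<open>< m\<close> is
  represented by its part \<open>w_part w m P\<close> of weight exactly \<open>m\<close>: two elements of \<open>filt w A m\<close> have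
  the same class iff these parts agree. An element of the direct sum of all these quotients is
  represented by the sum of its components. This is the identification of the graded ring with a
  ring of normal forms in \<open>x\<close>, \<open>\<partial>\<close>, \<open>h\<close> (\<open>\<xi>\<^sub>i\<close> being written \<open>\<partial>\<^sub>i\<close>), which makes initial ideals
  for different weights comparable. The product is the usual one, the class of \<open>P Q\<close> in degree
  \<open>m + m'\<close> for \<open>P\<close>, \<open>Q\<close> of degrees \<open>m\<close>, \<open>m'\<close>.
\<close>

definition w_part :: "'n::finite weight \<Rightarrow> real \<Rightarrow> ('k::field, 'n) hop \<Rightarrow> ('k, 'n) hop" where
  "w_part w m P = (\<lambda>\<beta> k \<alpha>. if wt w \<alpha> \<beta> = m then P \<beta> k \<alpha> else 0)"

definition gr_mult ::
  "'n::finite weight \<Rightarrow> ('k::field, 'n) hop \<Rightarrow> ('k, 'n) hop \<Rightarrow> ('k, 'n) hop" where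
  "gr_mult w f g =
     (\<Sum>m\<in>weights_of w f. \<Sum>m'\<in>weights_of w g.
        w_part w (m + m') (hop_mult (w_part w m f) (w_part w m' g)))"

definition gr_ring :: "'n::finite weight \<Rightarrow> ('k::field, 'n) hop ring \<Rightarrow> ('k, 'n) hop ring" where
  "gr_ring w A =
     \<lparr>carrier = {f. finite (weights_of w f)
                  \<and> (\<forall>m. \<exists>P\<in>filt w A m. w_part w m f = w_part w m P)},
      monoid.mult = gr_mult w,
      monoid.one = hop_one,
      zero = 0,
      add = (+)\<rparr>"

definition initial_form :: "'n::finite weight \<Rightarrow> ('k::field, 'n) hop \<Rightarrow> ('k, 'n) hop" where
  "initial_form w P = w_part w (w_ord w P) P"

definition initial_ideal ::
  "'n::finite weight \<Rightarrow> ('k::field, 'n) hop ring \<Rightarrow> ('k, 'n) hop set \<Rightarrow> ('k, 'n) hop set" where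
  "initial_ideal w A J = gen_left_ideal (gr_ring w A) (initial_form w ` J)"

definition weight_equiv ::
  "('k::field, 'n::finite) hop ring \<Rightarrow> ('k, 'n) hop set \<Rightarrow> ('n weight \<times> 'n weight) set" where
  "weight_equiv A J =
     {(w, w') \<in> W_loc \<times> W_loc. M_set w = M_set w' \<and> P_set w = P_set w'
        \<and> initial_ideal w A J = initial_ideal w' A J}"

definition equiv_classes ::
  "('k::field, 'n::finite) hop ring \<Rightarrow> ('k, 'n) hop set \<Rightarrow> 'n weight set set" where
  "equiv_classes A J = W_loc // weight_equiv A J"

lemma equiv_weight_equiv: "equiv W_loc (weight_equiv A J)"
  by (auto simp: weight_equiv_def equiv_def refl_on_def sym_def trans_def)

end

theory Submission
  imports Defs "HOL-Computational_Algebra.Primes"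
begin

text \<open>
  Let \<open>C\<close> be one of the coefficient rings, \<open>I\<close> an ideal of operators over \<open>C\<close>, \<open>J = h(I)\<close>, and \<open>J'\<close> the
  homogenization of the extension of \<open>I\<close> to formal coefficients. For fixed \<open>M(w)\<close> the initial ideals
  \<open>in\<^sub>w(J)\<close> and \<open>in\<^sub>w(J')\<close> determine each other, by recipes that do not involve \<open>w\<close> any more: \<open>in\<^sub>w(J)\<close>
  consists of the elements of \<open>in\<^sub>w(J')\<close> with coefficients in \<open>C\<close> (\<open>graded_descend\<close>), and \<open>in\<^sub>w(J')\<close> of
  the limits of elements of \<open>in\<^sub>w(J)\<close> that are polynomial in the variables \<open>x\<^sub>i\<close>, \<open>i \<in> M(w)\<close>
  (\<open>graded_ascend\<close>). So two weights are equivalent for \<open>J\<close> iff they are for \<open>J'\<close>.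

  Everything is a statement about submodules of finite free modules over \<open>C\<close>, because a left ideal is
  in particular a module over the coefficients. The classical route is that the formal power series
  are faithfully flat over \<open>C\<close>, so that extension of scalars commutes with intersections and can be
  undone. Here the one deeper property of \<open>C\<close> in use is that submodules of finite free modules are closed
  for the topology given by the order of vanishing at the origin (locale \<open>coefficient_ring\<close>). Since
  polynomials are dense, the extension of a module \<open>N\<close> to formal coefficients is its closure
  \<open>hat C N\<close>, and closedness over \<open>C\<close> yields the case of flatness that matters: closure commutes with
  intersection with a submodule cut out by a condition on monomials, such as a bound on the order or
  on the weight (\<open>hat_restrict\<close>). The bound on the order shows that homogenization commutes with
  extension (\<open>homogenize_ideal_hat\<close>), the bound on the weight gives the two recipes above.

  Closedness is Krull's intersection theorem, and is proved separately for the three rings. For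
  formal and convergent series, division by a finite standard basis leaves a remainder that vanishes
  on adherent elements (\<open>closed_by_division\<close>); the quotients converge because the recursion defining
  them is a contraction for suitable norms (\<open>convergent_quotients\<close>). There monomials are ordered by
  encoding them as products of primes, and powers of these integers also serve as the weights of the
  norms. The division algorithm does not stay within \<open>k[x]\<^sub>0\<close>; for this ring the noetherian
  property of the Rees algebra of the polynomial ring (\<open>rees_stationary\<close>) shows that an adherent
  element \<open>F\<close> satisfies \<open>F = c F\<close> modulo the submodule, for some \<open>c\<close> vanishing at the origin
  (\<open>local_fractions_closed\<close>).
\<close>

section \<open>Exponents\<close>

definition single :: "'n \<Rightarrow> 'n expo" where
  "single i = (\<lambda>j. if j = i then 1 else 0)"

lemma deg_add [simp]: "deg (\<alpha> + \<beta>) = deg \<alpha> + deg \<beta>"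
  by (simp add: deg_def sum.distrib)

lemma deg_zero [simp]: "deg 0 = 0"
  by (simp add: deg_def)

lemma deg_eq_0_iff [simp]: "deg \<alpha> = 0 \<longleftrightarrow> \<alpha> = 0"
  by (auto simp: deg_def fun_eq_iff)

lemma deg_single [simp]: "deg (single i) = 1"
  by (simp add: deg_def single_def)

lemma expo_diff_add [simp]: "\<gamma> \<le> \<alpha> \<Longrightarrow> \<alpha> - \<gamma> + \<gamma> = (\<alpha> :: 'n expo)"
  by (auto simp: fun_eq_iff le_fun_def)

lemma expo_add_diff [simp]: "\<gamma> \<le> \<alpha> \<Longrightarrow> \<gamma> + (\<alpha> - \<gamma>) = (\<alpha> :: 'n expo)"
  by (auto simp: fun_eq_iff le_fun_def)

lemma expo_add_diff_cancel [simp]: "(\<alpha> + \<gamma>) - \<gamma> = (\<alpha> :: 'n expo)" "(\<gamma> + \<alpha>) - \<gamma> = (\<alpha> :: 'n expo)"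
  by (auto simp: fun_eq_iff)

lemma expo_le_add [simp]: "\<gamma> \<le> \<alpha> + (\<gamma> :: 'n expo)" "\<gamma> \<le> \<gamma> + (\<alpha> :: 'n expo)"
  by (auto simp: le_fun_def)

lemma expo_zero_le [simp]: "0 \<le> (\<alpha> :: 'n expo)"
  by (auto simp: le_fun_def)

lemma expo_diff_le [simp]: "\<alpha> - \<gamma> \<le> (\<alpha> :: 'n expo)"
  by (auto simp: le_fun_def)

lemma expo_diff_zero [simp]: "\<alpha> - 0 = (\<alpha> :: 'n expo)"
  by (auto simp: fun_eq_iff)

lemma deg_diff: "\<gamma> \<le> \<alpha> \<Longrightarrow> deg (\<alpha> - \<gamma>) + deg \<gamma> = deg \<alpha>"
  by (metis deg_add expo_diff_add)

lemma le_deg: "\<alpha> i \<le> deg \<alpha>"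
  by (simp add: deg_def member_le_sum)

lemma finite_bounded_expos: "finite {\<alpha> :: 'n::finite expo. \<forall>i. \<alpha> i \<le> N i}"
proof -
  have "{\<alpha> :: 'n expo. \<forall>i. \<alpha> i \<le> N i} = PiE UNIV (\<lambda>i. {..N i})"
    by (auto simp: PiE_def Pi_def)
  then show ?thesis by (simp add: finite_PiE)
qed

lemma finite_atMost_expo [simp]: "finite {..\<alpha> :: 'n::finite expo}" "finite {\<gamma>. \<gamma> \<le> (\<alpha> :: 'n expo)}"
  using finite_bounded_expos[of \<alpha>] by (simp_all add: atMost_def le_fun_def)

lemma finite_deg_le [simp]: "finite {\<alpha> :: 'n::finite expo. deg \<alpha> \<le> d}" "finite {\<alpha> :: 'n::finite expo. deg \<alpha> < d}"
proof -
  show *: "finite {\<alpha> :: 'n::finite expo. deg \<alpha> \<le> d}"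
    by (rule finite_subset[OF _ finite_bounded_expos[of "\<lambda>_. d"]]) (auto intro: order_trans[OF le_deg])
  show "finite {\<alpha> :: 'n::finite expo. deg \<alpha> < d}"
    by (rule finite_subset[OF _ *]) auto
qed

lemma expo_induct [case_names zero add_single]:
  fixes \<beta> :: "'n::finite expo"
  assumes "P 0" and step: "\<And>\<beta> i. P \<beta> \<Longrightarrow> P (\<beta> + single i)"
  shows "P \<beta>"
proof (induction "deg \<beta>" arbitrary: \<beta>)
  case 0
  then have "\<beta> = 0" by simp
  then show ?case using assms(1) by metis
next
  case (Suc d)
  then obtain i where i: "\<beta> i > 0"
    by (metis bot_nat_0.not_eq_extremum deg_eq_0_iff nat.distinct(1) ext zero_fun_apply)
  then have le: "single i \<le> \<beta>" by (auto simp: single_def le_fun_def)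
  have "deg (\<beta> - single i) + 1 = deg \<beta>" using deg_diff[OF le] by simp
  then have "P (\<beta> - single i)" using Suc by simp
  from step[OF this, of i] show ?case using le by simp
qed

section \<open>Power series\<close>

lemma mfps_mult_eq: "mfps_mult f g \<alpha> = (\<Sum>\<gamma>\<in>{..\<alpha>}. f \<gamma> * g (\<alpha> - \<gamma>))"
  unfolding mfps_mult_def
  by (rule sum.reindex_bij_witness[of _ "\<lambda>\<gamma>. (\<gamma>, \<alpha> - \<gamma>)" fst]) auto

lemma mfps_mult_commute: "mfps_mult f g = mfps_mult g f"
  unfolding mfps_mult_eq fun_eq_iff
proof
  fix \<alpha> :: "'a expo"
  have [simp]: "\<alpha> - (\<alpha> - \<gamma>) = \<gamma>" if "\<gamma> \<le> \<alpha>" for \<gamma> 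
    using that by (auto simp: le_fun_def fun_eq_iff)
  show "(\<Sum>\<gamma>\<in>{..\<alpha>}. f \<gamma> * g (\<alpha> - \<gamma>)) = (\<Sum>\<gamma>\<in>{..\<alpha>}. g \<gamma> * f (\<alpha> - \<gamma>))"
    by (rule sum.reindex_bij_witness[of _ "\<lambda>\<gamma>. \<alpha> - \<gamma>" "\<lambda>\<gamma>. \<alpha> - \<gamma>"]) (auto simp: mult.commute)
qed

lemma mfps_mult_assoc: "mfps_mult (mfps_mult f g) h = mfps_mult f (mfps_mult g h)"
proof
  fix \<alpha>
  have "mfps_mult (mfps_mult f g) h \<alpha>
      = (\<Sum>(\<delta>, \<gamma>)\<in>(SIGMA \<delta>:{..\<alpha>}. {..\<delta>}). f \<gamma> * g (\<delta> - \<gamma>) * h (\<alpha> - \<delta>))"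
    unfolding mfps_mult_eq by (simp add: sum_distrib_right sum.Sigma)
  also have "\<dots> = (\<Sum>(\<gamma>, \<epsilon>)\<in>(SIGMA \<gamma>:{..\<alpha>}. {..\<alpha> - \<gamma>}). f \<gamma> * (g \<epsilon> * h (\<alpha> - \<gamma> - \<epsilon>)))"
  proof (rule sum.reindex_bij_witness[of _ "\<lambda>(\<gamma>, \<epsilon>). (\<gamma> + \<epsilon>, \<gamma>)" "\<lambda>(\<delta>, \<gamma>). (\<gamma>, \<delta> - \<gamma>)"], goal_cases)
    case (1 a) then show ?case by (auto simp: le_fun_def fun_eq_iff)
  next
    case (2 a)
    then show ?case by (auto simp: le_fun_def diff_le_mono intro: order_trans)
  next
    case (3 b) then show ?case by (auto simp: le_fun_def fun_eq_iff)
  next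
    case (4 b)
    have "fst b i + snd b i \<le> \<alpha> i" for i
    proof -
      have "snd b i \<le> \<alpha> i - fst b i" "fst b i \<le> \<alpha> i" using 4 by (auto simp: le_fun_def)
      then show ?thesis by linarith
    qed
    then show ?case by (cases b) (auto simp: le_fun_def)
  next
    case (5 a)
    then obtain \<delta> \<gamma> where a: "a = (\<delta>, \<gamma>)" "\<delta> \<le> \<alpha>" "\<gamma> \<le> \<delta>" by auto
    then have "\<alpha> - \<gamma> - (\<delta> - \<gamma>) = \<alpha> - \<delta>" by (auto simp: fun_eq_iff le_fun_def)
    then show ?case using a by (simp add: mult.assoc)
  qed
  also have "\<dots> = mfps_mult f (mfps_mult g h) \<alpha>"
    unfolding mfps_mult_eq by (simp add: sum_distrib_left sum.Sigma)
  finally show "mfps_mult (mfps_mult f g) h \<alpha> = mfps_mult f (mfps_mult g h) \<alpha>" .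
qed

lemma mfps_mult_add_left: "mfps_mult (f + g) h = mfps_mult f h + mfps_mult g h"
  by (simp add: fun_eq_iff mfps_mult_eq sum.distrib distrib_right)

lemma mfps_mult_add_right: "mfps_mult h (f + g) = mfps_mult h f + mfps_mult h g"
  by (simp add: mfps_mult_commute[of h] mfps_mult_add_left)

lemma mfps_mult_zero [simp]: "mfps_mult 0 f = 0" "mfps_mult f 0 = 0"
  by (simp_all add: fun_eq_iff mfps_mult_eq)

lemma mfps_mult_one [simp]: "mfps_mult mfps_one f = f" "mfps_mult f mfps_one = f"
proof -
  show *: "mfps_mult mfps_one f = f" for f :: "('b, 'a) mfps"
  proof
    fix \<alpha>
    have "mfps_mult mfps_one f \<alpha> = (\<Sum>\<gamma>\<in>{..\<alpha>}. if \<gamma> = 0 then f (\<alpha> - \<gamma>) else 0)"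
      unfolding mfps_mult_eq by (rule sum.cong) (auto simp: mfps_one_def)
    then show "mfps_mult mfps_one f \<alpha> = f \<alpha>" by simp
  qed
  show "mfps_mult f mfps_one = f" using *[of f] mfps_mult_commute[of f mfps_one] by simp
qed

text \<open>For \<open>\<gamma> = 0\<close> these are the scalars; as every coefficient ring contains them, closure under scalars
  and under negation is a case of closure under multiplication by coefficients.\<close>

definition mfps_monom :: "'k \<Rightarrow> 'n expo \<Rightarrow> ('k::field, 'n::finite) mfps" where
  "mfps_monom a \<gamma> = (\<lambda>\<alpha>. if \<alpha> = \<gamma> then a else 0)"

lemma mfps_mult_monom:
  "mfps_mult (mfps_monom a \<gamma>) f \<alpha> = (if \<gamma> \<le> \<alpha> then a * f (\<alpha> - \<gamma>) else 0)"
proof -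
  have "mfps_mult (mfps_monom a \<gamma>) f \<alpha> = (\<Sum>\<delta>\<in>{..\<alpha>}. if \<delta> = \<gamma> then a * f (\<alpha> - \<delta>) else 0)"
    unfolding mfps_mult_eq by (rule sum.cong) (auto simp: mfps_monom_def)
  then show ?thesis by simp
qed

lemma mfps_mult_const: "mfps_mult (mfps_monom a 0) f = (\<lambda>\<alpha>. a * f \<alpha>)"
  by (simp add: fun_eq_iff mfps_mult_monom)

lemma mfps_mult_minus_one: "mfps_mult (mfps_monom (-1) 0) f = - f"
  by (simp add: fun_eq_iff mfps_mult_const)

lemma mfps_mult_diff_left: "mfps_mult (f - g) h = mfps_mult f h - mfps_mult g h"
  by (simp add: fun_eq_iff mfps_mult_eq sum_subtractf left_diff_distrib)

lemma fun_sum_apply: "sum f I x = (\<Sum>i\<in>I. f i x)"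
  by (induction I rule: infinite_finite_induct) auto

text \<open>Stated for an arbitrary commutative monoid, so as to cover sums of scalars, of vectors and of
  operators alike.\<close>

lemma sum_closed:
  fixes f :: "'i \<Rightarrow> 'a::comm_monoid_add"
  assumes "0 \<in> S" "\<And>u v. u \<in> S \<Longrightarrow> v \<in> S \<Longrightarrow> u + v \<in> S" "\<And>i. i \<in> I \<Longrightarrow> f i \<in> S"
  shows "sum f I \<in> S"
  using assms by (induction I rule: infinite_finite_induct) auto

lemma mfps_mult_at_zero:
  fixes f g :: "('k::field, 'n::finite) mfps"
  shows "mfps_mult f g 0 = f 0 * g 0"
proof -
  have "{..0 :: 'n expo} = {0}" by (auto simp: le_fun_def fun_eq_iff)
  then show ?thesis by (simp add: mfps_mult_eq)
qed

text \<open>Membership in the \<open>d\<close>-th power of the ideal of series without constant term.\<close>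

definition mfps_order_ge :: "nat \<Rightarrow> ('k::field, 'n::finite) mfps \<Rightarrow> bool" where
  "mfps_order_ge d f \<longleftrightarrow> (\<forall>\<alpha>. deg \<alpha> < d \<longrightarrow> f \<alpha> = 0)"

lemma mfps_order_ge_mult:
  assumes "mfps_order_ge d f" "mfps_order_ge e g"
  shows "mfps_order_ge (d + e) (mfps_mult f g)"
  unfolding mfps_order_ge_def
proof (intro allI impI)
  fix \<alpha> :: "'a expo" assume a: "deg \<alpha> < d + e"
  have "f \<gamma> * g (\<alpha> - \<gamma>) = 0" if "\<gamma> \<in> {..\<alpha>}" for \<gamma>
  proof -
    have "deg (\<alpha> - \<gamma>) + deg \<gamma> = deg \<alpha>" using deg_diff that by auto
    then have "deg \<gamma> < d \<or> deg (\<alpha> - \<gamma>) < e" using a by linarith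
    then show ?thesis using assms by (auto simp: mfps_order_ge_def)
  qed
  then show "mfps_mult f g \<alpha> = 0" unfolding mfps_mult_eq by (simp add: sum.neutral)
qed

lemma mfps_order_ge_0 [simp]: "mfps_order_ge 0 f"
  by (simp add: mfps_order_ge_def)

lemma mfps_order_ge_mult_left: "mfps_order_ge d f \<Longrightarrow> mfps_order_ge d (mfps_mult g f)"
  using mfps_order_ge_mult[of 0 g d f] by simp

lemma mfps_order_ge_mult_right: "mfps_order_ge d f \<Longrightarrow> mfps_order_ge d (mfps_mult f g)"
  using mfps_order_ge_mult[of d f 0 g] by simp

lemma mfps_order_ge_add: "mfps_order_ge d f \<Longrightarrow> mfps_order_ge d g \<Longrightarrow> mfps_order_ge d (f + g)"
  by (simp add: mfps_order_ge_def)

lemma mfps_order_ge_diff: "mfps_order_ge d f \<Longrightarrow> mfps_order_ge d g \<Longrightarrow> mfps_order_ge d (f - g)"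
  by (simp add: mfps_order_ge_def)

definition mfps_trunc :: "nat \<Rightarrow> ('k::field, 'n::finite) mfps \<Rightarrow> ('k, 'n) mfps" where
  "mfps_trunc d f = (\<lambda>\<alpha>. if deg \<alpha> < d then f \<alpha> else 0)"

lemma mfps_trunc_polynomial: "mfps_trunc d f \<in> polynomials"
  by (auto simp: polynomials_def mfps_trunc_def intro: finite_subset[OF _ finite_deg_le(2)[of d]])

lemma mfps_order_ge_trunc: "mfps_order_ge d (f - mfps_trunc d f)"
  by (simp add: mfps_order_ge_def mfps_trunc_def)

section \<open>Partial derivatives\<close>

lemma deriv_single: "mfps_deriv (single i) f = (\<lambda>\<alpha>. of_nat (\<alpha> i + 1) * f (\<alpha> + single i))"
proof -
  have "(\<Prod>j\<in>UNIV. pochhammer (\<alpha> j + 1) (single i j)) = \<alpha> i + 1" for \<alpha> :: "'a expo"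
  proof -
    have "(\<Prod>j\<in>UNIV. pochhammer (\<alpha> j + 1) (single i j)) = (\<Prod>j\<in>UNIV. if j = i then \<alpha> j + 1 else 1)"
      by (rule prod.cong) (auto simp: single_def)
    then show ?thesis by simp
  qed
  then show ?thesis by (simp add: mfps_deriv_def)
qed

lemma deriv_zero_expo [simp]: "mfps_deriv 0 f = f"
  by (simp add: mfps_deriv_def)

lemma deriv_add_single: "mfps_deriv (\<gamma> + single i) f = mfps_deriv (single i) (mfps_deriv \<gamma> f)"
proof
  fix \<alpha> :: "'a expo"
  have "(\<Prod>j\<in>UNIV. pochhammer (\<alpha> j + 1) ((\<gamma> + single i) j))
      = (\<Prod>j\<in>UNIV. (if j = i then \<alpha> j + 1 else 1) * pochhammer ((\<alpha> + single i) j + 1) (\<gamma> j))"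
    by (rule prod.cong) (auto simp: single_def pochhammer_rec)
  also have "\<dots> = (\<alpha> i + 1) * (\<Prod>j\<in>UNIV. pochhammer ((\<alpha> + single i) j + 1) (\<gamma> j))"
    by (simp add: prod.distrib)
  finally show "mfps_deriv (\<gamma> + single i) f \<alpha> = mfps_deriv (single i) (mfps_deriv \<gamma> f) \<alpha>"
    unfolding mfps_deriv_def[of "\<gamma> + single i"] deriv_single mfps_deriv_def[of \<gamma>]
    by (simp only: of_nat_mult mult.assoc add.assoc add.commute[of \<gamma>])
qed

lemma deriv_add: "mfps_deriv \<gamma> (f + g) = mfps_deriv \<gamma> f + mfps_deriv \<gamma> g"
  by (simp add: fun_eq_iff mfps_deriv_def distrib_left)

lemma deriv_zero [simp]: "mfps_deriv \<gamma> 0 = 0"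
  by (simp add: fun_eq_iff mfps_deriv_def)

text \<open>The coefficient \<open>\<alpha>\<^sub>i + 1\<close> that the derivative of the product produces splits as the sum of the
  \<open>i\<close>-th exponents of the two factors.\<close>

lemma deriv_mult:
  "mfps_deriv (single i) (mfps_mult f g)
     = mfps_mult (mfps_deriv (single i) f) g + mfps_mult f (mfps_deriv (single i) g)"
proof
  fix \<alpha> :: "'a expo"
  let ?e = "single i"
  have *: "(\<Sum>\<gamma>\<in>{..\<alpha> + ?e}. of_nat (\<gamma> i) * f \<gamma> * g (\<alpha> + ?e - \<gamma>))
      = mfps_mult (mfps_deriv ?e f) g \<alpha>" for f g :: "('b, 'a) mfps"
  proof -
    have "(\<Sum>\<gamma>\<in>{..\<alpha> + ?e}. of_nat (\<gamma> i) * f \<gamma> * g (\<alpha> + ?e - \<gamma>))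
        = (\<Sum>\<gamma>\<in>{\<gamma>. \<gamma> \<le> \<alpha> + ?e \<and> ?e \<le> \<gamma>}. of_nat (\<gamma> i) * f \<gamma> * g (\<alpha> + ?e - \<gamma>))"
    proof (rule sum.mono_neutral_right)
      have *: "\<gamma> i = 0" if "\<not> ?e \<le> \<gamma>" for \<gamma> :: "'a expo"
        using that by (auto simp: le_fun_def single_def split: if_splits)
      show "\<forall>\<gamma>\<in>{..\<alpha> + ?e} - {\<gamma>. \<gamma> \<le> \<alpha> + ?e \<and> ?e \<le> \<gamma>}.
          of_nat (\<gamma> i) * f \<gamma> * g (\<alpha> + ?e - \<gamma>) = 0"
      proof
        fix \<gamma> assume "\<gamma> \<in> {..\<alpha> + ?e} - {\<gamma>. \<gamma> \<le> \<alpha> + ?e \<and> ?e \<le> \<gamma>}"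
        then have "\<gamma> i = 0" by (intro *) simp
        then show "of_nat (\<gamma> i) * f \<gamma> * g (\<alpha> + ?e - \<gamma>) = 0" by simp
      qed
    qed auto
    also have "\<dots> = mfps_mult (mfps_deriv ?e f) g \<alpha>"
      unfolding mfps_mult_eq deriv_single
      by (rule sum.reindex_bij_witness[of _ "\<lambda>\<gamma>. \<gamma> + ?e" "\<lambda>\<gamma>. \<gamma> - ?e"])
        (auto simp: le_fun_def single_def fun_eq_iff split: if_splits intro!: arg_cong[where f = g])
    finally show ?thesis .
  qed
  have "mfps_deriv ?e (mfps_mult f g) \<alpha>
      = (\<Sum>\<gamma>\<in>{..\<alpha> + ?e}. of_nat (\<alpha> i + 1) * (f \<gamma> * g (\<alpha> + ?e - \<gamma>)))"
    unfolding deriv_single mfps_mult_eq by (rule sum_distrib_left)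
  also have "\<dots> = (\<Sum>\<gamma>\<in>{..\<alpha> + ?e}. of_nat (\<gamma> i) * f \<gamma> * g (\<alpha> + ?e - \<gamma>)
       + of_nat ((\<alpha> + ?e - \<gamma>) i) * g (\<alpha> + ?e - \<gamma>) * f \<gamma>)"
  proof (rule sum.cong)
    fix \<gamma> assume "\<gamma> \<in> {..\<alpha> + ?e}"
    then have "\<gamma> i \<le> \<alpha> i + 1" by (auto simp: le_fun_def single_def split: if_splits dest: spec[of _ i])
    then have *: "\<alpha> i + 1 = \<gamma> i + (\<alpha> + ?e - \<gamma>) i" by (simp add: single_def)
    show "of_nat (\<alpha> i + 1) * (f \<gamma> * g (\<alpha> + ?e - \<gamma>)) = of_nat (\<gamma> i) * f \<gamma> * g (\<alpha> + ?e - \<gamma>)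
       + of_nat ((\<alpha> + ?e - \<gamma>) i) * g (\<alpha> + ?e - \<gamma>) * f \<gamma>"
      unfolding * of_nat_add by (simp add: algebra_simps)
  qed simp
  also have "\<dots> = mfps_mult (mfps_deriv ?e f) g \<alpha>
       + (\<Sum>\<gamma>\<in>{..\<alpha> + ?e}. of_nat ((\<alpha> + ?e - \<gamma>) i) * g (\<alpha> + ?e - \<gamma>) * f \<gamma>)"
    unfolding sum.distrib * ..
  also have "(\<Sum>\<gamma>\<in>{..\<alpha> + ?e}. of_nat ((\<alpha> + ?e - \<gamma>) i) * g (\<alpha> + ?e - \<gamma>) * f \<gamma>)
      = (\<Sum>\<gamma>\<in>{..\<alpha> + ?e}. of_nat (\<gamma> i) * g \<gamma> * f (\<alpha> + ?e - \<gamma>))"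
    by (rule sum.reindex_bij_witness[of _ "\<lambda>\<gamma>. \<alpha> + ?e - \<gamma>" "\<lambda>\<gamma>. \<alpha> + ?e - \<gamma>"])
      (auto simp: le_fun_def fun_eq_iff intro!: arg_cong[where f = f])
  also have "\<dots> = mfps_mult f (mfps_deriv ?e g) \<alpha>"
    unfolding * by (simp add: mfps_mult_commute)
  finally show "mfps_deriv ?e (mfps_mult f g) \<alpha>
     = (mfps_mult (mfps_deriv ?e f) g + mfps_mult f (mfps_deriv ?e g)) \<alpha>"
    by simp
qed

section \<open>Multiplication of operators\<close>

text \<open>With \<open>t = 1\<close> this is the product of the homogenized algebra, and with \<open>t = 0\<close> it restricts, on
  operators without \<open>h\<close>, to the product of the inhomogeneous one.\<close>

definition gmul :: "nat \<Rightarrow> ('k::field, 'n::finite) hop \<Rightarrow> ('k, 'n) hop \<Rightarrow> ('k, 'n) hop" where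
  "gmul t P Q = (\<lambda>\<delta> l \<alpha>.
     \<Sum>(\<beta>, k, \<beta>', k', \<gamma>)\<in>{(\<beta>, k, \<beta>', k', \<gamma>). P \<beta> k \<noteq> 0 \<and> Q \<beta>' k' \<noteq> 0 \<and> \<gamma> \<le> \<beta>
         \<and> (\<beta> - \<gamma>) + \<beta>' = \<delta> \<and> k + k' + t * deg \<gamma> = l}.
       of_nat (multi_choose \<beta> \<gamma>) * mfps_mult (P \<beta> k) (mfps_deriv \<gamma> (Q \<beta>' k')) \<alpha>)"

definition lmul :: "('k::field, 'n::finite) mfps \<Rightarrow> ('k, 'n) hop \<Rightarrow> ('k, 'n) hop" where
  "lmul c v = (\<lambda>\<beta> k. mfps_mult c (v \<beta> k))"

definition hmul :: "('k::field, 'n::finite) hop \<Rightarrow> ('k, 'n) hop" where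
  "hmul v = (\<lambda>\<beta> k. if k = 0 then 0 else v \<beta> (k - 1))"

definition pmul :: "nat \<Rightarrow> 'n \<Rightarrow> ('k::field, 'n::finite) hop \<Rightarrow> ('k, 'n) hop" where
  "pmul t i v = (\<lambda>\<beta> k. (if \<beta> i = 0 then 0 else v (\<beta> - single i) k)
     + (if t \<le> k then mfps_deriv (single i) (v \<beta> (k - t)) else 0))"

text \<open>Left multiplication by \<open>\<partial>\<^sup>\<beta> h\<^sup>k\<close>, in closed form.\<close>

definition act :: "nat \<Rightarrow> 'n expo \<Rightarrow> nat \<Rightarrow> ('k::field, 'n::finite) hop \<Rightarrow> ('k, 'n) hop" where
  "act t \<beta> k Q = (\<lambda>\<delta> l \<alpha>. \<Sum>\<gamma>\<in>{\<gamma>. \<gamma> \<le> \<beta> \<and> \<beta> - \<gamma> \<le> \<delta> \<and> k + t * deg \<gamma> \<le> l}.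
     of_nat (multi_choose \<beta> \<gamma>) * mfps_deriv \<gamma> (Q (\<delta> - (\<beta> - \<gamma>)) (l - (k + t * deg \<gamma>))) \<alpha>)"

definition monom :: "('k::field, 'n::finite) mfps \<Rightarrow> 'n expo \<Rightarrow> nat \<Rightarrow> ('k, 'n) hop" where
  "monom c \<beta> k = (\<lambda>\<beta>' k'. if \<beta>' = \<beta> \<and> k' = k then c else 0)"

lemma finite_le_and [simp]: "finite {\<gamma> :: 'n::finite expo. \<gamma> \<le> \<beta> \<and> R \<gamma>}"
  by (rule finite_subset[OF _ finite_atMost_expo(1)[of \<beta>]]) auto

lemma multi_choose_eq_0: "\<not> \<gamma> \<le> \<beta> \<Longrightarrow> multi_choose \<beta> \<gamma> = 0"
  by (auto simp: multi_choose_def le_fun_def not_le)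

lemma multi_choose_0 [simp]: "multi_choose 0 0 = 1"
  by (simp add: multi_choose_def)

lemma multi_choose_single:
  "multi_choose (\<beta> + single i) \<gamma>
     = multi_choose \<beta> \<gamma> + (if \<gamma> i = 0 then 0 else multi_choose \<beta> (\<gamma> - single i))"
proof -
  let ?R = "\<Prod>j\<in>UNIV - {i}. \<beta> j choose \<gamma> j"
  have 1: "multi_choose (\<beta> + single i) \<gamma> = (Suc (\<beta> i) choose \<gamma> i) * ?R"
    unfolding multi_choose_def by (subst prod.remove[of _ i]) (auto simp: single_def intro!: prod.cong)
  have 2: "multi_choose \<beta> \<gamma> = (\<beta> i choose \<gamma> i) * ?R"
    unfolding multi_choose_def by (subst prod.remove[of _ i]) auto
  have 3: "multi_choose \<beta> (\<gamma> - single i) = (\<beta> i choose (\<gamma> i - 1)) * ?R"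
    unfolding multi_choose_def by (subst prod.remove[of _ i]) (auto simp: single_def intro!: prod.cong)
  show ?thesis unfolding 1 2 3 by (cases "\<gamma> i") (auto simp: algebra_simps)
qed

lemma mfps_mult_act:
  "mfps_mult c (act t \<beta> k Q \<delta> l) \<alpha> = (\<Sum>\<gamma>\<in>{\<gamma>. \<gamma> \<le> \<beta> \<and> \<beta> - \<gamma> \<le> \<delta> \<and> k + t * deg \<gamma> \<le> l}.
     of_nat (multi_choose \<beta> \<gamma>)
       * mfps_mult c (mfps_deriv \<gamma> (Q (\<delta> - (\<beta> - \<gamma>)) (l - (k + t * deg \<gamma>)))) \<alpha>)"
  unfolding mfps_mult_eq act_def
  by (simp add: sum_distrib_left mult.left_commute) (rule sum.swap)

lemma gmul_eq:
  fixes P Q :: "('k::field, 'n::finite) hop"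
  assumes fin: "finite S" and sub: "{(\<beta>, k). P \<beta> k \<noteq> 0} \<subseteq> S"
  shows "gmul t P Q = (\<Sum>(\<beta>, k)\<in>S. lmul (P \<beta> k) (act t \<beta> k Q))"
proof (intro ext)
  fix \<delta> :: "'n expo" and l \<alpha>
  let ?G = "\<lambda>(\<beta>, k). {\<gamma>. \<gamma> \<le> \<beta> \<and> \<beta> - \<gamma> \<le> \<delta> \<and> k + t * deg \<gamma> \<le> l}"
  let ?Q = "\<lambda>\<beta> k \<gamma>. Q (\<delta> - (\<beta> - \<gamma>)) (l - (k + t * deg \<gamma>))"
  let ?f = "\<lambda>((\<beta>, k), \<gamma>). of_nat (multi_choose \<beta> \<gamma>) * mfps_mult (P \<beta> k) (mfps_deriv \<gamma> (?Q \<beta> k \<gamma>)) \<alpha>"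
  have "(\<Sum>(\<beta>, k)\<in>S. lmul (P \<beta> k) (act t \<beta> k Q)) \<delta> l \<alpha>
      = (\<Sum>b\<in>S. \<Sum>\<gamma>\<in>?G b. ?f (b, \<gamma>))"
    unfolding fun_sum_apply by (rule sum.cong) (auto simp: lmul_def mfps_mult_act)
  also have "\<dots> = sum ?f (Sigma S ?G)"
    by (subst sum.Sigma) (auto simp: fin split_beta)
  also have "\<dots> = sum ?f {((\<beta>, k), \<gamma>) | \<beta> k \<gamma>. \<gamma> \<in> ?G (\<beta>, k) \<and> P \<beta> k \<noteq> 0 \<and> ?Q \<beta> k \<gamma> \<noteq> 0}"
  proof (rule sum.mono_neutral_right)
    show "finite (Sigma S ?G)" using fin by (auto intro!: finite_SigmaI)
  qed (use sub in auto)
  also have "\<dots> = gmul t P Q \<delta> l \<alpha>"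
    unfolding gmul_def
    by (rule sum.reindex_bij_witness[of _ "\<lambda>(\<beta>, k, \<beta>', k', \<gamma>). ((\<beta>, k), \<gamma>)"
          "\<lambda>((\<beta>, k), \<gamma>). (\<beta>, k, \<delta> - (\<beta> - \<gamma>), l - (k + t * deg \<gamma>), \<gamma>)"]) auto
  finally show "gmul t P Q \<delta> l \<alpha> = (\<Sum>(\<beta>, k)\<in>S. lmul (P \<beta> k) (act t \<beta> k Q)) \<delta> l \<alpha>" ..
qed

lemma act_zero:
  fixes Q :: "('k::field, 'n::finite) hop"
  shows "act t 0 0 Q = Q"
proof -
  have "{\<gamma> :: 'n expo. \<gamma> \<le> 0 \<and> 0 - \<gamma> \<le> \<delta> \<and> 0 + t * deg \<gamma> \<le> l} = {0}" for \<delta> l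
    by (auto simp: le_fun_def fun_eq_iff)
  then show ?thesis by (simp add: act_def)
qed

lemma act_Suc:
  fixes Q :: "('k::field, 'n::finite) hop"
  shows "act t \<beta> (Suc k) Q = hmul (act t \<beta> k Q)"
proof (intro ext)
  fix \<delta> :: "'n expo" and l \<alpha>
  show "act t \<beta> (Suc k) Q \<delta> l \<alpha> = hmul (act t \<beta> k Q) \<delta> l \<alpha>"
    by (cases l) (simp_all add: act_def hmul_def)
qed

lemma expo_diff_single:
  fixes \<beta> :: "'n expo"
  assumes "\<gamma> \<le> \<beta>"
  shows "\<beta> + single i - \<gamma> \<le> \<delta> \<longleftrightarrow> \<delta> i \<noteq> 0 \<and> \<beta> - \<gamma> \<le> \<delta> - single i"
    and "\<delta> - (\<beta> + single i - \<gamma>) = \<delta> - single i - (\<beta> - \<gamma>)"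
proof -
  have eq: "\<beta> + single i - \<gamma> = (\<beta> - \<gamma>) + single i"
    using assms by (auto simp: fun_eq_iff le_fun_def)
  show "\<beta> + single i - \<gamma> \<le> \<delta> \<longleftrightarrow> \<delta> i \<noteq> 0 \<and> \<beta> - \<gamma> \<le> \<delta> - single i"
    unfolding eq
  proof (intro iffI conjI)
    assume *: "\<beta> - \<gamma> + single i \<le> \<delta>"
    show "\<delta> i \<noteq> 0" using le_funD[OF *, of i] by (auto simp: single_def)
    show "\<beta> - \<gamma> \<le> \<delta> - single i"
    proof (rule le_funI)
      fix j show "(\<beta> - \<gamma>) j \<le> (\<delta> - single i) j" using le_funD[OF *, of j] by simp
    qed
  next
    assume *: "\<delta> i \<noteq> 0 \<and> \<beta> - \<gamma> \<le> \<delta> - single i"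
    show "\<beta> - \<gamma> + single i \<le> \<delta>"
    proof (rule le_funI)
      fix j show "(\<beta> - \<gamma> + single i) j \<le> \<delta> j" using le_funD[OF conjunct2[OF *], of j] *
        by (cases "j = i") (auto simp: single_def)
    qed
  qed
  show "\<delta> - (\<beta> + single i - \<gamma>) = \<delta> - single i - (\<beta> - \<gamma>)"
    unfolding eq by (auto simp: fun_eq_iff)
qed

lemma pmul_apply:
  "pmul t i v \<delta> l \<alpha> = (if \<delta> i = 0 then 0 else v (\<delta> - single i) l \<alpha>)
     + (if t \<le> l then mfps_deriv (single i) (v \<delta> (l - t)) \<alpha> else 0)"
  by (simp add: pmul_def)

text \<open>Pascal's rule splits the binomial coefficient; the two parts are the two terms of
  \<open>\<partial>\<^sub>i c = c \<partial>\<^sub>i + (\<partial>c/\<partial>x\<^sub>i) h\<^sup>t\<close>.\<close>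

lemma act_single:
  fixes Q :: "('k::field, 'n::finite) hop"
  shows "act t (\<beta> + single i) k Q = pmul t i (act t \<beta> k Q)"
proof (intro ext)
  fix \<delta> :: "'n expo" and l \<alpha>
  let ?e = "single i"
  let ?G = "{\<gamma>. \<gamma> \<le> \<beta> + ?e \<and> \<beta> + ?e - \<gamma> \<le> \<delta> \<and> k + t * deg \<gamma> \<le> l}"
  let ?d = "\<lambda>\<gamma>. mfps_deriv \<gamma> (Q (\<delta> - (\<beta> + ?e - \<gamma>)) (l - (k + t * deg \<gamma>))) \<alpha>"
  have "act t (\<beta> + ?e) k Q \<delta> l \<alpha>
      = (\<Sum>\<gamma>\<in>?G. of_nat (multi_choose \<beta> \<gamma>) * ?d \<gamma>)
        + (\<Sum>\<gamma>\<in>?G. of_nat (if \<gamma> i = 0 then 0 else multi_choose \<beta> (\<gamma> - ?e)) * ?d \<gamma>)"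
    unfolding act_def multi_choose_single of_nat_add distrib_right sum.distrib ..
  also have "(\<Sum>\<gamma>\<in>?G. of_nat (multi_choose \<beta> \<gamma>) * ?d \<gamma>)
      = (if \<delta> i = 0 then 0 else act t \<beta> k Q (\<delta> - ?e) l \<alpha>)"
  proof -
    have "(\<Sum>\<gamma>\<in>?G. of_nat (multi_choose \<beta> \<gamma>) * ?d \<gamma>)
        = (\<Sum>\<gamma>\<in>{\<gamma>. \<gamma> \<le> \<beta> \<and> \<delta> i \<noteq> 0 \<and> \<beta> - \<gamma> \<le> \<delta> - ?e \<and> k + t * deg \<gamma> \<le> l}.
            of_nat (multi_choose \<beta> \<gamma>) * ?d \<gamma>)"
    proof (rule sum.mono_neutral_right)
      show "{\<gamma>. \<gamma> \<le> \<beta> \<and> \<delta> i \<noteq> 0 \<and> \<beta> - \<gamma> \<le> \<delta> - ?e \<and> k + t * deg \<gamma> \<le> l} \<subseteq> ?G"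
        using expo_diff_single(1)[of _ \<beta> i \<delta>]
        by (auto intro: order_trans[of _ \<beta> "\<beta> + ?e"])
      show "\<forall>\<gamma>\<in>?G - {\<gamma>. \<gamma> \<le> \<beta> \<and> \<delta> i \<noteq> 0 \<and> \<beta> - \<gamma> \<le> \<delta> - ?e \<and> k + t * deg \<gamma> \<le> l}.
          of_nat (multi_choose \<beta> \<gamma>) * ?d \<gamma> = 0"
      proof
        fix \<gamma> assume "\<gamma> \<in> ?G - {\<gamma>. \<gamma> \<le> \<beta> \<and> \<delta> i \<noteq> 0 \<and> \<beta> - \<gamma> \<le> \<delta> - ?e \<and> k + t * deg \<gamma> \<le> l}"
        then have "\<not> \<gamma> \<le> \<beta>" using expo_diff_single(1)[of \<gamma> \<beta> i \<delta>] by auto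
        then show "of_nat (multi_choose \<beta> \<gamma>) * ?d \<gamma> = 0" by (simp add: multi_choose_eq_0)
      qed
    qed auto
    also have "\<dots> = (if \<delta> i = 0 then 0 else act t \<beta> k Q (\<delta> - ?e) l \<alpha>)"
      by (auto simp: act_def expo_diff_single(2) intro!: sum.cong)
    finally show ?thesis .
  qed
  also have "(\<Sum>\<gamma>\<in>?G. of_nat (if \<gamma> i = 0 then 0 else multi_choose \<beta> (\<gamma> - ?e)) * ?d \<gamma>)
      = (if t \<le> l then mfps_deriv ?e (act t \<beta> k Q \<delta> (l - t)) \<alpha> else 0)"
  proof -
    have e_le: "?e \<le> \<gamma>" if "\<gamma> i \<noteq> 0" for \<gamma>
      using that by (auto simp: le_fun_def single_def)
    have "(\<Sum>\<gamma>\<in>?G. of_nat (if \<gamma> i = 0 then 0 else multi_choose \<beta> (\<gamma> - ?e)) * ?d \<gamma>)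
        = (\<Sum>\<gamma>\<in>{\<gamma> \<in> ?G. \<gamma> i \<noteq> 0}. of_nat (multi_choose \<beta> (\<gamma> - ?e)) * ?d \<gamma>)"
      by (rule sum.mono_neutral_cong_right) auto
    also have "\<dots> = (\<Sum>\<gamma>\<in>{\<gamma>. \<gamma> \<le> \<beta> \<and> \<beta> - \<gamma> \<le> \<delta> \<and> k + t * deg \<gamma> + t \<le> l}.
        of_nat (multi_choose \<beta> \<gamma>) * ?d (\<gamma> + ?e))"
    proof (rule sum.reindex_bij_witness[of _ "\<lambda>\<gamma>. \<gamma> + ?e" "\<lambda>\<gamma>. \<gamma> - ?e"], goal_cases)
      case (1 \<gamma>) then show ?case using e_le by auto
    next
      case (2 \<gamma>)
      then have le: "?e \<le> \<gamma>" using e_le by auto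
      then have eq: "\<gamma> = (\<gamma> - ?e) + ?e" by simp
      have "\<gamma> - ?e \<le> \<beta>" using 2 by (auto simp: le_fun_def le_diff_conv)
      moreover have "\<beta> - (\<gamma> - ?e) = \<beta> + ?e - \<gamma>" using le by (auto simp: fun_eq_iff le_fun_def)
      moreover have "deg \<gamma> = deg (\<gamma> - ?e) + 1" using deg_diff[OF le] by simp
      ultimately show ?case using 2 by (simp add: algebra_simps)
    next
      case (4 \<gamma>)
      have "\<beta> + ?e - (\<gamma> + ?e) = \<beta> - \<gamma>" by (auto simp: fun_eq_iff)
      moreover have "\<gamma> + ?e \<le> \<beta> + ?e" using 4 by (auto simp: le_fun_def)
      moreover have "(\<gamma> + ?e) i \<noteq> 0" by (simp add: single_def)
      ultimately show ?case using 4 by (simp add: algebra_simps)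
    next
      case (5 \<gamma>)
      then have "\<gamma> - ?e + ?e = \<gamma>" using e_le by simp
      then show ?case by simp
    qed simp
    also have "\<dots> = (if t \<le> l then mfps_deriv ?e (act t \<beta> k Q \<delta> (l - t)) \<alpha> else 0)"
    proof (cases "t \<le> l")
      case True
      have s: "{\<gamma>. \<gamma> \<le> \<beta> \<and> \<beta> - \<gamma> \<le> \<delta> \<and> k + t * deg \<gamma> + t \<le> l}
          = {\<gamma>. \<gamma> \<le> \<beta> \<and> \<beta> - \<gamma> \<le> \<delta> \<and> k + t * deg \<gamma> \<le> l - t}"
        using True by auto
      have d: "?d (\<gamma> + ?e) = of_nat (\<alpha> i + 1)
          * mfps_deriv \<gamma> (Q (\<delta> - (\<beta> - \<gamma>)) (l - t - (k + t * deg \<gamma>))) (\<alpha> + ?e)" for \<gamma>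
      proof -
        have "\<beta> + ?e - (\<gamma> + ?e) = \<beta> - \<gamma>" by (auto simp: fun_eq_iff)
        moreover have "l - (k + t * deg (\<gamma> + ?e)) = l - t - (k + t * deg \<gamma>)" by simp
        ultimately show ?thesis by (simp only: deriv_add_single deriv_single)
      qed
      show ?thesis unfolding s d using True
        by (simp only: act_def deriv_single sum_distrib_left mult.left_commute if_True)
    next
      case False
      then have "{\<gamma>. \<gamma> \<le> \<beta> \<and> \<beta> - \<gamma> \<le> \<delta> \<and> k + t * deg \<gamma> + t \<le> l} = {}" by auto
      then show ?thesis using False by simp
    qed
    finally show ?thesis .
  qed
  finally show "act t (\<beta> + ?e) k Q \<delta> l \<alpha> = pmul t i (act t \<beta> k Q) \<delta> l \<alpha>"
    by (simp only: pmul_apply)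
qed


text \<open>A set is closed under left multiplication by all operators as soon as it is closed under the
  coefficients, \<open>h\<close> and the \<open>\<partial>\<^sub>i\<close>. Hence left ideals are handled through these three kinds of
  generators, whose action on normal forms is explicit.\<close>

lemma gmul_closed:
  assumes fin: "finite {(\<beta>, k). P \<beta> k \<noteq> 0}" and C: "\<And>\<beta> k. P \<beta> k \<in> C"
    and zero: "0 \<in> S" and add: "\<And>u v. u \<in> S \<Longrightarrow> v \<in> S \<Longrightarrow> u + v \<in> S"
    and lmul: "\<And>c v. c \<in> C \<Longrightarrow> v \<in> S \<Longrightarrow> lmul c v \<in> S"
    and hmul: "\<And>v. v \<in> S \<Longrightarrow> hmul v \<in> S" and pmul: "\<And>i v. v \<in> S \<Longrightarrow> pmul t i v \<in> S"
    and Q: "Q \<in> S"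
  shows "gmul t P Q \<in> S"
proof -
  have act0: "act t 0 k Q \<in> S" for k
    by (induction k) (simp_all only: act_zero act_Suc Q hmul)
  then have act: "act t \<beta> k Q \<in> S" for \<beta> k
    by (rule expo_induct[where P = "\<lambda>\<beta>. act t \<beta> k Q \<in> S"]) (simp_all only: act_single pmul)
  then have "(\<Sum>(\<beta>, k)\<in>{(\<beta>, k). P \<beta> k \<noteq> 0}. lmul (P \<beta> k) (act t \<beta> k Q)) \<in> S"
    by (intro sum_closed zero add) (auto intro: lmul C)
  then show ?thesis by (simp only: gmul_eq[OF fin order_refl])
qed

lemma gmul_monom: "gmul t (monom c \<beta> k) Q = lmul c (act t \<beta> k Q)"
proof -
  have "{(\<beta>', k'). monom c \<beta> k \<beta>' k' \<noteq> 0} \<subseteq> {(\<beta>, k)}" by (auto simp: monom_def split: if_splits)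
  from gmul_eq[OF _ this, of t Q] show ?thesis by (simp add: monom_def)
qed

lemma lmul_one [simp]: "lmul mfps_one v = v"
  by (simp add: lmul_def)

lemma lmul_gmul: "lmul c v = gmul t (monom c 0 0) v"
  by (simp add: gmul_monom act_zero)

lemma hmul_gmul: "hmul v = gmul t (monom mfps_one 0 1) v"
  using act_Suc[of t 0 0 v] by (simp add: gmul_monom act_zero)

lemma pmul_gmul: "pmul t i v = gmul t (monom mfps_one (single i) 0) v"
  using act_single[of t 0 i 0 v] by (simp add: gmul_monom act_zero)

lemma hop_mult_gmul: "hop_mult = gmul 1"
  by (simp add: fun_eq_iff hop_mult_def gmul_def)

text \<open>An operator without \<open>h\<close>, as an element of the homogenized algebra.\<close>

definition lift :: "('k::field, 'n::finite) dop \<Rightarrow> ('k, 'n) hop" where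
  "lift P = (\<lambda>\<beta> k. if k = 0 then P \<beta> else 0)"

lemma dop_mult_gmul:
  fixes P Q :: "('k::field, 'n::finite) dop"
  shows "dop_mult P Q = (\<lambda>\<delta>. gmul 0 (lift P) (lift Q) \<delta> 0)"
proof (intro ext)
  fix \<delta> :: "'n expo" and \<alpha>
  show "dop_mult P Q \<delta> \<alpha> = gmul 0 (lift P) (lift Q) \<delta> 0 \<alpha>"
    unfolding dop_mult_def gmul_def
    by (rule sum.reindex_bij_witness[of _ "\<lambda>(\<beta>, k, \<beta>', k', \<gamma>). (\<beta>, \<beta>', \<gamma>)"
          "\<lambda>(\<beta>, \<beta>', \<gamma>). (\<beta>, 0, \<beta>', 0, \<gamma>)"]) (auto simp: lift_def split: if_splits)
qed

lemma act_add: "act t \<beta> k (u + v) = act t \<beta> k u + act t \<beta> k v"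
  by (simp add: fun_eq_iff act_def deriv_add distrib_left sum.distrib)

lemma lmul_add: "lmul c (u + v) = lmul c u + lmul c v"
  by (simp add: lmul_def fun_eq_iff mfps_mult_add_right)

lemma lmul_add_left: "lmul (c + d) v = lmul c v + lmul d v"
  by (simp add: lmul_def fun_eq_iff mfps_mult_add_left)

lemma lmul_minus_one: "lmul (mfps_monom (-1) 0) v = - v"
  by (simp add: lmul_def fun_eq_iff mfps_mult_minus_one)


lemma gmul_add_right:
  assumes "finite {(\<beta>, k). P \<beta> k \<noteq> 0}"
  shows "gmul t P (u + v) = gmul t P u + gmul t P v"
  by (simp add: gmul_eq[OF assms order_refl] act_add lmul_add split_beta sum.distrib)

lemma gmul_add_left:
  assumes "finite {(\<beta>, k). P \<beta> k \<noteq> 0}" "finite {(\<beta>, k). P' \<beta> k \<noteq> 0}"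
  shows "gmul t (P + P') v = gmul t P v + gmul t P' v"
proof -
  let ?S = "{(\<beta>, k). P \<beta> k \<noteq> 0} \<union> {(\<beta>, k). P' \<beta> k \<noteq> 0}"
  have "{(\<beta>, k). (P + P') \<beta> k \<noteq> 0} \<subseteq> ?S" by auto
  note eqs = gmul_eq[OF _ this] gmul_eq[of ?S P] gmul_eq[of ?S P']
  have "finite ?S" using assms by simp
  then show ?thesis
    by (subst eqs(1), simp, subst eqs(2), simp, simp, subst eqs(3), simp, simp)
      (simp add: lmul_add_left split_beta sum.distrib)
qed

section \<open>Coefficient rings\<close>

definition supp :: "('k::field, 'n::finite) hop \<Rightarrow> ('n expo \<times> nat) set" where
  "supp v = {(\<beta>, k). v \<beta> k \<noteq> 0}"

definition free :: "('k::field, 'n::finite) mfps set \<Rightarrow> ('n expo \<times> nat) set \<Rightarrow> ('k, 'n) hop set" where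
  "free C B = {v. (\<forall>\<beta> k. v \<beta> k \<in> C) \<and> supp v \<subseteq> B}"

definition submodule :: "('k::field, 'n::finite) mfps set \<Rightarrow> ('k, 'n) hop set \<Rightarrow> bool" where
  "submodule C N \<longleftrightarrow> 0 \<in> N \<and> (\<forall>u\<in>N. \<forall>v\<in>N. u + v \<in> N) \<and> (\<forall>c\<in>C. \<forall>v\<in>N. lmul c v \<in> N)"

definition agree :: "nat \<Rightarrow> ('k::field, 'n::finite) hop \<Rightarrow> ('k, 'n) hop \<Rightarrow> bool" where
  "agree d f g \<longleftrightarrow> (\<forall>\<beta> k \<alpha>. deg \<alpha> < d \<longrightarrow> f \<beta> k \<alpha> = g \<beta> k \<alpha>)"

definition adherent :: "('k::field, 'n::finite) hop set \<Rightarrow> ('k, 'n) hop \<Rightarrow> bool" where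
  "adherent N f \<longleftrightarrow> (\<forall>d. \<exists>g\<in>N. agree d f g)"

definition slice :: "('n::finite \<Rightarrow> real) \<Rightarrow> real \<Rightarrow> ('k::field, 'n) mfps \<Rightarrow> ('k, 'n) mfps" where
  "slice u e c = (\<lambda>\<alpha>. if (\<Sum>i\<in>UNIV. u i * real (\<alpha> i)) = e then c \<alpha> else 0)"

text \<open>The last assumption is the one with content. It plays the role of faithful flatness of the formal
  power series over \<open>C\<close>, and of the lemma of Artin and Rees.\<close>

locale coefficient_ring =
  fixes C :: "('k::field, 'n::finite) mfps set"
  assumes polynomials: "polynomials \<subseteq> C"
    and add: "c \<in> C \<Longrightarrow> d \<in> C \<Longrightarrow> c + d \<in> C"
    and mult: "c \<in> C \<Longrightarrow> d \<in> C \<Longrightarrow> mfps_mult c d \<in> C"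
    and deriv: "c \<in> C \<Longrightarrow> mfps_deriv (single i) c \<in> C"
    and slice: "c \<in> C \<Longrightarrow> (\<And>i. u i \<le> 0) \<Longrightarrow> slice u e c \<in> C"
    and closed: "finite B \<Longrightarrow> N \<subseteq> free C B \<Longrightarrow> submodule C N \<Longrightarrow> f \<in> free C B \<Longrightarrow> adherent N f
       \<Longrightarrow> f \<in> N"

lemma monom_polynomial: "mfps_monom a \<gamma> \<in> polynomials"
  by (auto simp: polynomials_def mfps_monom_def intro: finite_subset[of _ "{\<gamma>}"])

lemma zero_polynomial: "0 \<in> polynomials"
  by (simp add: polynomials_def)

lemma one_polynomial: "mfps_one \<in> polynomials"
  using monom_polynomial[of 1 0] by (simp add: mfps_monom_def mfps_one_def)

lemma supp_add: "supp (u + v) \<subseteq> supp u \<union> supp v"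
  by (auto simp: supp_def)

lemma supp_uminus [simp]: "supp (- v) = supp v"
  by (auto simp: supp_def)

lemma supp_zero [simp]: "supp 0 = {}"
  by (auto simp: supp_def)

lemma supp_lmul: "supp (lmul c v) \<subseteq> supp v"
  by (auto simp: supp_def lmul_def)

lemma supp_hmul: "supp (hmul v) \<subseteq> (\<lambda>(\<beta>, k). (\<beta>, Suc k)) ` supp v"
proof
  fix b assume "b \<in> supp (hmul v)"
  then obtain \<beta> k where b: "b = (\<beta>, k)" "hmul v \<beta> k \<noteq> 0" by (auto simp: supp_def)
  then show "b \<in> (\<lambda>(\<beta>, k). (\<beta>, Suc k)) ` supp v"
    by (cases k) (auto simp: hmul_def supp_def)
qed

lemma supp_pmul:
  "supp (pmul t i v) \<subseteq> (\<lambda>(\<beta>, k). (\<beta> + single i, k)) ` supp v \<union> (\<lambda>(\<beta>, k). (\<beta>, k + t)) ` supp v"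
proof
  fix b assume "b \<in> supp (pmul t i v)"
  then obtain \<beta> k where b: "b = (\<beta>, k)" "pmul t i v \<beta> k \<noteq> 0" by (auto simp: supp_def)
  then have "(\<beta> i \<noteq> 0 \<and> v (\<beta> - single i) k \<noteq> 0) \<or> (t \<le> k \<and> v \<beta> (k - t) \<noteq> 0)"
    by (auto simp: pmul_def split: if_splits)
  then show "b \<in> (\<lambda>(\<beta>, k). (\<beta> + single i, k)) ` supp v \<union> (\<lambda>(\<beta>, k). (\<beta>, k + t)) ` supp v"
  proof
    assume *: "\<beta> i \<noteq> 0 \<and> v (\<beta> - single i) k \<noteq> 0"
    then have "single i \<le> \<beta>" by (auto simp: le_fun_def single_def)
    then have "\<beta> - single i + single i = \<beta>" by simp
    then show ?thesis using * b by (force simp: supp_def image_iff)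
  next
    assume "t \<le> k \<and> v \<beta> (k - t) \<noteq> 0"
    then show ?thesis using b by (force simp: supp_def image_iff)
  qed
qed

lemma submodule_uminus:
  assumes "polynomials \<subseteq> C" "submodule C N" "v \<in> N"
  shows "- v \<in> N"
  using assms monom_polynomial[of "-1" 0] unfolding submodule_def lmul_minus_one[symmetric] by blast

lemma submodule_diff:
  assumes "polynomials \<subseteq> C" "submodule C N" "u \<in> N" "v \<in> N"
  shows "u - v \<in> N"
proof -
  have "- v \<in> N" using submodule_uminus[OF assms(1,2,4)] .
  then have "u + - v \<in> N" using assms(2,3) unfolding submodule_def by blast
  then show ?thesis by simp
qed

lemma agree_refl [simp]: "agree d f f"
  by (simp add: agree_def)

lemma agree_mono: "agree d f g \<Longrightarrow> e \<le> d \<Longrightarrow> agree e f g"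
  by (simp add: agree_def)

lemma agree_add: "agree d f g \<Longrightarrow> agree d f' g' \<Longrightarrow> agree d (f + f') (g + g')"
  by (simp add: agree_def)

lemma agree_iff: "agree d f g \<longleftrightarrow> (\<forall>\<beta> k. mfps_order_ge d (f \<beta> k - g \<beta> k))"
  by (auto simp: agree_def mfps_order_ge_def)

lemma agree_lmul:
  assumes "mfps_order_ge d (c - c')" "agree d f g"
  shows "agree d (lmul c f) (lmul c' g)"
  unfolding agree_iff
proof (intro allI)
  fix \<beta> k
  have "lmul c f \<beta> k - lmul c' g \<beta> k
      = mfps_mult (c - c') (f \<beta> k) + mfps_mult c' (f \<beta> k - g \<beta> k)"
    by (simp add: lmul_def mfps_mult_diff_left mfps_mult_commute[of c'])
  then show "mfps_order_ge d (lmul c f \<beta> k - lmul c' g \<beta> k)"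
    using assms by (simp add: agree_iff mfps_order_ge_add mfps_order_ge_mult_left mfps_order_ge_mult_right)
qed

lemma agree_hmul: "agree d f g \<Longrightarrow> agree d (hmul f) (hmul g)"
  by (simp add: agree_def hmul_def)

lemma agree_pmul: "agree (Suc d) f g \<Longrightarrow> agree d (pmul t i f) (pmul t i g)"
  by (auto simp: agree_def pmul_apply deriv_single)

lemma adherent_supp: "adherent N f \<Longrightarrow> (\<And>g. g \<in> N \<Longrightarrow> supp g \<subseteq> B) \<Longrightarrow> supp f \<subseteq> B"
proof
  fix b assume a: "adherent N f" "\<And>g. g \<in> N \<Longrightarrow> supp g \<subseteq> B" and "b \<in> supp f"
  then obtain \<beta> k \<alpha> where b: "b = (\<beta>, k)" "f \<beta> k \<alpha> \<noteq> 0" by (auto simp: supp_def fun_eq_iff)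
  obtain g where g: "g \<in> N" "agree (Suc (deg \<alpha>)) f g" using a(1) by (auto simp: adherent_def)
  then have "g \<beta> k \<alpha> \<noteq> 0" using b by (auto simp: agree_def)
  then have "b \<in> supp g" using b by (auto simp: supp_def fun_eq_iff)
  then show "b \<in> B" using a(2) g by auto
qed

lemma adherent_mono: "adherent N f \<Longrightarrow> N \<subseteq> N' \<Longrightarrow> adherent N' f"
  by (auto simp: adherent_def)

lemma mem_adherent: "f \<in> N \<Longrightarrow> adherent N f"
  unfolding adherent_def using agree_refl by blast

lemma adherentE:
  assumes "adherent N f"
  obtains g where "g \<in> N" "agree d f g"
  using assms unfolding adherent_def by blast

definition htrunc :: "nat \<Rightarrow> ('k::field, 'n::finite) hop \<Rightarrow> ('k, 'n) hop" where
  "htrunc d v = (\<lambda>\<beta> k. mfps_trunc d (v \<beta> k))"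

lemma supp_htrunc: "supp (htrunc d v) \<subseteq> supp v"
  by (auto simp: supp_def htrunc_def mfps_trunc_def fun_eq_iff split: if_splits)

section \<open>Extension to formal power series\<close>

text \<open>Every element of the closure is required to be approximated by elements of one finitely
  generated free module, since the closedness axiom is about such modules only.\<close>

definition hat :: "('k::field, 'n::finite) mfps set \<Rightarrow> ('k, 'n) hop set \<Rightarrow> ('k, 'n) hop set" where
  "hat C N = {f. \<exists>B. finite B \<and> adherent (N \<inter> free C B) f}"

lemma hat_finite_supp: "f \<in> hat C N \<Longrightarrow> finite (supp f)"
proof -
  assume "f \<in> hat C N"
  then obtain B where B: "finite B" "adherent (N \<inter> free C B) f" by (auto simp: hat_def)
  have "supp f \<subseteq> B" using B(2) by (rule adherent_supp) (auto simp: free_def)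
  then show ?thesis using B(1) by (rule finite_subset)
qed

text \<open>Two approximations may be supported in different finite sets; their union serves for the sum.\<close>

lemma hat_add:
  assumes f: "f \<in> hat C N" and f': "f' \<in> hat C N"
    and N: "\<And>u v. u \<in> N \<Longrightarrow> v \<in> N \<Longrightarrow> u + v \<in> N" and C: "\<And>c d. c \<in> C \<Longrightarrow> d \<in> C \<Longrightarrow> c + d \<in> C"
  shows "f + f' \<in> hat C N"
proof -
  obtain B B' where B: "finite B" "adherent (N \<inter> free C B) f" "finite B'" "adherent (N \<inter> free C B') f'"
    using f f' by (auto simp: hat_def)
  have "adherent (N \<inter> free C (B \<union> B')) (f + f')"
    unfolding adherent_def
  proof
    fix d
    obtain g g' where g: "g \<in> N \<inter> free C B" "agree d f g" "g' \<in> N \<inter> free C B'" "agree d f' g'"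
      using adherentE[OF B(2), of d] adherentE[OF B(4), of d] by metis
    have "g + g' \<in> N \<inter> free C (B \<union> B')"
      using g supp_add[of g g'] by (auto simp: free_def N C)
    then show "\<exists>h\<in>N \<inter> free C (B \<union> B'). agree d (f + f') h"
      using agree_add[OF g(2,4)] by blast
  qed
  then show ?thesis using B by (auto simp: hat_def)
qed

text \<open>The shift of one in the order of approximation makes room for an operation that differentiates.\<close>

lemma hat_image:
  assumes f: "f \<in> hat C N"
    and supp: "\<And>B. finite B \<Longrightarrow> \<exists>B'. finite B' \<and> (\<forall>v\<in>N \<inter> free C B. \<Phi> v \<in> N' \<inter> free C' B')"
    and cont: "\<And>d g. agree (Suc d) f g \<Longrightarrow> g \<in> N \<Longrightarrow> agree d (\<Psi> f) (\<Phi> g)"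
  shows "\<Psi> f \<in> hat C' N'"
proof -
  obtain B where B: "finite B" "adherent (N \<inter> free C B) f"
    using f by (auto simp: hat_def)
  obtain B' where B': "finite B'" "\<forall>v\<in>N \<inter> free C B. \<Phi> v \<in> N' \<inter> free C' B'"
    using supp[OF B(1)] by blast
  have "adherent (N' \<inter> free C' B') (\<Psi> f)"
    unfolding adherent_def
  proof
    fix d
    obtain g where g: "g \<in> N \<inter> free C B" "agree (Suc d) f g"
      by (rule adherentE[OF B(2), of "(Suc d)"])
    then show "\<exists>h\<in>N' \<inter> free C' B'. agree d (\<Psi> f) h"
      using B' cont[OF g(2)] by blast
  qed
  then show ?thesis using B' by (auto simp: hat_def)
qed

context coefficient_ring
begin

lemma zero_mem: "0 \<in> C" using polynomials zero_polynomial by auto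

lemma one_mem: "mfps_one \<in> C" using polynomials one_polynomial by auto

lemma uminus_mem: "c \<in> C \<Longrightarrow> - c \<in> C"
  using mult[of "mfps_monom (-1) 0" c] polynomials monom_polynomial by (auto simp: mfps_mult_minus_one)

lemma lmul_free: "c \<in> C \<Longrightarrow> v \<in> free C B \<Longrightarrow> lmul c v \<in> free C B"
  using supp_lmul[of c v] by (auto simp: free_def lmul_def mult)

lemma add_free: "u \<in> free C B \<Longrightarrow> v \<in> free C B \<Longrightarrow> u + v \<in> free C B"
  using supp_add[of u v] by (auto simp: free_def add)

lemma zero_free: "0 \<in> free C B"
  by (auto simp: free_def zero_mem)

lemma htrunc_free: "supp v \<subseteq> B \<Longrightarrow> htrunc d v \<in> free C B"
  using supp_htrunc[of d v] subsetD[OF polynomials mfps_trunc_polynomial]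
  by (auto simp: free_def htrunc_def)

lemma submodule_Int_free: "submodule C N \<Longrightarrow> submodule C (N \<inter> free C B)"
  by (auto simp: submodule_def zero_free add_free lmul_free)

lemma subset_hat:
  assumes "v \<in> N" "finite (supp v)" "\<And>\<beta> k. v \<beta> k \<in> C"
  shows "v \<in> hat C N"
  unfolding hat_def using assms by (auto simp: free_def intro!: exI[of _ "supp v"] mem_adherent)

text \<open>The factor \<open>c\<close> is an arbitrary formal series: replacing it by its truncations stays within \<open>C\<close> and
  changes the product in high order only.\<close>

lemma hat_lmul:
  assumes f: "f \<in> hat C N" and N: "submodule C N"
  shows "lmul c f \<in> hat C N"
proof -
  obtain B where B: "finite B" "adherent (N \<inter> free C B) f"
    using f by (auto simp: hat_def)
  have "adherent (N \<inter> free C B) (lmul c f)"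
    unfolding adherent_def
  proof
    fix d
    obtain g where g: "g \<in> N \<inter> free C B" "agree d f g"
      by (rule adherentE[OF B(2), of "d"])
    have "mfps_trunc d c \<in> C" using mfps_trunc_polynomial polynomials by auto
    then have "lmul (mfps_trunc d c) g \<in> N \<inter> free C B"
      using g N lmul_free by (auto simp: submodule_def)
    then show "\<exists>h\<in>N \<inter> free C B. agree d (lmul c f) h"
      using agree_lmul[OF mfps_order_ge_trunc g(2)] by blast
  qed
  then show ?thesis using B by (auto simp: hat_def)
qed

lemma hmul_free: "v \<in> free C B \<Longrightarrow> hmul v \<in> free C ((\<lambda>(\<beta>, k). (\<beta>, Suc k)) ` B)"
  using supp_hmul[of v] by (fastforce simp: free_def hmul_def zero_mem)

lemma pmul_free: "v \<in> free C B \<Longrightarrow>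
    pmul t i v \<in> free C ((\<lambda>(\<beta>, k). (\<beta> + single i, k)) ` B \<union> (\<lambda>(\<beta>, k). (\<beta>, k + t)) ` B)"
  using supp_pmul[of t i v] by (fastforce simp: free_def pmul_def intro!: add deriv zero_mem)

lemma hat_hmul:
  assumes "f \<in> hat C N" "\<And>v. v \<in> N \<Longrightarrow> hmul v \<in> N"
  shows "hmul f \<in> hat C N"
proof (rule hat_image[OF assms(1), where \<Phi> = hmul])
  fix B :: "('n expo \<times> nat) set" assume "finite B"
  then show "\<exists>B'. finite B' \<and> (\<forall>v\<in>N \<inter> free C B. hmul v \<in> N \<inter> free C B')"
    using hmul_free assms(2) by (intro exI[of _ "(\<lambda>(\<beta>, k). (\<beta>, Suc k)) ` B"]) auto
qed (auto intro: agree_hmul agree_mono)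

lemma hat_pmul:
  assumes "f \<in> hat C N" "\<And>v. v \<in> N \<Longrightarrow> pmul t i v \<in> N"
  shows "pmul t i f \<in> hat C N"
proof (rule hat_image[OF assms(1), where \<Phi> = "pmul t i"])
  fix B :: "('n expo \<times> nat) set" assume "finite B"
  then show "\<exists>B'. finite B' \<and> (\<forall>v\<in>N \<inter> free C B. pmul t i v \<in> N \<inter> free C B')"
    using pmul_free assms(2)
    by (intro exI[of _ "(\<lambda>(\<beta>, k). (\<beta> + single i, k)) ` B \<union> (\<lambda>(\<beta>, k). (\<beta>, k + t)) ` B"]) auto
qed (rule agree_pmul)

text \<open>This replaces the flatness of the formal power series over \<open>C\<close>: intersecting with a
  submodule given by a condition on the monomials commutes with the extension. An approximation
  \<open>y\<close> of \<open>f\<close> in \<open>N\<close> is congruent, modulo elements of \<open>N\<close> of high order, to truncations of \<open>f\<close>;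
  closedness turns these congruences into a decomposition of \<open>y\<close>.\<close>

lemma hat_restrict:
  assumes N: "submodule C N" and f: "f \<in> hat C N"
    and S: "\<And>\<beta> k \<alpha>. f \<beta> k \<alpha> \<noteq> 0 \<Longrightarrow> S \<beta> k \<alpha>"
    and mono: "\<And>\<beta> k \<alpha> \<alpha>'. S \<beta> k \<alpha> \<Longrightarrow> \<alpha> \<le> \<alpha>' \<Longrightarrow> S \<beta> k \<alpha>'"
  shows "f \<in> hat C {v \<in> N. \<forall>\<beta> k \<alpha>. v \<beta> k \<alpha> \<noteq> 0 \<longrightarrow> S \<beta> k \<alpha>}"
proof -
  obtain B where B: "finite B" "adherent (N \<inter> free C B) f"
    using f by (auto simp: hat_def)
  have suppf: "supp f \<subseteq> B" using B(2) by (rule adherent_supp) (auto simp: free_def)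
  define F where "F = {v \<in> free C B. \<forall>\<beta> k \<alpha>. v \<beta> k \<alpha> \<noteq> 0 \<longrightarrow> S \<beta> k \<alpha>}"
  have F: "submodule C F"
    unfolding submodule_def
  proof (intro conjI ballI)
    show "0 \<in> F" by (auto simp: F_def zero_free)
  next
    fix u v assume uv: "u \<in> F" "v \<in> F"
    have "S \<beta> k \<alpha>" if "(u + v) \<beta> k \<alpha> \<noteq> 0" for \<beta> k \<alpha>
    proof -
      have "u \<beta> k \<alpha> \<noteq> 0 \<or> v \<beta> k \<alpha> \<noteq> 0" using that by auto
      then show ?thesis using uv by (auto simp: F_def)
    qed
    moreover have "u + v \<in> free C B" using uv by (intro add_free) (simp_all add: F_def)
    ultimately show "u + v \<in> F" by (simp add: F_def del: plus_fun_apply)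
  next
    fix c v assume c: "c \<in> C" and v: "v \<in> F"
    have "S \<beta> k \<alpha>" if "lmul c v \<beta> k \<alpha> \<noteq> 0" for \<beta> k \<alpha>
    proof -
      have "(\<Sum>\<gamma>\<in>{..\<alpha>}. c \<gamma> * v \<beta> k (\<alpha> - \<gamma>)) \<noteq> 0"
        using that by (simp add: lmul_def mfps_mult_eq)
      then obtain \<gamma> where "\<gamma> \<in> {..\<alpha>}" "c \<gamma> * v \<beta> k (\<alpha> - \<gamma>) \<noteq> 0"
        by (rule sum.not_neutral_contains_not_neutral)
      then have "v \<beta> k (\<alpha> - \<gamma>) \<noteq> 0" by auto
      then have "S \<beta> k (\<alpha> - \<gamma>)" using v by (auto simp: F_def)
      then show ?thesis by (rule mono) simp
    qed
    then show "lmul c v \<in> F" using c v by (auto simp: F_def lmul_free)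
  qed
  have "adherent ({v \<in> N. \<forall>\<beta> k \<alpha>. v \<beta> k \<alpha> \<noteq> 0 \<longrightarrow> S \<beta> k \<alpha>} \<inter> free C B) f"
    unfolding adherent_def
  proof
    fix d
    \<comment> \<open>the elements of the module of order at least \<open>d\<close>\<close>
    define Z where "Z = {z \<in> N \<inter> free C B. agree d z 0}"
    have Z: "submodule C Z"
      unfolding submodule_def
    proof (intro conjI ballI)
      show "0 \<in> Z" using N by (auto simp: Z_def zero_free submodule_def)
    next
      fix u v assume "u \<in> Z" "v \<in> Z"
      then show "u + v \<in> Z" using N agree_add[of d u 0 v 0] by (auto simp: Z_def add_free submodule_def)
    next
      fix c v assume cv: "c \<in> C" "v \<in> Z"
      have "agree d (lmul c v) (lmul c 0)"
        using cv by (intro agree_lmul) (auto simp: Z_def mfps_order_ge_def)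
      moreover have "lmul c 0 = 0" by (simp add: lmul_def fun_eq_iff)
      ultimately show "lmul c v \<in> Z" using cv N by (auto simp: Z_def lmul_free submodule_def)
    qed
    define N' where "N' = {s + z | s z. s \<in> F \<and> z \<in> Z}"
    have N': "submodule C N'"
      unfolding submodule_def
    proof (intro conjI ballI)
      have "0 + 0 \<in> N'" using F Z unfolding N'_def submodule_def by blast
      then show "0 \<in> N'" by simp
    next
      fix u v assume "u \<in> N'" "v \<in> N'"
      then obtain s z s' z' where "u = s + z" "v = s' + z'" "s \<in> F" "z \<in> Z" "s' \<in> F" "z' \<in> Z"
        by (auto simp: N'_def)
      moreover have "(s + z) + (s' + z') = (s + s') + (z + z')" by (simp add: algebra_simps)
      ultimately show "u + v \<in> N'" using F Z unfolding N'_def submodule_def by blast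
    next
      fix c v assume "c \<in> C" "v \<in> N'"
      then obtain s z where "v = s + z" "s \<in> F" "z \<in> Z" by (auto simp: N'_def)
      then show "lmul c v \<in> N'"
        using F Z \<open>c \<in> C\<close> unfolding N'_def submodule_def by (simp only: lmul_add) blast
    qed
    have sub: "N' \<subseteq> free C B" by (auto simp: N'_def F_def Z_def add_free)
    obtain y where y: "y \<in> N \<inter> free C B" "agree d f y"
      by (rule adherentE[OF B(2), of "d"])
    have "adherent N' y"
      unfolding adherent_def
    proof
      fix e
      obtain y' where y': "y' \<in> N \<inter> free C B" "agree (max d e) f y'"
        by (rule adherentE[OF B(2), of "max d e"])
      have "y - y' \<in> N \<inter> free C B"
        using submodule_diff[OF polynomials submodule_Int_free[OF N]] y y' by blast
      moreover have "agree d (y - y') 0"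
        using y(2) y'(2) by (auto simp: agree_def)
      ultimately have "y - y' \<in> Z" by (simp add: Z_def)
      moreover have "htrunc e f \<in> F"
        using htrunc_free[OF suppf] S by (auto simp: F_def htrunc_def mfps_trunc_def)
      ultimately have "htrunc e f + (y - y') \<in> N'" by (auto simp: N'_def)
      moreover have "agree e y (htrunc e f + (y - y'))"
        using y'(2) by (auto simp: agree_def htrunc_def mfps_trunc_def)
      ultimately show "\<exists>g\<in>N'. agree e y g" by blast
    qed
    then have "y \<in> N'" using y by (intro closed[OF B(1) sub N']) auto
    then obtain s z where sz: "y = s + z" "s \<in> F" "z \<in> Z" by (auto simp: N'_def)
    have "y - z \<in> N" using submodule_diff[OF polynomials N, of y z] y(1) sz(3) by (simp add: Z_def)
    moreover have "y - z = s" unfolding sz(1) by (rule add_diff_cancel_right')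
    ultimately have "s \<in> N" by simp
    moreover have "agree d f s" using y(2) sz by (auto simp: agree_def Z_def)
    ultimately show "\<exists>g\<in>{v \<in> N. \<forall>\<beta> k \<alpha>. v \<beta> k \<alpha> \<noteq> 0 \<longrightarrow> S \<beta> k \<alpha>} \<inter> free C B. agree d f g"
      using sz by (auto simp: F_def)
  qed
  then show ?thesis using B by (auto simp: hat_def)
qed

end

section \<open>Left ideals\<close>

lemma additive_subgroup_iff:
  fixes A :: "'a::ab_group_add ring"
  assumes "zero A = 0" "add A = (+)" and uminus: "\<And>x. x \<in> carrier A \<Longrightarrow> - x \<in> carrier A"
  shows "additive_subgroup J A \<longleftrightarrow> J \<subseteq> carrier A \<and> 0 \<in> J \<and> (\<forall>x\<in>J. \<forall>y\<in>J. x + y \<in> J) \<and> (\<forall>x\<in>J. - x \<in> J)"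
proof -
  have inv: "m_inv (add_monoid A) x = - x" if "x \<in> carrier A" for x
    unfolding m_inv_def using that uminus assms
    by (intro the_equality) (auto simp: minus_unique)
  show ?thesis
  proof
    assume "additive_subgroup J A"
    then have "subgroup J (add_monoid A)" by (simp add: additive_subgroup_def)
    note s = subgroup.subset[OF this] subgroup.one_closed[OF this]
      subgroup.m_closed[OF this] subgroup.m_inv_closed[OF this]
    have "- x \<in> J" if "x \<in> J" for x using s(4)[OF that] inv[of x] s(1) that by auto
    then show "J \<subseteq> carrier A \<and> 0 \<in> J \<and> (\<forall>x\<in>J. \<forall>y\<in>J. x + y \<in> J) \<and> (\<forall>x\<in>J. - x \<in> J)"
      using s assms by auto
  next
    assume *: "J \<subseteq> carrier A \<and> 0 \<in> J \<and> (\<forall>x\<in>J. \<forall>y\<in>J. x + y \<in> J) \<and> (\<forall>x\<in>J. - x \<in> J)"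
    have "m_inv (add_monoid A) x \<in> J" if "x \<in> J" for x
      using inv[of x] * that by auto
    then show "additive_subgroup J A"
      using * assms by (auto simp: additive_subgroup_def subgroup_def)
  qed
qed

lemma carrier_hop_ring: "P \<in> carrier (hop_ring C) \<longleftrightarrow> finite (supp P) \<and> (\<forall>\<beta> k. P \<beta> k \<in> C)"
  by (simp add: hop_ring_def supp_def)

lemma finite_supp_lift:
  assumes "finite {\<beta>. P \<beta> \<noteq> 0}"
  shows "finite (supp (lift P))"
  by (rule finite_subset[OF _ finite_imageI[OF assms, of "\<lambda>\<beta>. (\<beta>, 0)"]])
    (auto simp: supp_def lift_def split: if_splits)

lemma finite_supp_liftD:
  assumes "finite (supp (lift P))"
  shows "finite {\<beta>. P \<beta> \<noteq> 0}"
  by (rule finite_subset[OF _ finite_imageI[OF assms, of fst]])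
    (force simp: supp_def lift_def image_iff)

lemma lift_add: "lift (P + Q) = lift P + lift Q"
  by (simp add: lift_def fun_eq_iff)

lemma lift_zero [simp]: "lift 0 = 0"
  by (simp add: lift_def fun_eq_iff)

lemma lift_lmul: "lift (\<lambda>\<beta>. mfps_mult c (P \<beta>)) = lmul c (lift P)"
  by (simp add: lift_def lmul_def fun_eq_iff)

lemma lift_pmul: "lift (\<lambda>\<delta>. pmul 0 i (lift P) \<delta> 0) = pmul 0 i (lift P)"
  by (simp add: lift_def pmul_def fun_eq_iff)

lemma lift_inj: "lift P = lift Q \<Longrightarrow> P = Q"
  unfolding lift_def fun_eq_iff by (metis (full_types))

lemma lift_at_0: "lift P \<beta> 0 = P \<beta>"
  by (simp add: lift_def)

lemma lift_monom: "lift (\<lambda>\<beta>. if \<beta> = \<gamma> then c else 0) = monom c \<gamma> 0"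
  by (auto simp: lift_def monom_def fun_eq_iff)

context coefficient_ring
begin

lemma additive_subgroup_hop:
  "additive_subgroup J (hop_ring C) \<longleftrightarrow> J \<subseteq> carrier (hop_ring C) \<and> 0 \<in> J
     \<and> (\<forall>x\<in>J. \<forall>y\<in>J. x + y \<in> J) \<and> (\<forall>x\<in>J. - x \<in> J)"
  by (rule additive_subgroup_iff) (auto simp: carrier_hop_ring uminus_mem, simp_all add: hop_ring_def)

lemma additive_subgroup_dop:
  "additive_subgroup J (dop_ring C) \<longleftrightarrow> J \<subseteq> carrier (dop_ring C) \<and> 0 \<in> J
     \<and> (\<forall>x\<in>J. \<forall>y\<in>J. x + y \<in> J) \<and> (\<forall>x\<in>J. - x \<in> J)"
  by (rule additive_subgroup_iff) (auto simp: dop_ring_def uminus_mem)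

lemma left_ideal_hopI:
  assumes sub: "J \<subseteq> carrier (hop_ring C)" and sm: "submodule C J"
    and h: "\<And>v. v \<in> J \<Longrightarrow> hmul v \<in> J" and p: "\<And>i v. v \<in> J \<Longrightarrow> pmul 1 i v \<in> J"
  shows "left_ideal J (hop_ring C)"
  unfolding left_ideal_def additive_subgroup_hop
proof (intro conjI ballI)
  fix P Q assume "P \<in> carrier (hop_ring C)" "Q \<in> J"
  then have "gmul 1 P Q \<in> J"
    using sm by (intro gmul_closed[where C = C] h p) (auto simp: carrier_hop_ring supp_def submodule_def)
  then show "P \<otimes>\<^bsub>hop_ring C\<^esub> Q \<in> J" by (simp add: hop_ring_def hop_mult_gmul)
next
  fix v assume "v \<in> J" then show "- v \<in> J" using submodule_uminus[OF polynomials sm] by simp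
qed (use sub sm in \<open>auto simp: submodule_def\<close>)

lemma monom_carrier: "c \<in> C \<Longrightarrow> monom c \<beta> k \<in> carrier (hop_ring C)"
  by (auto simp: carrier_hop_ring monom_def supp_def zero_mem split: if_splits
      intro!: finite_subset[of _ "{(\<beta>, k)}"])

lemma left_ideal_hopD:
  assumes J: "left_ideal J (hop_ring C)"
  shows "J \<subseteq> carrier (hop_ring C)" "submodule C J"
    "\<And>v. v \<in> J \<Longrightarrow> hmul v \<in> J" "\<And>i v. v \<in> J \<Longrightarrow> pmul 1 i v \<in> J"
proof -
  have gm: "gmul 1 P v \<in> J" if "P \<in> carrier (hop_ring C)" "v \<in> J" for P v
    using J that by (auto simp: left_ideal_def hop_ring_def hop_mult_gmul)
  have l: "lmul c v \<in> J" if "c \<in> C" "v \<in> J" for c v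
    unfolding lmul_gmul[of c v 1] using that by (intro gm monom_carrier)
  show "J \<subseteq> carrier (hop_ring C)" using J by (simp add: left_ideal_def additive_subgroup_hop)
  show "submodule C J" using J l by (auto simp: left_ideal_def additive_subgroup_hop submodule_def)
  show "hmul v \<in> J" if "v \<in> J" for v
    unfolding hmul_gmul[of v 1] using that by (intro gm monom_carrier one_mem)
  show "pmul 1 i v \<in> J" if "v \<in> J" for i v
    unfolding pmul_gmul[of 1 i v] using that by (intro gm monom_carrier one_mem)
qed

text \<open>Operators without \<open>h\<close> are multiplied by the specialization \<open>t = 0\<close>, for which the coefficient of
  \<open>h\<^sup>0\<close> in a product involves only such coefficients. So it suffices to look at the operators with
  \<open>h\<close> whose part free of \<open>h\<close> is in \<open>J\<close>.\<close>

lemma left_ideal_dopI: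
  assumes sub: "J \<subseteq> carrier (dop_ring C)" and sm: "submodule C (lift ` J)"
    and p: "\<And>i v. v \<in> lift ` J \<Longrightarrow> pmul 0 i v \<in> lift ` J"
  shows "left_ideal J (dop_ring C)"
proof -
  have l: "P \<in> J" if "lift P \<in> lift ` J" for P using that lift_inj by auto
  have add: "P + Q \<in> J" if "P \<in> J" "Q \<in> J" for P Q
    using that sm by (intro l) (auto simp: lift_add submodule_def)
  have zero: "0 \<in> J" using sm by (intro l) (auto simp: submodule_def)
  have lm: "(\<lambda>\<beta>. mfps_mult c (P \<beta>)) \<in> J" if "c \<in> C" "P \<in> J" for c P
    using that sm by (intro l) (auto simp: lift_lmul submodule_def)
  define S :: "('k, 'n) hop set" where "S = {v. (\<lambda>\<delta>. v \<delta> 0) \<in> J}"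
  have S: "gmul 0 (lift P) (lift Q) \<in> S" if P: "P \<in> carrier (dop_ring C)" and Q: "Q \<in> J" for P Q
  proof (rule gmul_closed[where C = C])
    show "finite {(\<beta>, k). lift P \<beta> k \<noteq> 0}"
      using finite_supp_lift[of P] P by (simp add: supp_def dop_ring_def)
    show "lift P \<beta> k \<in> C" for \<beta> k using P by (simp add: dop_ring_def lift_def zero_mem)
    show "0 \<in> S" using zero by (simp add: S_def zero_fun_def)
    show "u + v \<in> S" if "u \<in> S" "v \<in> S" for u v
      using add[of "\<lambda>\<delta>. u \<delta> 0" "\<lambda>\<delta>. v \<delta> 0"] that by (simp add: S_def plus_fun_def)
    show "lmul c v \<in> S" if "c \<in> C" "v \<in> S" for c v
      using that lm[of c "\<lambda>\<delta>. v \<delta> 0"] by (simp add: S_def lmul_def)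
    show "hmul v \<in> S" if "v \<in> S" for v using zero by (simp add: S_def hmul_def zero_fun_def)
    show "pmul 0 i v \<in> S" if "v \<in> S" for i v
    proof -
      let ?P = "\<lambda>\<delta>. v \<delta> 0"
      have "pmul 0 i (lift ?P) \<in> lift ` J" using that by (intro p) (auto simp: S_def)
      then have "lift (\<lambda>\<delta>. pmul 0 i (lift ?P) \<delta> 0) \<in> lift ` J" by (simp only: lift_pmul)
      then have "(\<lambda>\<delta>. pmul 0 i (lift ?P) \<delta> 0) \<in> J" by (rule l)
      moreover have "pmul 0 i (lift ?P) \<delta> 0 = pmul 0 i v \<delta> 0" for \<delta>
        by (simp add: pmul_def lift_def)
      ultimately show ?thesis by (simp add: S_def)
    qed
    show "lift Q \<in> S" using Q by (simp add: S_def lift_at_0)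
  qed
  have "- P \<in> J" if "P \<in> J" for P
    using lm[of "mfps_monom (-1) 0" P] that polynomials monom_polynomial
    by (auto simp: mfps_mult_minus_one fun_Compl_def)
  then show ?thesis
    unfolding left_ideal_def additive_subgroup_dop
    using sub zero add S by (auto simp: dop_ring_def dop_mult_gmul S_def)
qed

lemma left_ideal_dopD:
  assumes J: "left_ideal J (dop_ring C)"
  shows "J \<subseteq> carrier (dop_ring C)" "submodule C (lift ` J)"
    "\<And>i v. v \<in> lift ` J \<Longrightarrow> pmul 0 i v \<in> lift ` J"
proof -
  have fin: "finite {\<beta>. (if \<beta> = \<gamma> then c else 0) \<noteq> 0}" for \<gamma> :: "'n expo" and c :: "('k, 'n) mfps"
    by (rule finite_subset[of _ "{\<gamma>}"]) auto
  have gm: "(\<lambda>\<delta>. gmul 0 (monom c \<beta> 0) (lift P) \<delta> 0) \<in> J" if "c \<in> C" "P \<in> J" for c \<beta> P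
  proof -
    let ?M = "\<lambda>\<gamma>. if \<gamma> = \<beta> then c else 0"
    have "?M \<in> carrier (dop_ring C)" using that(1) fin by (auto simp: dop_ring_def zero_mem)
    then have "dop_mult ?M P \<in> J" using J that(2) by (auto simp: left_ideal_def dop_ring_def)
    then show ?thesis by (simp add: dop_mult_gmul lift_monom)
  qed
  have l: "lmul c (lift P) \<in> lift ` J" if "c \<in> C" "P \<in> J" for c P
  proof -
    have "(\<lambda>\<delta>. lmul c (lift P) \<delta> 0) \<in> J" using gm[OF that, of 0] by (simp add: lmul_gmul[symmetric])
    moreover have "lift (\<lambda>\<delta>. lmul c (lift P) \<delta> 0) = lmul c (lift P)"
      by (simp add: lift_def lmul_def fun_eq_iff)
    ultimately show ?thesis by (metis imageI)
  qed
  show "pmul 0 i v \<in> lift ` J" if "v \<in> lift ` J" for i v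
  proof -
    obtain P where P: "v = lift P" "P \<in> J" using \<open>v \<in> lift ` J\<close> by blast
    have "(\<lambda>\<delta>. pmul 0 i (lift P) \<delta> 0) \<in> J" using gm[OF one_mem P(2), of "single i"]
      by (simp add: pmul_gmul[symmetric])
    then have "lift (\<lambda>\<delta>. pmul 0 i (lift P) \<delta> 0) \<in> lift ` J" by (rule imageI)
    then show ?thesis using P by (simp only: lift_pmul)
  qed
  show "J \<subseteq> carrier (dop_ring C)" using J by (simp add: left_ideal_def additive_subgroup_dop)
  have "lift P + lift Q \<in> lift ` J" if "P \<in> J" "Q \<in> J" for P Q
    using J that unfolding lift_add[symmetric] by (auto simp: left_ideal_def additive_subgroup_dop)
  moreover have "0 \<in> lift ` J" using J lift_zero by (force simp: left_ideal_def additive_subgroup_dop)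
  ultimately show "submodule C (lift ` J)" using l by (auto simp: submodule_def)
qed

lemma left_ideal_carrier: "left_ideal (carrier (hop_ring C)) (hop_ring C)"
proof (rule left_ideal_hopI)
  show "submodule C (carrier (hop_ring C))"
    unfolding submodule_def
  proof (intro conjI ballI)
    show "u + v \<in> carrier (hop_ring C)" if "u \<in> carrier (hop_ring C)" "v \<in> carrier (hop_ring C)" for u v
      using that finite_subset[OF supp_add[of u v]] by (simp add: carrier_hop_ring add)
    show "lmul c v \<in> carrier (hop_ring C)" if "c \<in> C" "v \<in> carrier (hop_ring C)" for c v
      using that finite_subset[OF supp_lmul[of c v]] by (simp add: carrier_hop_ring) (simp add: lmul_def mult)
  qed (simp add: carrier_hop_ring zero_mem)
  show "hmul v \<in> carrier (hop_ring C)" if "v \<in> carrier (hop_ring C)" for v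
    using that finite_subset[OF supp_hmul[of v]]
    by (simp add: carrier_hop_ring) (simp add: hmul_def zero_mem)
  show "pmul 1 i v \<in> carrier (hop_ring C)" if "v \<in> carrier (hop_ring C)" for i v
  proof -
    have "finite (supp v)" using that by (simp add: carrier_hop_ring)
    then have "finite (supp (pmul 1 i v))" by (intro finite_subset[OF supp_pmul[of 1 i v]]) auto
    then show ?thesis using that by (auto simp: carrier_hop_ring pmul_def intro!: add deriv zero_mem)
  qed
qed simp

text \<open>The generated ideal is an intersection over a nonempty family, as the carrier belongs to it.\<close>

lemma left_ideal_gen:
  assumes "S \<subseteq> carrier (hop_ring C)"
  shows "left_ideal (gen_left_ideal (hop_ring C) S) (hop_ring C)"
proof -
  let ?F = "{J. left_ideal J (hop_ring C) \<and> S \<subseteq> J}"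
  have mem: "carrier (hop_ring C) \<in> ?F"
    using assms left_ideal_carrier by simp
  have J: "additive_subgroup J (hop_ring C)" "\<And>a x. a \<in> carrier (hop_ring C) \<Longrightarrow> x \<in> J \<Longrightarrow> a \<otimes>\<^bsub>hop_ring C\<^esub> x \<in> J"
    if "J \<in> ?F" for J
    using that by (auto simp: left_ideal_def)
  note J' = J(1)[unfolded additive_subgroup_hop]
  show ?thesis
    unfolding gen_left_ideal_def left_ideal_def[of "\<Inter> ?F"] additive_subgroup_hop
  proof (intro conjI ballI)
    show "\<Inter> ?F \<subseteq> carrier (hop_ring C)" using mem by (rule Inter_lower)
    show "0 \<in> \<Inter> ?F" using J' by (intro InterI) blast
    show "x + y \<in> \<Inter> ?F" if "x \<in> \<Inter> ?F" "y \<in> \<Inter> ?F" for x y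
      using that J' by (intro InterI) blast
    show "- x \<in> \<Inter> ?F" if "x \<in> \<Inter> ?F" for x
      using that J' by (intro InterI) blast
    show "a \<otimes>\<^bsub>hop_ring C\<^esub> x \<in> \<Inter> ?F" if "a \<in> carrier (hop_ring C)" "x \<in> \<Inter> ?F" for a x
      using that J(2) by (intro InterI) blast
  qed
qed

end

lemma gen_left_ideal_least: "left_ideal J A \<Longrightarrow> S \<subseteq> J \<Longrightarrow> gen_left_ideal A S \<subseteq> J"
  by (auto simp: gen_left_ideal_def)

lemma gen_left_ideal_subset: "S \<subseteq> gen_left_ideal A S"
  by (auto simp: gen_left_ideal_def)

section \<open>Homogenization and extension\<close>

text \<open>Homogenization to a prescribed degree. In contrast to \<open>homogenize\<close> it is additive and continuous,
  and for \<open>d\<close> at least the order of \<open>P\<close> it is \<open>homogenize P\<close> times a power of \<open>h\<close>.\<close>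

definition homdeg :: "nat \<Rightarrow> ('k::field, 'n::finite) dop \<Rightarrow> ('k, 'n) hop" where
  "homdeg d P = (\<lambda>\<beta> k. if deg \<beta> + k = d then P \<beta> else 0)"

lemma homogenize_homdeg: "homogenize P = homdeg (dop_order P) P"
  by (simp add: homogenize_def homdeg_def)

lemma le_dop_order:
  assumes "finite {\<beta>. P \<beta> \<noteq> 0}" "P \<beta> \<noteq> 0"
  shows "deg \<beta> \<le> dop_order P"
proof -
  have "{deg \<beta> | \<beta>. P \<beta> \<noteq> 0} = deg ` {\<beta>. P \<beta> \<noteq> 0}" by auto
  then show ?thesis unfolding dop_order_def using assms by (intro Max_ge) auto
qed

lemma dop_order_le:
  assumes "finite {\<beta>. P \<beta> \<noteq> 0}" "P \<noteq> 0" "\<And>\<beta>. P \<beta> \<noteq> 0 \<Longrightarrow> deg \<beta> \<le> d"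
  shows "dop_order P \<le> d"
proof -
  have *: "{deg \<beta> | \<beta>. P \<beta> \<noteq> 0} = deg ` {\<beta>. P \<beta> \<noteq> 0}" by auto
  obtain \<beta> where "P \<beta> \<noteq> 0" using assms(2) by (auto simp: fun_eq_iff)
  then show ?thesis unfolding dop_order_def * using assms by (subst Max_le_iff) auto
qed

lemma funpow_hmul: "(hmul ^^ m) v \<beta> k = (if k < m then 0 else v \<beta> (k - m))"
proof (induction m arbitrary: k)
  case 0
  then show ?case by simp
next
  case (Suc m)
  have "(hmul ^^ Suc m) v \<beta> k = (if k = 0 then 0 else (hmul ^^ m) v \<beta> (k - 1))"
    by (simp add: hmul_def)
  then show ?case using Suc[of "k - 1"] by (cases k) auto
qed

lemma supp_homdeg: "supp (homdeg d P) \<subseteq> (\<lambda>(\<beta>, k). (\<beta>, d - deg \<beta>)) ` supp (lift P)"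
proof
  fix b assume "b \<in> supp (homdeg d P)"
  then obtain \<beta> where "b = (\<beta>, d - deg \<beta>)" "P \<beta> \<noteq> 0"
    by (auto simp: supp_def homdeg_def split: if_splits)
  then show "b \<in> (\<lambda>(\<beta>, k). (\<beta>, d - deg \<beta>)) ` supp (lift P)"
    by (force simp: supp_def lift_def image_iff)
qed

lemma carrier_dop_ring: "P \<in> carrier (dop_ring C) \<longleftrightarrow> finite {\<beta>. P \<beta> \<noteq> 0} \<and> (\<forall>\<beta>. P \<beta> \<in> C)"
  by (simp add: dop_ring_def)

context coefficient_ring
begin

lemma homdeg_mem:
  assumes I: "left_ideal I (dop_ring C)" and J: "left_ideal J (hop_ring C)" and "homogenize ` I \<subseteq> J"
    and Q: "Q \<in> I" and d: "\<And>\<beta>. Q \<beta> \<noteq> 0 \<Longrightarrow> deg \<beta> \<le> d"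
  shows "homdeg d Q \<in> J"
proof (cases "Q = 0")
  case True
  then have "homdeg d Q = 0" by (simp add: homdeg_def fun_eq_iff)
  then show ?thesis using left_ideal_hopD(2)[OF J] by (simp add: submodule_def)
next
  case False
  have fin: "finite {\<beta>. Q \<beta> \<noteq> 0}"
    using subsetD[OF left_ideal_dopD(1)[OF I] Q] unfolding carrier_dop_ring by (rule conjunct1)
  have le: "dop_order Q \<le> d" using fin False d by (rule dop_order_le)
  let ?m = "d - dop_order Q"
  have pow: "(hmul ^^ m) v \<in> J" if v: "v \<in> J" for m v
    by (induction m) (use v left_ideal_hopD(3)[OF J] in simp_all)
  have "homdeg d Q = (hmul ^^ ?m) (homogenize Q)"
  proof (intro ext)
    fix \<beta> k \<alpha>
    have "Q \<beta> \<noteq> 0 \<Longrightarrow> deg \<beta> \<le> dop_order Q" using le_dop_order[OF fin] .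
    then show "homdeg d Q \<beta> k \<alpha> = (hmul ^^ ?m) (homogenize Q) \<beta> k \<alpha>"
      using le by (cases "Q \<beta> = 0") (auto simp: funpow_hmul homdeg_def homogenize_def)
  qed
  moreover have "homogenize Q \<in> J" using assms(3) Q by blast
  ultimately show ?thesis using pow by simp
qed

lemma homogenize_carrier:
  assumes "P \<in> carrier (dop_ring C)"
  shows "homogenize P \<in> carrier (hop_ring C)"
proof -
  have P: "finite {\<beta>. P \<beta> \<noteq> 0}" "\<And>\<beta>. P \<beta> \<in> C" using assms by (simp_all add: carrier_dop_ring)
  have "finite (supp (homdeg (dop_order P) P))"
    by (rule finite_subset[OF supp_homdeg finite_imageI[OF finite_supp_lift[OF P(1)]]])
  moreover have "homdeg (dop_order P) P \<beta> k \<in> C" for \<beta> k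
    using P(2) zero_mem by (simp add: homdeg_def)
  ultimately show ?thesis unfolding carrier_hop_ring homogenize_homdeg by blast
qed

lemma left_ideal_homogenize_ideal:
  assumes "left_ideal I (dop_ring C)"
  shows "left_ideal (homogenize_ideal C I) (hop_ring C)"
  unfolding homogenize_ideal_def
proof (rule left_ideal_gen)
  show "homogenize ` I \<subseteq> carrier (hop_ring C)"
    using left_ideal_dopD(1)[OF assms] homogenize_carrier by blast
qed

end

lemma lift_carrier: "P \<in> carrier (dop_ring C) \<Longrightarrow> 0 \<in> C \<Longrightarrow> lift P \<in> carrier (hop_ring C)"
  using finite_supp_lift[of P] unfolding carrier_hop_ring carrier_dop_ring by (simp add: lift_def)

locale formal_extension = coefficient_ring C + formal: coefficient_ring "formal_series :: ('k, 'n) mfps set"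
  for C :: "('k::field, 'n::finite) mfps set"
begin

text \<open>Closedness over the formal power series: a formal module that contains \<open>N\<close> contains the limits of
  elements of \<open>N\<close>. So \<open>hat C N\<close> is the extension of \<open>N\<close> to formal coefficients.\<close>

lemma hat_subset:
  assumes L: "submodule formal_series L" and "N \<subseteq> L" and f: "f \<in> hat C N"
  shows "f \<in> L"
proof -
  obtain B where B: "finite B" "adherent (N \<inter> free C B) f"
    using f by (auto simp: hat_def)
  have suppf: "supp f \<subseteq> B" using B(2) by (rule adherent_supp) (auto simp: free_def)
  have "free C B \<subseteq> free formal_series B" by (auto simp: free_def formal_series_def)
  then have "N \<inter> free C B \<subseteq> L \<inter> free formal_series B" using assms(2) by blast
  then have "adherent (L \<inter> free formal_series B) f" by (rule adherent_mono[OF B(2)])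
  moreover have "f \<in> free formal_series B" using suppf by (simp add: free_def formal_series_def)
  ultimately have "f \<in> L \<inter> free formal_series B"
    by (intro formal.closed[OF B(1) Int_lower2 formal.submodule_Int_free[OF L]])
  then show ?thesis by (rule IntD1)
qed

lemma hat_carrier: "f \<in> hat C N \<Longrightarrow> f \<in> carrier (hop_ring formal_series)"
  using hat_finite_supp[of f C N] by (simp add: carrier_hop_ring formal_series_def)

lemma subset_hat_carrier: "N \<subseteq> carrier (hop_ring C) \<Longrightarrow> N \<subseteq> hat C N"
proof
  fix v assume "N \<subseteq> carrier (hop_ring C)" "v \<in> N"
  then show "v \<in> hat C N" using carrier_hop_ring[of v C] by (intro subset_hat) auto
qed

lemma hat_submodule:
  assumes N: "submodule C N"
  shows "submodule formal_series (hat C N)"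
proof -
  have "0 \<in> hat C N"
    using N by (intro subset_hat) (auto simp: submodule_def zero_mem)
  moreover have "f + g \<in> hat C N" if "f \<in> hat C N" "g \<in> hat C N" for f g
    using that N by (intro hat_add) (auto simp: submodule_def add)
  ultimately show ?thesis
    using hat_lmul[OF _ N] by (auto simp: submodule_def)
qed

lemma gen_dop_hat:
  assumes I: "left_ideal I (dop_ring C)"
  shows "P \<in> gen_left_ideal (dop_ring formal_series) I \<longleftrightarrow> lift P \<in> hat C (lift ` I)"
proof
  note Id = left_ideal_dopD[OF I]
  have "left_ideal {P. lift P \<in> hat C (lift ` I)} (dop_ring formal_series)"
  proof (rule formal.left_ideal_dopI)
    show "{P. lift P \<in> hat C (lift ` I)} \<subseteq> carrier (dop_ring formal_series)"
      using finite_supp_liftD[OF hat_finite_supp] by (auto simp: carrier_dop_ring formal_series_def)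
    note sm = hat_submodule[OF Id(2)]
    show "submodule formal_series (lift ` {P. lift P \<in> hat C (lift ` I)})"
      unfolding submodule_def
    proof (intro conjI ballI)
      have "lift 0 \<in> hat C (lift ` I)" using sm by (simp add: submodule_def)
      then show "0 \<in> lift ` {P. lift P \<in> hat C (lift ` I)}" by (metis CollectI imageI lift_zero)
    next
      fix u v assume "u \<in> lift ` {P. lift P \<in> hat C (lift ` I)}" "v \<in> lift ` {P. lift P \<in> hat C (lift ` I)}"
      then obtain P Q where PQ: "u = lift P" "v = lift Q" "lift P \<in> hat C (lift ` I)" "lift Q \<in> hat C (lift ` I)"
        by auto
      then have "lift (P + Q) \<in> hat C (lift ` I)" unfolding lift_add using sm by (simp add: submodule_def)
      then show "u + v \<in> lift ` {P. lift P \<in> hat C (lift ` I)}"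
        unfolding PQ(1,2) lift_add[symmetric] by (intro imageI CollectI)
    next
      fix c v assume "v \<in> lift ` {P. lift P \<in> hat C (lift ` I)}"
      then obtain P where P: "v = lift P" "lift P \<in> hat C (lift ` I)" by auto
      then have "lift (\<lambda>\<beta>. mfps_mult c (P \<beta>)) \<in> hat C (lift ` I)"
        unfolding lift_lmul using sm by (simp add: submodule_def formal_series_def)
      then show "lmul c v \<in> lift ` {P. lift P \<in> hat C (lift ` I)}"
        unfolding P(1) lift_lmul[symmetric] by (intro imageI) simp
    qed
    show "pmul 0 i v \<in> lift ` {P. lift P \<in> hat C (lift ` I)}"
      if v: "v \<in> lift ` {P. lift P \<in> hat C (lift ` I)}" for i v
    proof -
      obtain P where P: "v = lift P" "lift P \<in> hat C (lift ` I)" using v by auto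
      then have "lift (\<lambda>\<delta>. pmul 0 i (lift P) \<delta> 0) \<in> hat C (lift ` I)"
        unfolding lift_pmul by (intro hat_pmul Id(3))
      then have "lift (\<lambda>\<delta>. pmul 0 i (lift P) \<delta> 0) \<in> lift ` {P. lift P \<in> hat C (lift ` I)}"
        by (intro imageI) simp
      then show ?thesis unfolding lift_pmul P(1) .
    qed
  qed
  moreover have "I \<subseteq> {P. lift P \<in> hat C (lift ` I)}"
  proof -
    have "lift ` I \<subseteq> carrier (hop_ring C)"
      using Id(1) lift_carrier zero_mem by blast
    then show ?thesis using subset_hat_carrier by blast
  qed
  ultimately have "gen_left_ideal (dop_ring formal_series) I \<subseteq> {P. lift P \<in> hat C (lift ` I)}"
    by (rule gen_left_ideal_least)
  then show "P \<in> gen_left_ideal (dop_ring formal_series) I \<Longrightarrow> lift P \<in> hat C (lift ` I)" by blast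
next
  assume P: "lift P \<in> hat C (lift ` I)"
  show "P \<in> gen_left_ideal (dop_ring formal_series) I"
    unfolding gen_left_ideal_def
  proof (rule InterI)
    fix L assume L: "L \<in> {J. left_ideal J (dop_ring formal_series) \<and> I \<subseteq> J}"
    then have "submodule formal_series (lift ` L)" "lift ` I \<subseteq> lift ` L"
      using formal.left_ideal_dopD(2) by auto
    from hat_subset[OF this P] show "P \<in> L" using lift_inj by auto
  qed
qed

text \<open>The order of an operator is a condition on monomials, so an element of order \<open>d\<close> in the
  extension is a limit of elements of the ideal of order at most \<open>d\<close>; no cancellation of higher order
  terms has to be taken into account when homogenizing.\<close>

lemma homogenize_ideal_hat:
  assumes I: "left_ideal I (dop_ring C)"
  shows "homogenize_ideal formal_series (gen_left_ideal (dop_ring formal_series) I)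
    = hat C (homogenize_ideal C I)"
proof
  let ?I = "gen_left_ideal (dop_ring formal_series) I"
  let ?J = "homogenize_ideal C I"
  note Id = left_ideal_dopD[OF I]
  have J: "left_ideal ?J (hop_ring C)" using I by (rule left_ideal_homogenize_ideal)
  note Jd = left_ideal_hopD[OF J]
  have hI: "homogenize ` I \<subseteq> ?J" unfolding homogenize_ideal_def by (rule gen_left_ideal_subset)
  have "left_ideal (hat C ?J) (hop_ring formal_series)"
    using hat_carrier hat_hmul hat_pmul Jd by (intro formal.left_ideal_hopI hat_submodule) auto
  moreover have "homogenize ` ?I \<subseteq> hat C ?J"
  proof
    fix p assume "p \<in> homogenize ` ?I"
    then obtain P where P: "p = homogenize P" "P \<in> ?I" by auto
    then have lP: "lift P \<in> hat C (lift ` I)" using gen_dop_hat[OF I] by simp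
    let ?d = "dop_order P"
    let ?N = "{v \<in> lift ` I. \<forall>\<beta> k \<alpha>. v \<beta> k \<alpha> \<noteq> 0 \<longrightarrow> deg \<beta> \<le> ?d}"
    have fin: "finite {\<beta>. P \<beta> \<noteq> 0}" using hat_finite_supp[OF lP] by (rule finite_supp_liftD)
    have "lift P \<in> hat C ?N"
    proof (rule hat_restrict[OF Id(2) lP])
      show "deg \<beta> \<le> ?d" if "lift P \<beta> k \<alpha> \<noteq> 0" for \<beta> k \<alpha>
      proof -
        have "P \<beta> \<noteq> 0" using that by (auto simp: lift_def split: if_splits)
        then show ?thesis using le_dop_order[OF fin] by blast
      qed
    qed
    then have "(\<lambda>v. homdeg ?d (\<lambda>\<beta>. v \<beta> 0)) (lift P) \<in> hat C ?J"
    proof (rule hat_image[where \<Phi> = "\<lambda>v. homdeg ?d (\<lambda>\<beta>. v \<beta> 0)"])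
      fix B :: "('n expo \<times> nat) set" assume B: "finite B"
      let ?B = "(\<lambda>(\<beta>, k). (\<beta>, ?d - deg \<beta>)) ` B"
      have "homdeg ?d (\<lambda>\<beta>. v \<beta> 0) \<in> ?J \<inter> free C ?B" if v: "v \<in> ?N \<inter> free C B" for v
      proof -
        obtain Q where Q: "v = lift Q" "Q \<in> I" using v by auto
        have v0: "(\<lambda>\<beta>. v \<beta> 0) = Q" by (simp add: Q lift_at_0)
        have "homdeg ?d Q \<in> ?J"
        proof (rule homdeg_mem[OF I J hI Q(2)])
          fix \<beta> assume "Q \<beta> \<noteq> 0"
          then obtain \<alpha> where "Q \<beta> \<alpha> \<noteq> 0" by (auto simp: fun_eq_iff)
          then have "v \<beta> 0 \<alpha> \<noteq> 0" by (simp add: Q lift_at_0)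
          then show "deg \<beta> \<le> ?d" using v by blast
        qed
        moreover have "supp (homdeg ?d Q) \<subseteq> ?B"
        proof -
          have "supp (lift Q) \<subseteq> B" using v by (simp add: free_def Q(1))
          then show ?thesis using supp_homdeg[of ?d Q] by blast
        qed
        moreover have "homdeg ?d Q \<beta> k \<in> C" for \<beta> k
          using Id(1) Q(2) zero_mem by (auto simp: homdeg_def carrier_dop_ring)
        ultimately show ?thesis unfolding v0 by (simp add: free_def)
      qed
      then show "\<exists>B'. finite B' \<and> (\<forall>v\<in>?N \<inter> free C B. homdeg ?d (\<lambda>\<beta>. v \<beta> 0) \<in> ?J \<inter> free C B')"
        using B by (intro exI[of _ ?B]) blast
    next
      fix e g assume "agree (Suc e) (lift P) g"
      then show "agree e (homdeg ?d (\<lambda>\<beta>. lift P \<beta> 0)) (homdeg ?d (\<lambda>\<beta>. g \<beta> 0))"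
        by (auto simp: agree_def homdeg_def)
    qed
    then show "p \<in> hat C ?J" by (simp add: P(1) homogenize_homdeg lift_at_0)
  qed
  ultimately show "homogenize_ideal formal_series ?I \<subseteq> hat C ?J"
    unfolding homogenize_ideal_def[of formal_series] by (rule gen_left_ideal_least)
  have "I \<subseteq> ?I" by (rule gen_left_ideal_subset)
  have Ic: "?I \<subseteq> carrier (dop_ring formal_series)"
    using gen_dop_hat[OF I] finite_supp_liftD[OF hat_finite_supp]
    by (auto simp: carrier_dop_ring formal_series_def)
  let ?K = "homogenize_ideal formal_series ?I"
  have K: "left_ideal ?K (hop_ring formal_series)"
    unfolding homogenize_ideal_def using Ic formal.homogenize_carrier by (intro formal.left_ideal_gen) auto
  note Kd = formal.left_ideal_hopD[OF K]
  note Ad = left_ideal_hopD[OF left_ideal_carrier]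
  have "left_ideal (?K \<inter> carrier (hop_ring C)) (hop_ring C)"
  proof (rule left_ideal_hopI)
    show "submodule C (?K \<inter> carrier (hop_ring C))"
      using Kd(2) Ad(2) by (auto simp: submodule_def formal_series_def)
  qed (use Kd Ad in auto)
  moreover have "homogenize ` I \<subseteq> ?K \<inter> carrier (hop_ring C)"
  proof -
    have "homogenize ` ?I \<subseteq> ?K" unfolding homogenize_ideal_def by (rule gen_left_ideal_subset)
    then show ?thesis using \<open>I \<subseteq> ?I\<close> Id(1) homogenize_carrier by blast
  qed
  ultimately have "?J \<subseteq> ?K \<inter> carrier (hop_ring C)"
    unfolding homogenize_ideal_def[of C] by (rule gen_left_ideal_least)
  then show "hat C ?J \<subseteq> ?K" using hat_subset[OF Kd(2)] by blast
qed

end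

section \<open>Weights\<close>

lemma wt_add: "wt w (\<alpha> + \<alpha>') (\<beta> + \<beta>') = wt w \<alpha> \<beta> + wt w \<alpha>' \<beta>'"
  by (simp add: wt_def sum.distrib distrib_left)

text \<open>This is where \<open>u\<^sub>i + v\<^sub>i \<ge> 0\<close> enters: replacing \<open>x\<^sub>i \<partial>\<^sub>i\<close> by \<open>h\<close> does not raise the weight.\<close>

lemma wt_diag: "w \<in> W_loc \<Longrightarrow> 0 \<le> wt w \<gamma> \<gamma>"
proof -
  assume "w \<in> W_loc"
  then have "0 \<le> (fst w i + snd w i) * real (\<gamma> i)" for i by (auto simp: W_loc_def)
  then have "0 \<le> (\<Sum>i\<in>UNIV. (fst w i + snd w i) * real (\<gamma> i))" by (rule sum_nonneg)
  then show ?thesis by (simp add: wt_def sum.distrib distrib_right)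
qed

text \<open>Where \<open>u\<^sub>i < 0\<close>, a lower bound on the value bounds \<open>\<alpha>\<^sub>i\<close>; where \<open>u\<^sub>i = 0\<close>, the exponent \<open>\<alpha>\<^sub>i\<close> does not
  contribute to the value.\<close>

lemma finite_values:
  fixes u :: "'n::finite \<Rightarrow> real"
  assumes u: "\<And>i. u i \<le> 0"
  shows "finite {\<Sum>i\<in>UNIV. u i * real (\<alpha> i) | \<alpha>. (\<Sum>i\<in>UNIV. u i * real (\<alpha> i)) \<ge> c}"
proof -
  define N where "N i = nat \<lceil>c / u i\<rceil>" for i
  have "{\<Sum>i\<in>UNIV. u i * real (\<alpha> i) | \<alpha>. (\<Sum>i\<in>UNIV. u i * real (\<alpha> i)) \<ge> c}
      \<subseteq> (\<lambda>\<alpha>. \<Sum>i\<in>UNIV. u i * real (\<alpha> i)) ` {\<alpha>. \<forall>i. \<alpha> i \<le> N i}"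
  proof
    fix s assume "s \<in> {\<Sum>i\<in>UNIV. u i * real (\<alpha> i) | \<alpha>. (\<Sum>i\<in>UNIV. u i * real (\<alpha> i)) \<ge> c}"
    then obtain \<alpha> where s: "s = (\<Sum>i\<in>UNIV. u i * real (\<alpha> i))" and c: "s \<ge> c" by auto
    define \<alpha>' where "\<alpha>' i = (if u i = 0 then 0 else \<alpha> i)" for i
    have "\<alpha>' i \<le> N i" for i
    proof (cases "u i = 0")
      case False
      then have ui: "u i < 0" using u[of i] by simp
      have "(\<Sum>j\<in>UNIV. u j * real (\<alpha> j)) = u i * real (\<alpha> i) + (\<Sum>j\<in>UNIV - {i}. u j * real (\<alpha> j))"
        by (subst sum.remove[of _ i]) auto
      moreover have "(\<Sum>j\<in>UNIV - {i}. u j * real (\<alpha> j)) \<le> 0"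
        by (rule sum_nonpos) (auto intro!: mult_nonpos_nonneg u)
      ultimately have "c \<le> u i * real (\<alpha> i)" using c s by linarith
      then have "real (\<alpha> i) \<le> c / u i" using ui by (simp add: le_divide_eq mult.commute)
      then have "real (\<alpha> i) \<le> real_of_int \<lceil>c / u i\<rceil>" by linarith
      then show ?thesis using False by (simp add: \<alpha>'_def N_def)
    qed (simp add: \<alpha>'_def)
    moreover have "s = (\<Sum>i\<in>UNIV. u i * real (\<alpha>' i))"
      unfolding s by (rule sum.cong) (auto simp: \<alpha>'_def)
    ultimately show "s \<in> (\<lambda>\<alpha>. \<Sum>i\<in>UNIV. u i * real (\<alpha> i)) ` {\<alpha>. \<forall>i. \<alpha> i \<le> N i}" by auto
  qed
  then show ?thesis using finite_bounded_expos finite_subset by blast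
qed

lemma wt_split: "wt w \<alpha> \<beta> = (\<Sum>i\<in>UNIV. fst w i * real (\<alpha> i)) + wt w 0 \<beta>"
  by (simp add: wt_def)

lemma W_locD: "w \<in> W_loc \<Longrightarrow> fst w i \<le> 0"
  by (auto simp: W_loc_def)

lemma weights_of_greatest:
  assumes w: "w \<in> W_loc" and fin: "finite (supp P)" and "P \<noteq> 0"
  obtains m where "m \<in> weights_of w P" "\<And>m'. m' \<in> weights_of w P \<Longrightarrow> m' \<le> m"
proof -
  obtain m0 where m0: "m0 \<in> weights_of w P"
    using assms(3) by (auto simp: weights_of_def fun_eq_iff)
  let ?A = "{m \<in> weights_of w P. m0 \<le> m}"
  let ?V = "\<lambda>\<beta>. {\<Sum>i\<in>UNIV. fst w i * real (\<alpha> i) | \<alpha>. (\<Sum>i\<in>UNIV. fst w i * real (\<alpha> i)) \<ge> m0 - wt w 0 \<beta>}"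
  have "?A \<subseteq> (\<Union>b\<in>supp P. (\<lambda>s. s + wt w 0 (fst b)) ` ?V (fst b))"
  proof
    fix m assume "m \<in> ?A"
    then obtain \<alpha> \<beta> k where m: "m = wt w \<alpha> \<beta>" "P \<beta> k \<alpha> \<noteq> 0" "m0 \<le> m" by (auto simp: weights_of_def)
    then have "(\<beta>, k) \<in> supp P" by (auto simp: supp_def fun_eq_iff)
    moreover have "m \<in> (\<lambda>s. s + wt w 0 \<beta>) ` ?V \<beta>"
      using m wt_split[of w \<alpha> \<beta>] by (intro image_eqI[of _ _ "\<Sum>i\<in>UNIV. fst w i * real (\<alpha> i)"]) auto
    ultimately show "m \<in> (\<Union>b\<in>supp P. (\<lambda>s. s + wt w 0 (fst b)) ` ?V (fst b))" by force
  qed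
  then have "finite ?A"
    using fin finite_values[of "fst w", OF W_locD[OF w]] by (elim finite_subset) simp
  then have "Max ?A \<in> ?A" "\<And>m'. m' \<in> ?A \<Longrightarrow> m' \<le> Max ?A"
    using m0 Max_in[of ?A] Max_ge[of ?A] by blast+
  then show ?thesis using that[of "Max ?A"] by (metis (no_types, lifting) linear mem_Collect_eq order_trans)
qed

text \<open>In a term of the product that takes \<open>\<gamma>\<close> derivatives of the coefficient, both the exponents of \<open>x\<close>
  and of \<open>\<partial>\<close> drop by \<open>\<gamma>\<close>.\<close>

lemma weights_gmul:
  assumes w: "w \<in> W_loc" and nz: "gmul 1 P Q \<delta> l \<alpha> \<noteq> 0"
  obtains \<beta> k \<alpha>1 \<beta>' k' \<alpha>2 where "P \<beta> k \<alpha>1 \<noteq> 0" "Q \<beta>' k' \<alpha>2 \<noteq> 0" "wt w \<alpha> \<delta> \<le> wt w \<alpha>1 \<beta> + wt w \<alpha>2 \<beta>'"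
proof -
  let ?T = "{(\<beta>, k, \<beta>', k', \<gamma>). P \<beta> k \<noteq> 0 \<and> Q \<beta>' k' \<noteq> 0 \<and> \<gamma> \<le> \<beta> \<and> (\<beta> - \<gamma>) + \<beta>' = \<delta> \<and> k + k' + 1 * deg \<gamma> = l}"
  obtain b where b: "b \<in> ?T" "(\<lambda>(\<beta>, k, \<beta>', k', \<gamma>).
      of_nat (multi_choose \<beta> \<gamma>) * mfps_mult (P \<beta> k) (mfps_deriv \<gamma> (Q \<beta>' k')) \<alpha>) b \<noteq> 0"
    using nz unfolding gmul_def by (rule sum.not_neutral_contains_not_neutral)
  then obtain \<beta> k \<beta>' k' \<gamma> where *: "\<gamma> \<le> \<beta>" "(\<beta> - \<gamma>) + \<beta>' = \<delta>"
    "mfps_mult (P \<beta> k) (mfps_deriv \<gamma> (Q \<beta>' k')) \<alpha> \<noteq> 0" by (cases b) auto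
  obtain \<epsilon> where \<epsilon>: "\<epsilon> \<in> {..\<alpha>}" "P \<beta> k \<epsilon> * mfps_deriv \<gamma> (Q \<beta>' k') (\<alpha> - \<epsilon>) \<noteq> 0"
    using *(3) unfolding mfps_mult_eq by (rule sum.not_neutral_contains_not_neutral)
  then have Q: "Q \<beta>' k' (\<alpha> - \<epsilon> + \<gamma>) \<noteq> 0" by (auto simp: mfps_deriv_def)
  have "wt w \<epsilon> \<beta> + wt w (\<alpha> - \<epsilon> + \<gamma>) \<beta>' = wt w (\<epsilon> + (\<alpha> - \<epsilon> + \<gamma>)) (\<beta> + \<beta>')"
    by (simp add: wt_add)
  also have "\<epsilon> + (\<alpha> - \<epsilon> + \<gamma>) = \<alpha> + \<gamma>"
    using \<epsilon>(1) by (simp add: add.assoc[symmetric])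
  also have "\<beta> + \<beta>' = \<delta> + \<gamma>"
  proof -
    have "\<delta> + \<gamma> = (\<beta> - \<gamma> + \<gamma>) + \<beta>'" unfolding *(2)[symmetric] by (simp only: ac_simps)
    then show ?thesis using *(1) by simp
  qed
  also have "wt w (\<alpha> + \<gamma>) (\<delta> + \<gamma>) = wt w \<alpha> \<delta> + wt w \<gamma> \<gamma>" by (rule wt_add)
  finally have "wt w \<alpha> \<delta> \<le> wt w \<epsilon> \<beta> + wt w (\<alpha> - \<epsilon> + \<gamma>) \<beta>'" using wt_diag[OF w, of \<gamma>] by linarith
  then show ?thesis using that[of \<beta> k \<epsilon> \<beta>' k' "\<alpha> - \<epsilon> + \<gamma>"] \<epsilon>(2) Q by auto
qed

definition wt_le :: "'n::finite weight \<Rightarrow> real \<Rightarrow> ('k::field, 'n) hop \<Rightarrow> bool" where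
  "wt_le w m P \<longleftrightarrow> (\<forall>\<beta> k \<alpha>. P \<beta> k \<alpha> \<noteq> 0 \<longrightarrow> wt w \<alpha> \<beta> \<le> m)"

lemma filt_iff: "P \<in> filt w A m \<longleftrightarrow> P \<in> carrier A \<and> wt_le w m P"
  by (auto simp: filt_def weights_of_def wt_le_def)

lemma wt_le_gmul: "w \<in> W_loc \<Longrightarrow> wt_le w m P \<Longrightarrow> wt_le w m' Q \<Longrightarrow> wt_le w (m + m') (gmul 1 P Q)"
  unfolding wt_le_def[of w "m + m'"]
proof (intro allI impI)
  fix \<beta> k \<alpha> assume a: "w \<in> W_loc" "wt_le w m P" "wt_le w m' Q" "gmul 1 P Q \<beta> k \<alpha> \<noteq> 0"
  from a(1,4) show "wt w \<alpha> \<beta> \<le> m + m'"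
  proof (rule weights_gmul)
    fix \<beta>1 k1 \<alpha>1 \<beta>2 k2 \<alpha>2
    assume "P \<beta>1 k1 \<alpha>1 \<noteq> 0" "Q \<beta>2 k2 \<alpha>2 \<noteq> 0" "wt w \<alpha> \<beta> \<le> wt w \<alpha>1 \<beta>1 + wt w \<alpha>2 \<beta>2"
    moreover from this have "wt w \<alpha>1 \<beta>1 \<le> m" "wt w \<alpha>2 \<beta>2 \<le> m'" using a by (auto simp: wt_le_def)
    ultimately show ?thesis by linarith
  qed
qed

lemma w_part_add: "w_part w m (P + Q) = w_part w m P + w_part w m Q"
  by (auto simp: w_part_def fun_eq_iff)

lemma w_part_zero [simp]: "w_part w m 0 = 0"
  by (auto simp: w_part_def fun_eq_iff)

lemma w_part_uminus: "w_part w m (- P) = - w_part w m P"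
  by (auto simp: w_part_def fun_eq_iff)

lemma w_part_w_part: "w_part w m (w_part w m' P) = (if m = m' then w_part w m P else 0)"
  by (auto simp: w_part_def fun_eq_iff)

lemma wt_le_w_part: "wt_le w m (w_part w m P)"
  by (auto simp: wt_le_def w_part_def)

lemma supp_w_part: "supp (w_part w m P) \<subseteq> supp P"
  by (auto simp: supp_def w_part_def fun_eq_iff split: if_splits)

lemma wt_le_diff_eq:
  assumes "wt_le w m P" "wt_le w m P'" "w_part w m P = w_part w m P'" "(P - P') \<beta> k \<alpha> \<noteq> 0"
  shows "wt w \<alpha> \<beta> < m"
proof -
  have "wt w \<alpha> \<beta> \<noteq> m"
  proof
    assume "wt w \<alpha> \<beta> = m"
    then have "w_part w m P \<beta> k \<alpha> = P \<beta> k \<alpha>" "w_part w m P' \<beta> k \<alpha> = P' \<beta> k \<alpha>"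
      by (simp_all add: w_part_def)
    then show False using assms(3,4) by simp
  qed
  moreover have "P \<beta> k \<alpha> \<noteq> 0 \<or> P' \<beta> k \<alpha> \<noteq> 0" using assms(4) by auto
  then have "wt w \<alpha> \<beta> \<le> m" using assms(1,2) by (auto simp: wt_le_def)
  ultimately show ?thesis by simp
qed

text \<open>The product of classes in the graded ring is well defined.\<close>

lemma w_part_gmul:
  assumes w: "w \<in> W_loc" and fin: "finite (supp P)" "finite (supp P')"
    and P: "wt_le w m P" "wt_le w m P'" "w_part w m P = w_part w m P'"
    and Q: "wt_le w m' Q" "wt_le w m' Q'" "w_part w m' Q = w_part w m' Q'"
  shows "w_part w (m + m') (gmul 1 P Q) = w_part w (m + m') (gmul 1 P' Q')"
proof -
  have fin': "finite {(\<beta>, k). P' \<beta> k \<noteq> 0}" "finite {(\<beta>, k). (P - P') \<beta> k \<noteq> 0}"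
  proof -
    show "finite {(\<beta>, k). P' \<beta> k \<noteq> 0}" using fin(2) by (simp add: supp_def)
    show "finite {(\<beta>, k). (P - P') \<beta> k \<noteq> 0}"
      by (rule finite_subset[of _ "supp P \<union> supp P'"]) (use fin in \<open>auto simp: supp_def\<close>)
  qed
  have "gmul 1 P Q = gmul 1 (P' + (P - P')) Q" by simp
  also have "\<dots> = gmul 1 P' Q + gmul 1 (P - P') Q"
    using fin' by (rule gmul_add_left)
  also have "gmul 1 P' Q = gmul 1 P' (Q' + (Q - Q'))" by simp
  also have "\<dots> = gmul 1 P' Q' + gmul 1 P' (Q - Q')" using fin'(1) by (rule gmul_add_right)
  finally have eq: "gmul 1 P Q = gmul 1 P' Q' + gmul 1 P' (Q - Q') + gmul 1 (P - P') Q" .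
  have 1: "w_part w (m + m') (gmul 1 P' (Q - Q')) = 0"
  proof (intro ext)
    fix \<beta> k \<alpha>
    have "wt w \<alpha> \<beta> < m + m'" if nz: "gmul 1 P' (Q - Q') \<beta> k \<alpha> \<noteq> 0"
      using w nz
    proof (rule weights_gmul)
      fix \<beta>1 k1 \<alpha>1 \<beta>2 k2 \<alpha>2
      assume *: "P' \<beta>1 k1 \<alpha>1 \<noteq> 0" "(Q - Q') \<beta>2 k2 \<alpha>2 \<noteq> 0" "wt w \<alpha> \<beta> \<le> wt w \<alpha>1 \<beta>1 + wt w \<alpha>2 \<beta>2"
      have "wt w \<alpha>1 \<beta>1 \<le> m" using P(2) *(1) by (auto simp: wt_le_def)
      moreover have "wt w \<alpha>2 \<beta>2 < m'" using Q *(2) by (rule wt_le_diff_eq)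
      ultimately show ?thesis using *(3) by linarith
    qed
    then show "w_part w (m + m') (gmul 1 P' (Q - Q')) \<beta> k \<alpha> = 0 \<beta> k \<alpha>"
      by (cases "gmul 1 P' (Q - Q') \<beta> k \<alpha> = 0") (auto simp: w_part_def simp del: One_nat_def)
  qed
  have 2: "w_part w (m + m') (gmul 1 (P - P') Q) = 0"
  proof (intro ext)
    fix \<beta> k \<alpha>
    have "wt w \<alpha> \<beta> < m + m'" if nz: "gmul 1 (P - P') Q \<beta> k \<alpha> \<noteq> 0"
      using w nz
    proof (rule weights_gmul)
      fix \<beta>1 k1 \<alpha>1 \<beta>2 k2 \<alpha>2
      assume *: "(P - P') \<beta>1 k1 \<alpha>1 \<noteq> 0" "Q \<beta>2 k2 \<alpha>2 \<noteq> 0" "wt w \<alpha> \<beta> \<le> wt w \<alpha>1 \<beta>1 + wt w \<alpha>2 \<beta>2"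
      have "wt w \<alpha>2 \<beta>2 \<le> m'" using Q(1) *(2) by (auto simp: wt_le_def)
      moreover have "wt w \<alpha>1 \<beta>1 < m" using P *(1) by (rule wt_le_diff_eq)
      ultimately show ?thesis using *(3) by linarith
    qed
    then show "w_part w (m + m') (gmul 1 (P - P') Q) \<beta> k \<alpha> = 0 \<beta> k \<alpha>"
      by (cases "gmul 1 (P - P') Q \<beta> k \<alpha> = 0") (auto simp: w_part_def simp del: One_nat_def)
  qed
  show ?thesis unfolding eq w_part_add 1 2 by simp
qed

lemma wt_le_monom: "w \<in> W_loc \<Longrightarrow> wt_le w 0 (monom c 0 0)"
  unfolding wt_le_def
proof (intro allI impI)
  fix \<beta> :: "'a expo" and k \<alpha> assume w: "w \<in> W_loc" and "monom c 0 0 \<beta> k \<alpha> \<noteq> 0"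
  then have "\<beta> = 0" by (auto simp: monom_def split: if_splits)
  then show "wt w \<alpha> \<beta> \<le> 0"
    using W_locD[OF w] by (auto simp: wt_def intro!: sum_nonpos mult_nonpos_nonneg)
qed

lemma finite_supp_monom: "finite (supp (monom c \<beta> k))"
  by (rule finite_subset[of _ "{(\<beta>, k)}"]) (auto simp: supp_def monom_def split: if_splits)

lemma wt_le_lmul:
  assumes "w \<in> W_loc" "wt_le w m P"
  shows "wt_le w m (lmul c P)"
  using wt_le_gmul[OF assms(1) wt_le_monom[OF assms(1)] assms(2), of c]
  unfolding lmul_gmul[of c P 1] by simp

lemma w_part_lmul:
  assumes "w \<in> W_loc" "wt_le w m P" "wt_le w m P'" "w_part w m P = w_part w m P'"
  shows "w_part w m (lmul c P) = w_part w m (lmul c P')"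
  using w_part_gmul[OF assms(1) finite_supp_monom finite_supp_monom wt_le_monom wt_le_monom refl assms(2-4),
      OF assms(1) assms(1), of c]
  unfolding lmul_gmul[of c _ 1] by simp

lemma wt_le_add: "wt_le w m P \<Longrightarrow> wt_le w m Q \<Longrightarrow> wt_le w m (P + Q)"
  unfolding wt_le_def by (metis add_cancel_right_right plus_fun_apply)

lemma wt_le_zero [simp]: "wt_le w m 0"
  by (simp add: wt_le_def)

lemma w_part_agree: "agree d f g \<Longrightarrow> agree d (w_part w m f) (w_part w m g)"
  by (simp add: agree_def w_part_def)

lemma weights_w_part: "weights_of w (w_part w m P) \<subseteq> {m}"
  by (auto simp: weights_of_def w_part_def)

lemma sum_w_part:
  assumes "finite (weights_of w f)"
  shows "f = (\<Sum>m\<in>weights_of w f. w_part w m f)"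
proof (intro ext)
  fix \<beta> k \<alpha>
  have "(\<Sum>m\<in>weights_of w f. w_part w m f) \<beta> k \<alpha> = (\<Sum>m\<in>weights_of w f. if m = wt w \<alpha> \<beta> then f \<beta> k \<alpha> else 0)"
    unfolding fun_sum_apply by (rule sum.cong) (auto simp: w_part_def)
  also have "\<dots> = (if wt w \<alpha> \<beta> \<in> weights_of w f then f \<beta> k \<alpha> else 0)"
    using assms by simp
  also have "\<dots> = f \<beta> k \<alpha>" by (auto simp: weights_of_def)
  finally show "f \<beta> k \<alpha> = (\<Sum>m\<in>weights_of w f. w_part w m f) \<beta> k \<alpha>" ..
qed

lemma weights_of_add: "weights_of w (P + Q) \<subseteq> weights_of w P \<union> weights_of w Q"
proof
  fix m assume "m \<in> weights_of w (P + Q)"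
  then obtain \<alpha> \<beta> k where "m = wt w \<alpha> \<beta>" "P \<beta> k \<alpha> + Q \<beta> k \<alpha> \<noteq> 0" by (auto simp: weights_of_def)
  then have "m = wt w \<alpha> \<beta> \<and> (P \<beta> k \<alpha> \<noteq> 0 \<or> Q \<beta> k \<alpha> \<noteq> 0)" by auto
  then show "m \<in> weights_of w P \<union> weights_of w Q" unfolding weights_of_def by blast
qed

text \<open>Since the components of \<open>u\<close> are nonpositive, finiteness of the set of weights bounds the
  exponents of the variables in \<open>M_set w\<close>, and only these.\<close>

lemma finite_weights_M:
  assumes w: "w \<in> W_loc" and M: "M_set w = M_set w'" and w': "w' \<in> W_loc"
    and fin: "finite (supp f)" "finite (weights_of w f)"
  shows "finite (weights_of w' f)"
proof (cases "f = 0")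
  case False
  define N where "N b i = nat \<lceil>(Min (weights_of w f) - wt w 0 (fst b)) / fst w i\<rceil>" for b :: "'a expo \<times> nat" and i
  have "weights_of w' f \<subseteq> (\<Union>b\<in>supp f. (\<lambda>\<alpha>. wt w' \<alpha> (fst b)) ` {\<alpha>. \<forall>i. \<alpha> i \<le> N b i})"
  proof
    fix m assume "m \<in> weights_of w' f"
    then obtain \<alpha> \<beta> k where m: "m = wt w' \<alpha> \<beta>" "f \<beta> k \<alpha> \<noteq> 0" by (auto simp: weights_of_def)
    then have b: "(\<beta>, k) \<in> supp f" by (auto simp: supp_def fun_eq_iff)
    define \<alpha>' where "\<alpha>' i = (if fst w i < 0 then \<alpha> i else 0)" for i
    have z: "fst w' i = 0" if "\<not> fst w i < 0" for i
      using that M W_locD[OF w', of i] by (auto simp: M_set_def set_eq_iff)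
    have "m = wt w' \<alpha>' \<beta>"
      unfolding m wt_def by (auto simp: \<alpha>'_def z intro!: sum.cong)
    moreover have "\<alpha>' i \<le> N (\<beta>, k) i" for i
    proof (cases "fst w i < 0")
      case True
      have "wt w \<alpha> \<beta> \<in> weights_of w f" using m by (auto simp: weights_of_def)
      then have "Min (weights_of w f) \<le> wt w \<alpha> \<beta>" using fin by simp
      then have le: "Min (weights_of w f) - wt w 0 \<beta> \<le> (\<Sum>j\<in>UNIV. fst w j * real (\<alpha> j))"
        using wt_split[of w \<alpha> \<beta>] by linarith
      have "(\<Sum>j\<in>UNIV. fst w j * real (\<alpha> j)) = fst w i * real (\<alpha> i) + (\<Sum>j\<in>UNIV - {i}. fst w j * real (\<alpha> j))"
        by (subst sum.remove[of _ i]) auto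
      moreover have "(\<Sum>j\<in>UNIV - {i}. fst w j * real (\<alpha> j)) \<le> 0"
        by (rule sum_nonpos) (auto intro!: mult_nonpos_nonneg W_locD[OF w])
      ultimately have "Min (weights_of w f) - wt w 0 \<beta> \<le> fst w i * real (\<alpha> i)" using le by linarith
      then have "real (\<alpha> i) \<le> (Min (weights_of w f) - wt w 0 \<beta>) / fst w i"
        using True by (simp add: le_divide_eq mult.commute)
      then have "real (\<alpha> i) \<le> real_of_int \<lceil>(Min (weights_of w f) - wt w 0 \<beta>) / fst w i\<rceil>" by linarith
      then show ?thesis using True by (simp add: \<alpha>'_def N_def)
    qed (simp add: \<alpha>'_def)
    ultimately show "m \<in> (\<Union>b\<in>supp f. (\<lambda>\<alpha>. wt w' \<alpha> (fst b)) ` {\<alpha>. \<forall>i. \<alpha> i \<le> N b i})"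
      using b by (intro UN_I[of "(\<beta>, k)"]) auto
  qed
  moreover have "finite (\<Union>b\<in>supp f. (\<lambda>\<alpha>. wt w' \<alpha> (fst b)) ` {\<alpha>. \<forall>i. \<alpha> i \<le> N b i})"
    using fin(1) by (intro finite_UN_I finite_imageI finite_bounded_expos)
  ultimately show ?thesis by (rule finite_subset)
qed (simp add: weights_of_def)

section \<open>Initial ideals\<close>

text \<open>The graded left ideal of the classes of elements of \<open>J\<close>, defined without reference to the
  product of the graded ring.\<close>

definition graded ::
  "'n::finite weight \<Rightarrow> ('k::field, 'n) mfps set \<Rightarrow> ('k, 'n) hop set \<Rightarrow> ('k, 'n) hop set" where
  "graded w C J = {f. finite (weights_of w f)
     \<and> (\<forall>m. \<exists>P\<in>J. P \<in> carrier (hop_ring C) \<and> wt_le w m P \<and> w_part w m f = w_part w m P)}"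

lemma gr_carrier: "carrier (gr_ring w (hop_ring C)) = graded w C (carrier (hop_ring C))"
proof -
  have "(\<exists>P\<in>filt w (hop_ring C) m. w_part w m f = w_part w m P)
      \<longleftrightarrow> (\<exists>P\<in>carrier (hop_ring C). P \<in> carrier (hop_ring C) \<and> wt_le w m P \<and> w_part w m f = w_part w m P)"
    for m f
    unfolding Bex_def filt_iff by blast
  then show ?thesis by (simp add: gr_ring_def graded_def)
qed

lemma greatest_weight:
  assumes "wt_le w m P" "w_part w m P \<noteq> 0"
  shows "w_ord w P = m"
proof -
  obtain \<beta> k \<alpha> where "P \<beta> k \<alpha> \<noteq> 0" "wt w \<alpha> \<beta> = m"
    using assms(2) by (auto simp: w_part_def fun_eq_iff split: if_splits)
  then have "m \<in> weights_of w P" by (auto simp: weights_of_def)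
  then show ?thesis
    unfolding w_ord_def using assms(1) by (intro Greatest_equality) (auto simp: weights_of_def wt_le_def)
qed

lemma graded_mono: "J \<subseteq> J' \<Longrightarrow> carrier (hop_ring C) \<subseteq> carrier (hop_ring C') \<Longrightarrow> graded w C J \<subseteq> graded w C' J'"
proof
  fix f assume J: "J \<subseteq> J'" and C: "carrier (hop_ring C) \<subseteq> carrier (hop_ring C')" and f: "f \<in> graded w C J"
  have "\<exists>P\<in>J'. P \<in> carrier (hop_ring C') \<and> wt_le w m P \<and> w_part w m f = w_part w m P" for m
  proof -
    obtain P where "P \<in> J" "P \<in> carrier (hop_ring C)" "wt_le w m P" "w_part w m f = w_part w m P"
      using f by (auto simp: graded_def)
    then show ?thesis using J C by (intro bexI[of _ P]) auto
  qed
  then show "f \<in> graded w C' J'" using f by (simp add: graded_def)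
qed

context coefficient_ring
begin

lemma w_part_mem:
  assumes "w \<in> W_loc" "\<And>\<beta> k. P \<beta> k \<in> C"
  shows "w_part w m P \<beta> k \<in> C"
proof -
  have "w_part w m P \<beta> k = slice (fst w) (m - wt w 0 \<beta>) (P \<beta> k)"
  proof
    fix \<alpha>
    have "wt w \<alpha> \<beta> = m \<longleftrightarrow> (\<Sum>i\<in>UNIV. fst w i * real (\<alpha> i)) = m - wt w 0 \<beta>"
      using wt_split[of w \<alpha> \<beta>] by linarith
    then show "w_part w m P \<beta> k \<alpha> = slice (fst w) (m - wt w 0 \<beta>) (P \<beta> k) \<alpha>"
      by (simp add: w_part_def slice_def)
  qed
  then show ?thesis using slice[OF assms(2) W_locD[OF assms(1)]] by simp
qed

lemma w_part_carrier:
  assumes "w \<in> W_loc" "P \<in> carrier (hop_ring C)"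
  shows "w_part w m P \<in> carrier (hop_ring C)"
  using assms w_part_mem[OF assms(1), of P] finite_subset[OF supp_w_part[of w m P]]
  by (simp add: carrier_hop_ring)

lemma w_part_graded:
  assumes J: "left_ideal J (hop_ring C)" and P: "P \<in> J" "wt_le w m P"
  shows "w_part w m P \<in> graded w C J"
proof -
  have "finite (weights_of w (w_part w m P))"
    by (rule finite_subset[OF weights_w_part]) simp
  moreover have "\<exists>Q\<in>J. Q \<in> carrier (hop_ring C) \<and> wt_le w m' Q \<and> w_part w m' (w_part w m P) = w_part w m' Q" for m'
  proof (cases "m' = m")
    case True
    then show ?thesis using P left_ideal_hopD(1)[OF J] by (intro bexI[of _ P]) (auto simp: w_part_w_part)
  next
    case False
    then show ?thesis using left_ideal_hopD(1,2)[OF J]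
      by (intro bexI[of _ 0]) (auto simp: w_part_w_part submodule_def)
  qed
  ultimately show ?thesis by (simp add: graded_def)
qed

lemma graded_add:
  assumes J: "left_ideal J (hop_ring C)" and f: "f \<in> graded w C J" and g: "g \<in> graded w C J"
  shows "f + g \<in> graded w C J"
proof -
  note Jd = left_ideal_hopD[OF J]
  have "finite (weights_of w (f + g))"
    by (rule finite_subset[OF weights_of_add]) (use f g in \<open>simp add: graded_def\<close>)
  moreover have "\<exists>P\<in>J. P \<in> carrier (hop_ring C) \<and> wt_le w m P \<and> w_part w m (f + g) = w_part w m P" for m
  proof -
    obtain P where P: "P \<in> J" "wt_le w m P" "w_part w m f = w_part w m P" using f by (auto simp: graded_def)
    obtain Q where Q: "Q \<in> J" "wt_le w m Q" "w_part w m g = w_part w m Q" using g by (auto simp: graded_def)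
    have "P + Q \<in> J" using Jd(2) P Q by (simp add: submodule_def)
    then show ?thesis
      using P Q Jd(1) by (intro bexI[of _ "P + Q"]) (auto simp: w_part_add intro: wt_le_add)
  qed
  ultimately show ?thesis by (simp add: graded_def)
qed

lemma graded_zero:
  assumes "left_ideal J (hop_ring C)"
  shows "0 \<in> graded w C J"
  using w_part_graded[OF assms, of 0 w 0] left_ideal_hopD(2)[OF assms] by (simp add: submodule_def)

lemma weights_of_uminus: "weights_of w (- f) = weights_of w f"
  by (simp add: weights_of_def)

lemma graded_uminus:
  assumes J: "left_ideal J (hop_ring C)" and f: "f \<in> graded w C J"
  shows "- f \<in> graded w C J"
proof -
  note Jd = left_ideal_hopD[OF J]
  have "\<exists>P\<in>J. P \<in> carrier (hop_ring C) \<and> wt_le w m P \<and> w_part w m (- f) = w_part w m P" for m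
  proof -
    obtain P where P: "P \<in> J" "wt_le w m P" "w_part w m f = w_part w m P" using f by (auto simp: graded_def)
    have "- P \<in> J" using submodule_uminus[OF polynomials Jd(2) P(1)] .
    moreover have "wt_le w m (- P)" using P(2) by (simp add: wt_le_def)
    ultimately show ?thesis
      using P Jd(1) by (intro bexI[of _ "- P"]) (auto simp: w_part_uminus)
  qed
  then show ?thesis using f by (simp add: graded_def weights_of_uminus)
qed

lemma graded_gr_mult:
  assumes w: "w \<in> W_loc" and J: "left_ideal J (hop_ring C)"
    and a: "a \<in> graded w C (carrier (hop_ring C))" and f: "f \<in> graded w C J"
  shows "gr_mult w a f \<in> graded w C J"
proof -
  have "w_part w (m + m') (hop_mult (w_part w m a) (w_part w m' f)) \<in> graded w C J" for m m'
  proof -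
    obtain P where P: "P \<in> carrier (hop_ring C)" "wt_le w m P" "w_part w m a = w_part w m P"
      using a by (auto simp: graded_def)
    obtain Q where Q: "Q \<in> J" "wt_le w m' Q" "w_part w m' f = w_part w m' Q"
      using f by (auto simp: graded_def)
    have fin: "finite (supp P)" using P by (simp add: carrier_hop_ring)
    have "hop_mult P Q \<in> J" using J P(1) Q(1) by (auto simp: left_ideal_def hop_ring_def)
    then have "w_part w (m + m') (gmul 1 P Q) \<in> graded w C J"
      using w_part_graded[OF J] wt_le_gmul[OF w P(2) Q(2)] by (simp add: hop_mult_gmul)
    moreover have "w_part w (m + m') (gmul 1 (w_part w m P) (w_part w m' Q)) = w_part w (m + m') (gmul 1 P Q)"
      using fin P(2) Q(2) w
      by (intro w_part_gmul) (auto simp: w_part_w_part wt_le_w_part intro: finite_subset[OF supp_w_part])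
    ultimately show ?thesis by (simp add: P(3) Q(3) hop_mult_gmul)
  qed
  then show ?thesis
    unfolding gr_mult_def by (intro sum_closed graded_add[OF J] graded_zero[OF J])
qed

lemma left_ideal_graded:
  assumes w: "w \<in> W_loc" and J: "left_ideal J (hop_ring C)"
  shows "left_ideal (graded w C J) (gr_ring w (hop_ring C))"
proof -
  have "additive_subgroup (graded w C J) (gr_ring w (hop_ring C))
    \<longleftrightarrow> graded w C J \<subseteq> carrier (gr_ring w (hop_ring C)) \<and> 0 \<in> graded w C J
     \<and> (\<forall>x\<in>graded w C J. \<forall>y\<in>graded w C J. x + y \<in> graded w C J) \<and> (\<forall>x\<in>graded w C J. - x \<in> graded w C J)"
  proof (rule additive_subgroup_iff)
    show "- x \<in> carrier (gr_ring w (hop_ring C))" if "x \<in> carrier (gr_ring w (hop_ring C))" for x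
      using that graded_uminus[OF left_ideal_carrier] unfolding gr_carrier by blast
  qed (simp_all add: gr_ring_def)
  moreover have "graded w C J \<subseteq> carrier (gr_ring w (hop_ring C))"
    unfolding gr_carrier using left_ideal_hopD(1)[OF J] by (intro graded_mono) auto
  ultimately have "additive_subgroup (graded w C J) (gr_ring w (hop_ring C))"
    using graded_zero[OF J] graded_add[OF J] graded_uminus[OF J] by blast
  moreover have "a \<otimes>\<^bsub>gr_ring w (hop_ring C)\<^esub> x \<in> graded w C J"
    if "a \<in> carrier (gr_ring w (hop_ring C))" "x \<in> graded w C J" for a x
    using graded_gr_mult[OF w J _ that(2)] that(1) unfolding gr_carrier by (simp add: gr_ring_def)
  ultimately show ?thesis by (simp add: left_ideal_def)
qed

text \<open>An element of \<open>graded w C J\<close> is the sum of its finitely many homogeneous parts, and each of them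
  vanishes or is the initial form of an element of \<open>J\<close>.\<close>

lemma initial_ideal_graded:
  assumes w: "w \<in> W_loc" and J: "left_ideal J (hop_ring C)"
  shows "initial_ideal w (hop_ring C) J = graded w C J"
proof
  have "initial_form w P \<in> graded w C J" if P: "P \<in> J" for P
  proof (cases "P = 0")
    case True
    then show ?thesis using graded_zero[OF J] by (simp add: initial_form_def)
  next
    case False
    have "finite (supp P)" using left_ideal_hopD(1)[OF J] P by (auto simp: carrier_hop_ring)
    then obtain m where m: "m \<in> weights_of w P" "\<And>m'. m' \<in> weights_of w P \<Longrightarrow> m' \<le> m"
      using weights_of_greatest[OF w _ False] by blast
    then have "w_ord w P = m" unfolding w_ord_def by (intro Greatest_equality) auto
    moreover have "wt_le w m P" using m(2) by (auto simp: wt_le_def weights_of_def)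
    ultimately show ?thesis using w_part_graded[OF J P] by (simp add: initial_form_def)
  qed
  then show "initial_ideal w (hop_ring C) J \<subseteq> graded w C J"
    unfolding initial_ideal_def using left_ideal_graded[OF w J] by (intro gen_left_ideal_least) auto
next
  show "graded w C J \<subseteq> initial_ideal w (hop_ring C) J"
    unfolding initial_ideal_def gen_left_ideal_def
  proof (intro subsetI InterI)
    fix f L assume f: "f \<in> graded w C J"
      and L: "L \<in> {L. left_ideal L (gr_ring w (hop_ring C)) \<and> initial_form w ` J \<subseteq> L}"
    have "additive_subgroup L (gr_ring w (hop_ring C))" using L by (simp add: left_ideal_def)
    then have sub: "subgroup L (add_monoid (gr_ring w (hop_ring C)))" by (simp add: additive_subgroup_def)
    have zero: "0 \<in> L" using subgroup.one_closed[OF sub] by (simp add: gr_ring_def)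
    have add: "u + v \<in> L" if "u \<in> L" "v \<in> L" for u v
      using subgroup.m_closed[OF sub that] by (simp add: gr_ring_def)
    have part: "w_part w m f \<in> L" for m
    proof (cases "w_part w m f = 0")
      case True
      then show ?thesis using zero by metis
    next
      case False
      obtain P where P: "P \<in> J" "wt_le w m P" "w_part w m f = w_part w m P" using f by (auto simp: graded_def)
      have "w_ord w P = m" using greatest_weight[OF P(2)] False P(3) by metis
      then have "initial_form w P = w_part w m f" using P(3) by (simp add: initial_form_def)
      then show ?thesis using L P(1) by (metis (mono_tags, lifting) image_eqI mem_Collect_eq subsetD)
    qed
    have "f = (\<Sum>m\<in>weights_of w f. w_part w m f)" using f by (intro sum_w_part) (simp add: graded_def)
    also have "\<dots> \<in> L" by (intro sum_closed zero add part)
    finally show "f \<in> L" .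
  qed
qed

text \<open>The elements whose class of weight \<open>m\<close> is the class of an element of \<open>J\<close> form a module, to which
  closedness will be applied.\<close>

lemma submodule_represented:
  assumes w: "w \<in> W_loc" and J: "submodule C J"
  shows "submodule C {g \<in> free C B. wt_le w m g \<and> (\<exists>R\<in>J. wt_le w m R \<and> w_part w m g = w_part w m R)}"
  (is "submodule C ?N")
  unfolding submodule_def
proof (intro conjI ballI)
  show "0 \<in> ?N" using J by (auto simp: zero_free submodule_def intro!: bexI[of _ 0])
next
  fix u v assume u: "u \<in> ?N" and v: "v \<in> ?N"
  then obtain R S where RS: "R \<in> J" "wt_le w m R" "w_part w m u = w_part w m R"
    "S \<in> J" "wt_le w m S" "w_part w m v = w_part w m S" by blast
  have "R + S \<in> J" using RS J by (simp add: submodule_def)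
  moreover have "wt_le w m (R + S)" using RS by (intro wt_le_add)
  moreover have "w_part w m (u + v) = w_part w m (R + S)" unfolding w_part_add RS ..
  moreover have "u + v \<in> free C B" "wt_le w m (u + v)" using u v by (auto intro!: add_free wt_le_add)
  ultimately show "u + v \<in> ?N" by blast
next
  fix c v assume c: "c \<in> C" and v: "v \<in> ?N"
  then obtain R where R: "R \<in> J" "wt_le w m R" "w_part w m v = w_part w m R" by blast
  have v': "v \<in> free C B" "wt_le w m v" using v by blast+
  have "w_part w m (lmul c v) = w_part w m (lmul c R)" using w v'(2) R(2,3) by (rule w_part_lmul)
  moreover have "lmul c R \<in> J" using J c R(1) by (simp add: submodule_def)
  moreover have "wt_le w m (lmul c R)" "wt_le w m (lmul c v)" using w R(2) v'(2) by (auto intro: wt_le_lmul)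
  moreover have "lmul c v \<in> free C B" using c v'(1) by (rule lmul_free)
  ultimately show "lmul c v \<in> ?N" by blast
qed

end

context formal_extension
begin

lemma left_ideal_hat:
  assumes "left_ideal J (hop_ring C)"
  shows "left_ideal (hat C J) (hop_ring formal_series)"
proof -
  note Jd = left_ideal_hopD[OF assms]
  show ?thesis
  proof (rule formal.left_ideal_hopI)
    show "hat C J \<subseteq> carrier (hop_ring formal_series)" using hat_carrier by blast
    show "submodule formal_series (hat C J)" using Jd(2) by (rule hat_submodule)
    show "hmul v \<in> hat C J" if "v \<in> hat C J" for v using that Jd(3) by (rule hat_hmul)
    show "pmul 1 i v \<in> hat C J" if "v \<in> hat C J" for i v using that Jd(4) by (rule hat_pmul)
  qed
qed

lemma carrier_subset: "carrier (hop_ring C) \<subseteq> carrier (hop_ring formal_series)"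
  by (auto simp: carrier_hop_ring formal_series_def)

lemma hat_wt_le:
  assumes w: "w \<in> W_loc" and N: "submodule C N" and f: "f \<in> hat C N" "wt_le w m f"
  shows "f \<in> hat C {v \<in> N. wt_le w m v}"
proof -
  have "f \<in> hat C {v \<in> N. \<forall>\<beta> k \<alpha>. v \<beta> k \<alpha> \<noteq> 0 \<longrightarrow> wt w \<alpha> \<beta> \<le> m}"
  proof (rule hat_restrict[OF N f(1)])
    show "wt w \<alpha> \<beta> \<le> m" if "f \<beta> k \<alpha> \<noteq> 0" for \<beta> k \<alpha> using f(2) that by (auto simp: wt_le_def)
    show "wt w \<alpha>' \<beta> \<le> m" if "wt w \<alpha> \<beta> \<le> m" "\<alpha> \<le> \<alpha>'" for \<beta> :: "'n expo" and k :: nat and \<alpha> \<alpha>'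
    proof -
      have "(\<Sum>i\<in>UNIV. fst w i * real (\<alpha>' i)) \<le> (\<Sum>i\<in>UNIV. fst w i * real (\<alpha> i))"
        using that(2) W_locD[OF w] by (intro sum_mono mult_left_mono_neg) (auto simp: le_fun_def)
      then show ?thesis using that(1) wt_split[of w \<alpha> \<beta>] wt_split[of w \<alpha>' \<beta>] by linarith
    qed
  qed
  then show ?thesis by (simp add: wt_le_def)
qed

text \<open>If the class of \<open>f\<close> is represented by \<open>P\<close> in the extended ideal, approximations of \<open>P\<close> in \<open>J\<close> of
  the same weight have classes converging to that of \<open>f\<close>, and closedness provides one with class \<open>f\<close>.\<close>

lemma graded_descend:
  assumes w: "w \<in> W_loc" and J: "left_ideal J (hop_ring C)"
  shows "graded w C J = graded w formal_series (hat C J) \<inter> carrier (hop_ring C)"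
proof (intro equalityI subsetI IntI)
  note Jd = left_ideal_hopD[OF J]
  fix f assume f: "f \<in> graded w C J"
  show "f \<in> graded w formal_series (hat C J)"
    using graded_mono[OF subset_hat_carrier[OF Jd(1)] carrier_subset] f by blast
  have part: "w_part w m f \<in> carrier (hop_ring C)" for m
  proof -
    obtain P where "P \<in> carrier (hop_ring C)" "w_part w m f = w_part w m P" using f by (auto simp: graded_def)
    then show ?thesis using w_part_carrier[OF w] by metis
  qed
  have "f = (\<Sum>m\<in>weights_of w f. w_part w m f)" using f by (intro sum_w_part) (simp add: graded_def)
  also have "\<dots> \<in> carrier (hop_ring C)"
    using left_ideal_hopD(2)[OF left_ideal_carrier] by (intro sum_closed part) (auto simp: submodule_def)
  finally show "f \<in> carrier (hop_ring C)" .
next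
  note Jd = left_ideal_hopD[OF J]
  fix f assume f: "f \<in> graded w formal_series (hat C J) \<inter> carrier (hop_ring C)"
  have "\<exists>R\<in>J. R \<in> carrier (hop_ring C) \<and> wt_le w m R \<and> w_part w m f = w_part w m R" for m
  proof -
    obtain P where P: "P \<in> hat C J" "wt_le w m P" "w_part w m f = w_part w m P"
      using f by (auto simp: graded_def)
    then have "P \<in> hat C {v \<in> J. wt_le w m v}" using hat_wt_le[OF w Jd(2)] by blast
    then obtain B where B: "finite B" "adherent ({v \<in> J. wt_le w m v} \<inter> free C B) P"
      by (auto simp: hat_def)
    let ?N = "{g \<in> free C B. wt_le w m g \<and> (\<exists>R\<in>J. wt_le w m R \<and> w_part w m g = w_part w m R)}"
    have suppP: "supp P \<subseteq> B" using B(2) by (rule adherent_supp) (auto simp: free_def)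
    have "supp (w_part w m f) \<subseteq> B" unfolding P(3) using supp_w_part suppP by (rule order_trans)
    moreover have "w_part w m f \<in> carrier (hop_ring C)" using w_part_carrier[OF w] f by blast
    ultimately have ff: "w_part w m f \<in> free C B" by (simp add: free_def carrier_hop_ring)
    have adh: "adherent ?N (w_part w m f)"
      unfolding adherent_def
    proof
      fix d
      obtain R where R: "R \<in> {v \<in> J. wt_le w m v} \<inter> free C B" "agree d P R"
        by (rule adherentE[OF B(2), of d])
      have "w_part w m R \<in> free C B"
        using R(1) w_part_mem[OF w, of R] supp_w_part[of w m R] by (auto simp: free_def)
      moreover have "\<exists>S\<in>J. wt_le w m S \<and> w_part w m (w_part w m R) = w_part w m S"
        using R(1) by (intro bexI[of _ R]) (auto simp: w_part_w_part)
      ultimately have "w_part w m R \<in> ?N" using wt_le_w_part by blast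
      moreover have "agree d (w_part w m f) (w_part w m R)"
        unfolding P(3) using R(2) by (rule w_part_agree)
      ultimately show "\<exists>g\<in>?N. agree d (w_part w m f) g" by blast
    qed
    have "w_part w m f \<in> ?N"
      by (rule closed[OF B(1) _ submodule_represented[OF w Jd(2)] ff adh]) blast
    then obtain R where "R \<in> J" "wt_le w m R" "w_part w m (w_part w m f) = w_part w m R" by blast
    then show ?thesis using Jd(1) by (intro bexI[of _ R]) (auto simp: w_part_w_part)
  qed
  then show "f \<in> graded w C J" using f by (simp add: graded_def)
qed

text \<open>Finiteness of the set of weights cannot be omitted on the right: a limit of elements that are
  polynomial in the variables of \<open>M_set w\<close> may be a proper power series in them.\<close>

lemma graded_ascend:
  assumes w: "w \<in> W_loc" and J: "left_ideal J (hop_ring C)"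
  shows "graded w formal_series (hat C J) = {f \<in> hat formal_series (graded w C J). finite (weights_of w f)}"
proof (intro equalityI subsetI)
  note Jd = left_ideal_hopD[OF J]
  fix f assume f: "f \<in> graded w formal_series (hat C J)"
  have part: "w_part w m f \<in> hat formal_series (graded w C J)" for m
  proof -
    obtain P where P: "P \<in> hat C J" "wt_le w m P" "w_part w m f = w_part w m P"
      using f by (auto simp: graded_def)
    then have "P \<in> hat C {v \<in> J. wt_le w m v}" using hat_wt_le[OF w Jd(2)] by blast
    then show ?thesis
      unfolding P(3)
    proof (rule hat_image[where \<Phi> = "w_part w m"])
      fix B :: "('n expo \<times> nat) set" assume "finite B"
      moreover have "w_part w m v \<in> graded w C J \<inter> free formal_series B"
        if v: "v \<in> {v \<in> J. wt_le w m v} \<inter> free C B" for v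
        using v w_part_graded[OF J, of v w m] supp_w_part[of w m v] by (auto simp: free_def formal_series_def)
      ultimately show "\<exists>B'. finite B' \<and>
          (\<forall>v\<in>{v \<in> J. wt_le w m v} \<inter> free C B. w_part w m v \<in> graded w C J \<inter> free formal_series B')"
        by blast
    next
      fix d g assume "agree (Suc d) P g"
      then show "agree d (w_part w m P) (w_part w m g)" by (intro w_part_agree) (rule agree_mono, auto)
    qed
  qed
  have fin: "finite (weights_of w f)" using f by (simp add: graded_def)
  have "f = (\<Sum>m\<in>weights_of w f. w_part w m f)" using fin by (rule sum_w_part)
  also have "\<dots> \<in> hat formal_series (graded w C J)"
  proof (intro sum_closed part)
    show "0 \<in> hat formal_series (graded w C J)"
      using graded_zero[OF J] by (intro formal.subset_hat) (auto simp: formal_series_def)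
    show "u + v \<in> hat formal_series (graded w C J)"
      if "u \<in> hat formal_series (graded w C J)" "v \<in> hat formal_series (graded w C J)" for u v
      using that graded_add[OF J] by (intro hat_add) (auto simp: formal_series_def)
  qed
  finally show "f \<in> {f \<in> hat formal_series (graded w C J). finite (weights_of w f)}" using fin by simp
next
  note Jd = left_ideal_hopD[OF J]
  fix f assume "f \<in> {f \<in> hat formal_series (graded w C J). finite (weights_of w f)}"
  then have f: "f \<in> hat formal_series (graded w C J)" "finite (weights_of w f)" by auto
  obtain B where B: "finite B" "adherent (graded w C J \<inter> free formal_series B) f"
    using f(1) by (auto simp: hat_def)
  have suppf: "supp f \<subseteq> B" using B(2) by (rule adherent_supp) (auto simp: free_def)
  have sub: "J \<subseteq> hat C J" using Jd(1) by (rule subset_hat_carrier)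
  have "\<exists>R\<in>hat C J. R \<in> carrier (hop_ring formal_series) \<and> wt_le w m R \<and> w_part w m f = w_part w m R" for m
  proof -
    let ?N = "{g \<in> free formal_series B. wt_le w m g \<and> (\<exists>R\<in>hat C J. wt_le w m R \<and> w_part w m g = w_part w m R)}"
    have free: "w_part w m g \<in> free formal_series B" if "supp g \<subseteq> B" for g
      using that supp_w_part[of w m g] by (auto simp: free_def formal_series_def)
    have adh: "adherent ?N (w_part w m f)"
      unfolding adherent_def
    proof
      fix d
      obtain g where g: "g \<in> graded w C J \<inter> free formal_series B" "agree d f g"
        by (rule adherentE[OF B(2), of d])
      obtain R where R: "R \<in> J" "wt_le w m R" "w_part w m g = w_part w m R"
        using g(1) by (auto simp: graded_def)
      have "w_part w m (w_part w m g) = w_part w m R" using R(3) by (simp add: w_part_w_part)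
      then have "w_part w m g \<in> ?N"
        using free[of g] g(1) R sub wt_le_w_part[of w m g] by (auto simp: free_def)
      then show "\<exists>h\<in>?N. agree d (w_part w m f) h" using w_part_agree[OF g(2)] by blast
    qed
    have "w_part w m f \<in> ?N"
      by (rule formal.closed[OF B(1) _ formal.submodule_represented[OF w hat_submodule[OF Jd(2)]]
            free[OF suppf] adh]) blast
    then obtain R where "R \<in> hat C J" "wt_le w m R" "w_part w m (w_part w m f) = w_part w m R" by blast
    then show ?thesis using hat_carrier by (intro bexI[of _ R]) (auto simp: w_part_w_part)
  qed
  then show "f \<in> graded w formal_series (hat C J)" using f(2) by (simp add: graded_def)
qed

text \<open>Neither recipe refers to \<open>w\<close> except through the finiteness of \<open>weights_of w\<close>, which depends on
  \<open>M_set w\<close> only.\<close>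

lemma weight_equiv_hat:
  assumes J: "left_ideal J (hop_ring C)"
  shows "weight_equiv (hop_ring C) J = weight_equiv (hop_ring formal_series) (hat C J)"
proof -
  have *: "graded w C J = graded w' C J \<longleftrightarrow> graded w formal_series (hat C J) = graded w' formal_series (hat C J)"
    if w: "w \<in> W_loc" "w' \<in> W_loc" and M: "M_set w = M_set w'" for w w'
  proof
    assume eq: "graded w C J = graded w' C J"
    have "finite (weights_of w f) \<longleftrightarrow> finite (weights_of w' f)" if "f \<in> hat formal_series (graded w C J)" for f
      using finite_weights_M w M hat_finite_supp[OF that] by metis
    then show "graded w formal_series (hat C J) = graded w' formal_series (hat C J)"
      unfolding graded_ascend[OF w(1) J] graded_ascend[OF w(2) J] eq[symmetric] by blast
  next
    assume "graded w formal_series (hat C J) = graded w' formal_series (hat C J)"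
    then show "graded w C J = graded w' C J"
      unfolding graded_descend[OF w(1) J] graded_descend[OF w(2) J] by blast
  qed
  have **: "initial_ideal w (hop_ring C) J = initial_ideal w' (hop_ring C) J
      \<longleftrightarrow> initial_ideal w (hop_ring formal_series) (hat C J) = initial_ideal w' (hop_ring formal_series) (hat C J)"
    if "w \<in> W_loc" "w' \<in> W_loc" "M_set w = M_set w'" for w w'
    unfolding initial_ideal_graded[OF that(1) J] initial_ideal_graded[OF that(2) J]
      formal.initial_ideal_graded[OF that(1) left_ideal_hat[OF J]]
      formal.initial_ideal_graded[OF that(2) left_ideal_hat[OF J]]
    by (rule *[OF that])
  show ?thesis
  proof (rule Set.set_eqI)
    fix p :: "'n weight \<times> 'n weight"
    obtain w w' where p: "p = (w, w')" by (cases p)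
    show "p \<in> weight_equiv (hop_ring C) J \<longleftrightarrow> p \<in> weight_equiv (hop_ring formal_series) (hat C J)"
      unfolding weight_equiv_def p using **[of w w'] by blast
  qed
qed

theorem equiv_classes_extension:
  assumes I: "left_ideal I (dop_ring C)"
  shows "equiv_classes (hop_ring C) (homogenize_ideal C I)
    = equiv_classes (hop_ring formal_series)
        (homogenize_ideal formal_series (gen_left_ideal (dop_ring formal_series) I))"
  unfolding equiv_classes_def homogenize_ideal_hat[OF I]
  using weight_equiv_hat[OF left_ideal_homogenize_ideal[OF I]] by simp

end

section \<open>Ordering monomials by integers\<close>

lemma nat_incseq_subseq:
  fixes s :: "nat \<Rightarrow> nat"
  obtains \<phi> :: "nat \<Rightarrow> nat" where "strict_mono \<phi>" "incseq (\<lambda>k. s (\<phi> k))"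
proof -
  obtain f where f: "strict_mono f" "monoseq (\<lambda>k. s (f k))" using seq_monosub[of s] by auto
  show ?thesis
  proof (cases "incseq (\<lambda>k. s (f k))")
    case True
    then show ?thesis using f that by blast
  next
    case False
    then have dec: "decseq (\<lambda>k. s (f k))" using f(2) by (simp add: monoseq_iff)
    define m where "m = (LEAST m. \<exists>k. s (f k) = m)"
    have "\<exists>k. s (f k) = m" unfolding m_def by (rule LeastI[of _ "s (f 0)"]) blast
    then obtain K where K: "s (f K) = m" by blast
    have "s (f (k + K)) = m" for k
    proof (rule antisym)
      show "s (f (k + K)) \<le> m" using decseqD[OF dec, of K "k + K"] K by simp
      show "m \<le> s (f (k + K))" unfolding m_def by (rule Least_le) blast
    qed
    then have "incseq (\<lambda>k. s (f (k + K)))" by (simp add: incseq_def)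
    moreover have "strict_mono (\<lambda>k. f (k + K))" using f(1) by (simp add: strict_mono_def)
    ultimately show ?thesis using that by blast
  qed
qed

text \<open>Dickson's lemma, by passing to subsequences for one coordinate after the other.\<close>

lemma dickson_seq:
  fixes a :: "nat \<Rightarrow> 'c::finite \<Rightarrow> nat"
  obtains \<phi> :: "nat \<Rightarrow> nat" where "strict_mono \<phi>" "\<And>k l. k \<le> l \<Longrightarrow> a (\<phi> k) \<le> a (\<phi> l)"
proof -
  have *: "\<exists>\<phi> :: nat \<Rightarrow> nat. strict_mono \<phi> \<and> (\<forall>i\<in>I. incseq (\<lambda>k. a (\<phi> k) i))" if "finite I" for I
    using that
  proof (induction I)
    case empty
    show ?case by (intro exI[of _ id]) (auto simp: strict_mono_def)
  next
    case (insert x I)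
    then obtain \<phi> where \<phi>: "strict_mono \<phi>" "\<forall>i\<in>I. incseq (\<lambda>k. a (\<phi> k) i)" by blast
    obtain \<psi> where \<psi>: "strict_mono \<psi>" "incseq (\<lambda>k. a (\<phi> (\<psi> k)) x)"
      using nat_incseq_subseq[of "\<lambda>k. a (\<phi> k) x"] by blast
    have "incseq (\<lambda>k. a (\<phi> (\<psi> k)) i)" if "i \<in> I" for i
      using \<phi>(2) that strict_mono_leD[OF \<psi>(1)] by (auto simp: incseq_def)
    moreover have "strict_mono (\<lambda>k. \<phi> (\<psi> k))" using \<phi>(1) \<psi>(1) by (simp add: strict_mono_def)
    ultimately show ?case using \<psi>(2) by (intro exI[of _ "\<lambda>k. \<phi> (\<psi> k)"]) auto
  qed
  obtain \<phi> :: "nat \<Rightarrow> nat" where "strict_mono \<phi>" "\<And>i. incseq (\<lambda>k. a (\<phi> k) i)"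
    using *[of UNIV] by auto
  then show ?thesis using that[of \<phi>] by (simp add: incseq_def le_fun_def)
qed

text \<open>The minimal elements are finitely many, since an infinite set of them would contain two comparable
  ones.\<close>

lemma dickson_set:
  fixes S :: "'n::finite expo set"
  obtains F where "finite F" "F \<subseteq> S" "\<And>\<alpha>. \<alpha> \<in> S \<Longrightarrow> \<exists>\<gamma>\<in>F. \<gamma> \<le> \<alpha>"
proof
  let ?F = "{\<alpha>\<in>S. \<forall>\<gamma>\<in>S. \<gamma> \<le> \<alpha> \<longrightarrow> \<gamma> = \<alpha>}"
  show "?F \<subseteq> S" by blast
  show "finite ?F"
  proof (rule ccontr)
    assume "infinite ?F"
    then obtain a :: "nat \<Rightarrow> 'n expo" where a: "inj a" "range a \<subseteq> ?F" using infinite_countable_subset by blast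
    obtain \<phi> :: "nat \<Rightarrow> nat" where \<phi>: "strict_mono \<phi>" "\<And>k l. k \<le> l \<Longrightarrow> a (\<phi> k) \<le> a (\<phi> l)"
      using dickson_seq[of a] by blast
    have "a (\<phi> 0) \<le> a (\<phi> 1)" by (rule \<phi>(2)) simp
    then have "a (\<phi> 0) = a (\<phi> 1)" using a(2) by blast
    then have "\<phi> 0 = \<phi> 1" using a(1) by (simp add: inj_eq)
    moreover have "\<phi> 0 < \<phi> 1" using \<phi>(1) by (simp add: strict_mono_def)
    ultimately show False by simp
  qed
  show "\<exists>\<gamma>\<in>?F. \<gamma> \<le> \<alpha>" if "\<alpha> \<in> S" for \<alpha>
    using that
  proof (induction "deg \<alpha>" arbitrary: \<alpha> rule: less_induct)
    case less
    show ?case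
    proof (cases "\<alpha> \<in> ?F")
      case True
      then show ?thesis by blast
    next
      case False
      then obtain \<gamma> where \<gamma>: "\<gamma> \<in> S" "\<gamma> \<le> \<alpha>" "\<gamma> \<noteq> \<alpha>" using less by blast
      have "deg (\<alpha> - \<gamma>) + deg \<gamma> = deg \<alpha>" using \<gamma>(2) by (rule deg_diff)
      moreover have "\<alpha> - \<gamma> \<noteq> 0"
      proof
        assume "\<alpha> - \<gamma> = 0"
        then have "0 + \<gamma> = \<alpha>" using expo_diff_add[OF \<gamma>(2)] by metis
        then show False using \<gamma>(3) by simp
      qed
      then have "deg (\<alpha> - \<gamma>) \<noteq> 0" unfolding deg_eq_0_iff .
      ultimately have "deg \<gamma> < deg \<alpha>" by linarith
      then obtain \<gamma>' where "\<gamma>' \<in> ?F" "\<gamma>' \<le> \<gamma>" using less.hyps \<gamma>(1) by blast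
      then show ?thesis using \<gamma>(2) by (meson order_trans)
    qed
  qed
qed

text \<open>Monomials of a finite free module are encoded by products of distinct primes, one for each
  variable and one for each basis vector. The encoding is injective, turns products of monomials
  into products of integers, and has only finitely many values below any bound, so it gives an
  admissible order in both directions; its powers moreover serve as weights of norms.\<close>

locale monomial_order =
  fixes p :: "'n::finite \<Rightarrow> nat" and e :: "'b \<Rightarrow> nat" and B :: "'b set"
  assumes finite_B: "finite B" and inj_p: "inj p" and prime_p: "prime (p i)"
    and inj_e: "inj_on e B" and prime_e: "prime (e j)" and e_p: "e j \<noteq> p i"
begin

definition mono_code :: "'n expo \<Rightarrow> nat" where "mono_code \<alpha> = (\<Prod>i\<in>UNIV. p i ^ \<alpha> i)"

definition key :: "'b \<times> 'n expo \<Rightarrow> nat" where "key \<delta> = e (fst \<delta>) * mono_code (snd \<delta>)"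

lemma mono_code_add: "mono_code (\<alpha> + \<gamma>) = mono_code \<alpha> * mono_code \<gamma>"
  by (simp add: mono_code_def power_add prod.distrib)

lemma mono_code_pos: "0 < mono_code \<alpha>"
  using prime_p by (auto simp: mono_code_def prime_gt_0_nat intro!: prod_pos)

lemma key_add: "key (j, \<alpha> + \<gamma>) = key (j, \<alpha>) * mono_code \<gamma>"
  by (simp add: key_def mono_code_add)

lemma key_pos: "0 < key \<delta>"
  using mono_code_pos prime_e by (simp add: key_def prime_gt_0_nat)

lemma key_diff: "\<gamma> \<le> \<alpha> \<Longrightarrow> key (j, \<alpha>) = key (j, \<alpha> - \<gamma>) * mono_code \<gamma>"
  using key_add[of j "\<alpha> - \<gamma>" \<gamma>] by simp

lemma e_range: "e j \<notin> range p"
proof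
  assume "e j \<in> range p"
  then obtain i where "e j = p i" by (rule rangeE)
  then show False using e_p[of j i] by contradiction
qed

lemma key_prod:
  "key (j, \<alpha>) = (\<Prod>q\<in>insert (e j) (range p). q ^ (if q = e j then 1 else \<alpha> (inv_into UNIV p q)))"
proof -
  have "(\<Prod>q\<in>range p. q ^ (if q = e j then 1 else \<alpha> (inv_into UNIV p q)))
      = (\<Prod>i\<in>UNIV. p i ^ (if p i = e j then 1 else \<alpha> (inv_into UNIV p (p i))))"
    by (rule prod.reindex_cong[OF inj_p]) auto
  also have "\<dots> = mono_code \<alpha>"
    unfolding mono_code_def using e_p[of j] inj_p by (intro prod.cong) (auto simp: inv_f_f dest: not_sym)
  finally show ?thesis using e_p[of j] by (subst prod.insert) (auto simp: key_def)
qed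

lemma multiplicity_key:
  assumes "prime q"
  shows "multiplicity q (key (j, \<alpha>)) = (if q = e j then 1 else if q \<in> range p then \<alpha> (inv_into UNIV p q) else 0)"
  unfolding key_prod using prime_e prime_p assms
  by (subst multiplicity_prod_prime_powers) auto

lemma key_inj:
  assumes "j \<in> B" "j' \<in> B" "key (j, \<alpha>) = key (j', \<alpha>')"
  shows "j = j' \<and> \<alpha> = \<alpha>'"
proof
  have "multiplicity (e j) (key (j', \<alpha>')) = 1"
    using multiplicity_key[OF prime_e, of j j \<alpha>] assms(3) by simp
  then have "e j = e j'"
    using multiplicity_key[OF prime_e, of j j' \<alpha>'] e_range[of j] by (metis zero_neq_one)
  then show "j = j'" using inj_onD[OF inj_e] assms(1,2) by blast
  show "\<alpha> = \<alpha>'"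
  proof
    fix i
    have "multiplicity (p i) (key (l, \<gamma>)) = \<gamma> i" for l \<gamma>
      using multiplicity_key[OF prime_p, of i l \<gamma>] e_p[of l i, THEN not_sym] inj_p by (simp add: inv_f_f)
    then show "\<alpha> i = \<alpha>' i" using assms(3) by metis
  qed
qed

lemma finite_key_le: "finite {\<delta>. fst \<delta> \<in> B \<and> key \<delta> \<le> X}"
proof (rule finite_imageD)
  show "finite (key ` {\<delta>. fst \<delta> \<in> B \<and> key \<delta> \<le> X})"
    by (rule finite_subset[of _ "{..X}"]) auto
  show "inj_on key {\<delta>. fst \<delta> \<in> B \<and> key \<delta> \<le> X}"
    using key_inj by (auto simp: inj_on_def)
qed

end

lemma monomial_order_exists:
  fixes B :: "'b set"
  assumes "finite B"
  obtains p :: "'n::finite \<Rightarrow> nat" and e where "monomial_order p e B"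
proof -
  let ?P = "{q::nat. prime q}"
  have P: "enumerate ?P k \<in> ?P" for k using primes_infinite by (rule enumerate_in_set)
  have inj: "enumerate ?P k = enumerate ?P l \<longleftrightarrow> k = l" for k l
    using strict_mono_enumerate[OF primes_infinite] by (simp add: strict_mono_eq)
  obtain f :: "'n \<Rightarrow> nat" where f: "inj f"
    using finite_imp_inj_to_nat_seg[OF finite_class.finite_UNIV] by blast
  obtain g :: "'b \<Rightarrow> nat" where g: "inj_on g B"
    using finite_imp_inj_to_nat_seg[OF assms] by blast
  have "2 * k + 1 \<noteq> 2 * l" for k l :: nat by presburger
  then have "monomial_order (\<lambda>i. enumerate ?P (2 * f i)) (\<lambda>j. enumerate ?P (2 * g j + 1)) B"
    using P f g assms by unfold_locales (auto simp: inj_def inj_on_def inj)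
  then show ?thesis by (rule that)
qed

section \<open>Division\<close>

type_synonym ('b, 'k, 'n) vec = "'b \<Rightarrow> ('k, 'n) mfps"

definition scal :: "('k::field, 'n::finite) mfps \<Rightarrow> ('b, 'k, 'n) vec \<Rightarrow> ('b, 'k, 'n) vec" where
  "scal c v = (\<lambda>j. mfps_mult c (v j))"

definition vecs :: "('k::field, 'n::finite) mfps set \<Rightarrow> 'b set \<Rightarrow> ('b, 'k, 'n) vec set" where
  "vecs C B = {v. (\<forall>j. v j \<in> C) \<and> (\<forall>j. j \<notin> B \<longrightarrow> v j = 0)}"

definition vagree :: "nat \<Rightarrow> ('b, 'k, 'n::finite) vec \<Rightarrow> ('b, 'k, 'n) vec \<Rightarrow> bool" where
  "vagree d f g \<longleftrightarrow> (\<forall>j \<alpha>. deg \<alpha> < d \<longrightarrow> f j \<alpha> = g j \<alpha>)"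

text \<open>A system of equations expressing each unknown by unknowns of smaller height is solvable.\<close>

lemma causal_fixpoint:
  fixes h :: "'a \<Rightarrow> nat" and F :: "('a \<Rightarrow> 'c) \<Rightarrow> 'a \<Rightarrow> 'c"
  assumes "\<And>Q Q' x. (\<And>y. h y < h x \<Longrightarrow> Q y = Q' y) \<Longrightarrow> F Q x = F Q' x"
  obtains Q where "\<And>x. Q x = F Q x"
proof -
  have "adm_wf (measure h) F"
    unfolding adm_wf_def
  proof (intro allI impI)
    fix Q Q' :: "'a \<Rightarrow> 'c" and x assume *: "\<forall>y. (y, x) \<in> measure h \<longrightarrow> Q y = Q' y"
    show "F Q x = F Q' x" by (rule assms) (use * in simp)
  qed
  then have eq: "wfrec (measure h) F = F (wfrec (measure h) F)" by (intro wfrec_fixpoint) auto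
  show ?thesis
  proof (rule that[of "wfrec (measure h) F"])
    show "wfrec (measure h) F x = F (wfrec (measure h) F) x" for x using eq by (rule fun_cong)
  qed
qed

context monomial_order
begin

definition is_lead :: "('b, 'k::field, 'n) vec \<Rightarrow> 'b \<times> 'n expo \<Rightarrow> bool" where
  "is_lead v \<delta> \<longleftrightarrow> fst \<delta> \<in> B \<and> v (fst \<delta>) (snd \<delta>) \<noteq> 0
     \<and> (\<forall>j\<in>B. \<forall>\<alpha>. v j \<alpha> \<noteq> 0 \<longrightarrow> key \<delta> \<le> key (j, \<alpha>))"

lemma is_lead_exists:
  assumes "j \<in> B" "v j \<alpha> \<noteq> 0"
  obtains \<delta> where "is_lead v \<delta>"
proof -
  let ?P = "\<lambda>\<delta>. fst \<delta> \<in> B \<and> v (fst \<delta>) (snd \<delta>) \<noteq> 0"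
  have "?P (j, \<alpha>)" using assms by simp
  from ex_has_least_nat[of ?P, OF this, of key] obtain \<delta> where
    \<delta>: "?P \<delta>" "\<forall>\<delta>'. ?P \<delta>' \<longrightarrow> key \<delta> \<le> key \<delta>'" by blast
  have "is_lead v \<delta>" unfolding is_lead_def using \<delta>(1) \<delta>(2)[rule_format, of "(_, _)"] by auto
  then show ?thesis by (rule that)
qed

end

text \<open>\<open>G\<close> generates the leading monomials \<open>E\<close> of a submodule, and \<open>red\<close> assigns to each of them a
  generator dividing it.\<close>

locale standard_basis = monomial_order p e B
  for p :: "'n::finite \<Rightarrow> nat" and e :: "'b \<Rightarrow> nat" and B :: "'b set" +
  fixes E G :: "('b \<times> 'n expo) set" and red :: "'b \<times> 'n expo \<Rightarrow> 'b \<times> 'n expo"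
    and g :: "'b \<times> 'n expo \<Rightarrow> ('b, 'k::field, 'n) vec"
  assumes finite_G: "finite G" and E_B: "\<delta> \<in> E \<Longrightarrow> fst \<delta> \<in> B"
    and red_G: "\<delta> \<in> E \<Longrightarrow> red \<delta> \<in> G" and red_fst: "\<delta> \<in> E \<Longrightarrow> fst (red \<delta>) = fst \<delta>"
    and red_le: "\<delta> \<in> E \<Longrightarrow> snd (red \<delta>) \<le> snd \<delta>"
    and lead_g: "\<delta>0 \<in> G \<Longrightarrow> is_lead (g \<delta>0) \<delta>0" and one_g: "\<delta>0 \<in> G \<Longrightarrow> g \<delta>0 (fst \<delta>0) (snd \<delta>0) = 1"
begin

definition cofactor :: "'b \<times> 'n expo \<Rightarrow> 'n expo" where "cofactor \<delta> = snd \<delta> - snd (red \<delta>)"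

text \<open>The coefficients of the multiple of a generator that has leading monomial \<open>\<delta>'\<close>.\<close>

definition shift :: "'b \<times> 'n expo \<Rightarrow> 'b \<times> 'n expo \<Rightarrow> 'k" where
  "shift \<delta>' \<delta> = (if cofactor \<delta>' \<le> snd \<delta> then g (red \<delta>') (fst \<delta>) (snd \<delta> - cofactor \<delta>') else 0)"

definition quotients :: "('b \<times> 'n expo \<Rightarrow> 'k) \<Rightarrow> 'b \<times> 'n expo \<Rightarrow> ('k, 'n) mfps" where
  "quotients Q \<delta>0 = (\<lambda>\<gamma>. if (fst \<delta>0, snd \<delta>0 + \<gamma>) \<in> E \<and> red (fst \<delta>0, snd \<delta>0 + \<gamma>) = \<delta>0
     then Q (fst \<delta>0, snd \<delta>0 + \<gamma>) else 0)"

lemma key_red: "\<delta> \<in> E \<Longrightarrow> key \<delta> = key (red \<delta>) * mono_code (cofactor \<delta>)"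
  using key_diff[of "snd (red \<delta>)" "snd \<delta>" "fst \<delta>"] red_le[of \<delta>] red_fst[of \<delta>]
    key_add[of "fst \<delta>" "snd (red \<delta>)" "cofactor \<delta>"]
  by (simp add: cofactor_def key_def)

lemma shift_key:
  assumes "\<delta>' \<in> E" "fst \<delta> \<in> B" "shift \<delta>' \<delta> \<noteq> 0"
  shows "key \<delta>' \<le> key \<delta>"
proof -
  have le: "cofactor \<delta>' \<le> snd \<delta>" and nz: "g (red \<delta>') (fst \<delta>) (snd \<delta> - cofactor \<delta>') \<noteq> 0"
    using assms(3) by (auto simp: shift_def split: if_splits)
  have "key (red \<delta>') \<le> key (fst \<delta>, snd \<delta> - cofactor \<delta>')"
    using lead_g[OF red_G[OF assms(1)]] assms(2) nz by (simp add: is_lead_def)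
  then have "key (red \<delta>') * mono_code (cofactor \<delta>') \<le> key (fst \<delta>, snd \<delta> - cofactor \<delta>') * mono_code (cofactor \<delta>')"
    by simp
  then show ?thesis using key_red[OF assms(1)] key_diff[OF le, of "fst \<delta>"] by simp
qed

lemma shift_self:
  assumes "\<delta> \<in> E"
  shows "shift \<delta> \<delta> = 1"
proof -
  have "snd \<delta> - cofactor \<delta> = snd (red \<delta>)"
    using red_le[OF assms] by (auto simp: cofactor_def fun_eq_iff le_fun_def)
  then show ?thesis
    using one_g[OF red_G[OF assms]] red_fst[OF assms] by (simp add: shift_def) (simp add: cofactor_def)
qed

text \<open>\<open>Q\<close> collects the coefficients of all quotients, and of the remainder outside \<open>E\<close>; since every
  monomial has exactly one of these roles, one recursion on keys determines all of them.\<close>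

lemma division_recursion:
  obtains Q where "\<And>\<delta>. Q \<delta> = f \<delta> - (\<Sum>\<delta>'\<in>{\<delta>'\<in>E. key \<delta>' < key \<delta>}. Q \<delta>' * shift \<delta>' \<delta>)"
  by (rule causal_fixpoint[where h = key
        and F = "\<lambda>Q \<delta>. f \<delta> - (\<Sum>\<delta>'\<in>{\<delta>'\<in>E. key \<delta>' < key \<delta>}. Q \<delta>' * shift \<delta>' \<delta>)"])
    (auto intro!: sum.cong)

lemma finite_E_le: "finite {\<delta>'\<in>E. key \<delta>' \<le> X}"
  by (rule finite_subset[OF _ finite_key_le[of X]]) (use E_B in blast)

text \<open>The sum of the multiples of the generators has at \<open>\<delta>\<close> the contributions of all leading monomials
  \<open>\<delta>'\<close> of key at most that of \<open>\<delta>\<close>. Those with smaller key are the ones subtracted in the recursion for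
  \<open>Q \<delta>\<close>, and \<open>\<delta>\<close> itself contributes \<open>Q \<delta>\<close>.\<close>

lemma division_formula:
  assumes Q: "\<And>\<delta>. Q \<delta> = f \<delta> - (\<Sum>\<delta>'\<in>{\<delta>'\<in>E. key \<delta>' < key \<delta>}. Q \<delta>' * shift \<delta>' \<delta>)" and j: "j \<in> B"
  shows "(\<Sum>\<delta>0\<in>G. mfps_mult (quotients Q \<delta>0) (g \<delta>0 j) \<alpha>)
    = f (j, \<alpha>) - (if (j, \<alpha>) \<in> E then 0 else Q (j, \<alpha>))"
proof -
  let ?\<delta> = "(j, \<alpha>)"
  let ?T1 = "{x \<in> G \<times> {..\<alpha>}. (fst (fst x), snd (fst x) + snd x) \<in> E \<and> red (fst (fst x), snd (fst x) + snd x) = fst x}"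
  let ?T2 = "{\<delta>'\<in>E. cofactor \<delta>' \<le> \<alpha>}"
  let ?T3 = "{\<delta>'\<in>E. key \<delta>' \<le> key ?\<delta>}"
  have "(\<Sum>\<delta>0\<in>G. mfps_mult (quotients Q \<delta>0) (g \<delta>0 j) \<alpha>)
      = (\<Sum>x\<in>G \<times> {..\<alpha>}. quotients Q (fst x) (snd x) * g (fst x) j (\<alpha> - snd x))"
    unfolding mfps_mult_eq by (simp add: sum.cartesian_product split_beta)
  also have "\<dots> = (\<Sum>x\<in>?T1. Q (fst (fst x), snd (fst x) + snd x) * g (fst x) j (\<alpha> - snd x))"
    by (rule sum.mono_neutral_cong_right) (auto simp: finite_G quotients_def)
  also have "\<dots> = (\<Sum>\<delta>'\<in>?T2. Q \<delta>' * g (red \<delta>') j (\<alpha> - cofactor \<delta>'))"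
  proof (rule sum.reindex_bij_witness[of _ "\<lambda>\<delta>'. (red \<delta>', cofactor \<delta>')" "\<lambda>x. (fst (fst x), snd (fst x) + snd x)"],
      goal_cases)
    case (1 x)
    then show ?case by (auto simp: cofactor_def prod_eq_iff)
  next
    case (2 x)
    then show ?case by (auto simp: cofactor_def prod_eq_iff)
  next
    case (3 \<delta>')
    then show ?case using red_fst red_le by (simp add: cofactor_def prod_eq_iff)
  next
    case (4 \<delta>')
    then have "(fst (red \<delta>'), snd (red \<delta>') + cofactor \<delta>') = \<delta>'"
      using red_fst red_le by (simp add: cofactor_def prod_eq_iff)
    then show ?case using 4 red_G by auto
  next
    case (5 x)
    then have "cofactor (fst (fst x), snd (fst x) + snd x) = snd x" by (auto simp: cofactor_def)
    then show ?case using 5 by auto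
  qed
  also have "\<dots> = (\<Sum>\<delta>'\<in>?T3. Q \<delta>' * shift \<delta>' ?\<delta>)"
  proof (rule sum.mono_neutral_cong)
    have "?T2 \<subseteq> (\<lambda>x. (fst (fst x), snd (fst x) + snd x)) ` (G \<times> {..\<alpha>})"
    proof
      fix \<delta>' assume "\<delta>' \<in> ?T2"
      then have "\<delta>' = (fst (red \<delta>'), snd (red \<delta>') + cofactor \<delta>')" "red \<delta>' \<in> G" "cofactor \<delta>' \<le> \<alpha>"
        using red_fst red_le red_G by (simp_all add: cofactor_def prod_eq_iff)
      then show "\<delta>' \<in> (\<lambda>x. (fst (fst x), snd (fst x) + snd x)) ` (G \<times> {..\<alpha>})"
        by (intro image_eqI[of _ _ "(red \<delta>', cofactor \<delta>')"]) auto
    qed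
    then show "finite ?T2" by (rule finite_subset) (simp add: finite_G)
    show "finite ?T3" by (rule finite_E_le)
    show "Q \<delta>' * g (red \<delta>') j (\<alpha> - cofactor \<delta>') = 0" if "\<delta>' \<in> ?T2 - ?T3" for \<delta>'
      using that shift_key[of \<delta>' ?\<delta>] j by (auto simp: shift_def)
  qed (auto simp: shift_def)
  also have "\<dots> = (\<Sum>\<delta>'\<in>{\<delta>'\<in>E. key \<delta>' < key ?\<delta>}. Q \<delta>' * shift \<delta>' ?\<delta>) + (if ?\<delta> \<in> E then Q ?\<delta> else 0)"
  proof (cases "?\<delta> \<in> E")
    case True
    have "?T3 = insert ?\<delta> {\<delta>'\<in>E. key \<delta>' < key ?\<delta>}"
    proof (intro equalityI subsetI)
      fix \<delta>' assume "\<delta>' \<in> ?T3"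
      then show "\<delta>' \<in> insert ?\<delta> {\<delta>'\<in>E. key \<delta>' < key ?\<delta>}"
        using key_inj[of "fst \<delta>'" j "snd \<delta>'" \<alpha>] j E_B[of \<delta>'] by (cases \<delta>') auto
    qed (use True in auto)
    moreover have "finite {\<delta>'\<in>E. key \<delta>' < key ?\<delta>}"
      by (rule finite_subset[OF _ finite_E_le[of "key ?\<delta>"]]) auto
    ultimately show ?thesis using True by (simp add: shift_self add.commute)
  next
    case False
    have "?T3 = {\<delta>'\<in>E. key \<delta>' < key ?\<delta>}"
    proof (intro equalityI subsetI)
      fix \<delta>' assume a: "\<delta>' \<in> ?T3"
      then have "key \<delta>' \<noteq> key ?\<delta>"
        using key_inj[of "fst \<delta>'" j "snd \<delta>'" \<alpha>] j E_B[of \<delta>'] False by (cases \<delta>') auto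
      then show "\<delta>' \<in> {\<delta>'\<in>E. key \<delta>' < key ?\<delta>}" using a by auto
    qed auto
    then show ?thesis using False by simp
  qed
  also have "\<dots> = f ?\<delta> - (if ?\<delta> \<in> E then 0 else Q ?\<delta>)"
    using Q[of ?\<delta>] by simp
  finally show ?thesis .
qed

end

text \<open>Whether a monomial is the leading one depends only on the coefficients up to its key. Hence
  the remainder of \<open>f\<close>, which has no monomial in \<open>E\<close>, vanishes if \<open>f\<close> is adherent to the submodule.\<close>

lemma closed_by_division:
  fixes C :: "('k::field, 'n::finite) mfps set" and N :: "('b, 'k, 'n) vec set"
  assumes poly: "polynomials \<subseteq> C" and B: "finite B" and N: "N \<subseteq> vecs C B" and zero: "0 \<in> N"
    and add: "\<And>u v. u \<in> N \<Longrightarrow> v \<in> N \<Longrightarrow> u + v \<in> N" and scal: "\<And>c v. c \<in> C \<Longrightarrow> v \<in> N \<Longrightarrow> scal c v \<in> N"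
    and f: "f \<in> vecs C B" and adh: "\<And>d. \<exists>h\<in>N. vagree d f h"
    and quot: "\<And>p e E G red g Q \<delta>0. standard_basis p e B E G red g \<Longrightarrow> g ` G \<subseteq> vecs C B \<Longrightarrow>
      (\<And>\<delta>. Q \<delta> = f (fst \<delta>) (snd \<delta>)
         - (\<Sum>\<delta>'\<in>{\<delta>'\<in>E. monomial_order.key p e \<delta>' < monomial_order.key p e \<delta>}.
              Q \<delta>' * standard_basis.shift red g \<delta>' \<delta>)) \<Longrightarrow>
      \<delta>0 \<in> G \<Longrightarrow> standard_basis.quotients E red Q \<delta>0 \<in> C"
  shows "f \<in> N"
proof -
  obtain p :: "'n \<Rightarrow> nat" and e where "monomial_order p e B" using monomial_order_exists[OF B] by blast
  then interpret monomial_order p e B .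
  define E where "E = {\<delta>. \<exists>v\<in>N. is_lead v \<delta>}"
  have "\<exists>F. finite F \<and> F \<subseteq> {\<alpha>. (j, \<alpha>) \<in> E} \<and> (\<forall>\<alpha>\<in>{\<alpha>. (j, \<alpha>) \<in> E}. \<exists>\<gamma>\<in>F. \<gamma> \<le> \<alpha>)" for j
    using dickson_set[of "{\<alpha>. (j, \<alpha>) \<in> E}"] by metis
  then obtain F where F: "\<And>j. finite (F j)" "\<And>j. F j \<subseteq> {\<alpha>. (j, \<alpha>) \<in> E}"
    "\<And>j \<alpha>. (j, \<alpha>) \<in> E \<Longrightarrow> \<exists>\<gamma>\<in>F j. \<gamma> \<le> \<alpha>" by (metis mem_Collect_eq)
  define G where "G = Sigma B F"
  have G_E: "G \<subseteq> E" using F(2) by (auto simp: G_def)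
  have "\<exists>\<delta>0\<in>G. fst \<delta>0 = fst \<delta> \<and> snd \<delta>0 \<le> snd \<delta>" if \<delta>E: "\<delta> \<in> E" for \<delta>
  proof -
    obtain \<gamma> where "\<gamma> \<in> F (fst \<delta>)" "\<gamma> \<le> snd \<delta>" using F(3)[of "fst \<delta>" "snd \<delta>"] \<delta>E by auto
    moreover have "fst \<delta> \<in> B" using \<delta>E by (auto simp: E_def is_lead_def)
    ultimately show ?thesis by (intro bexI[of _ "(fst \<delta>, \<gamma>)"]) (auto simp: G_def)
  qed
  then obtain red where red: "\<And>\<delta>. \<delta> \<in> E \<Longrightarrow> red \<delta> \<in> G \<and> fst (red \<delta>) = fst \<delta> \<and> snd (red \<delta>) \<le> snd \<delta>"
    by metis
  have "\<exists>v\<in>N. is_lead v \<delta>0 \<and> v (fst \<delta>0) (snd \<delta>0) = 1" if \<delta>0: "\<delta>0 \<in> G" for \<delta>0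
  proof -
    obtain v where v: "v \<in> N" "is_lead v \<delta>0" using \<delta>0 G_E by (auto simp: E_def)
    let ?a = "v (fst \<delta>0) (snd \<delta>0)"
    let ?v = "scal (mfps_monom (inverse ?a) 0) v"
    have eq: "?v j \<alpha> = inverse ?a * v j \<alpha>" for j \<alpha> by (simp add: scal_def mfps_mult_const)
    have "?a \<noteq> 0" using v(2) by (simp add: is_lead_def)
    moreover have "mfps_monom (inverse ?a) 0 \<in> C" using poly
      by (auto simp: polynomials_def mfps_monom_def intro!: subsetD[OF poly] finite_subset[of _ "{0}"])
    ultimately show ?thesis using v scal by (intro bexI[of _ ?v]) (auto simp: is_lead_def eq)
  qed
  then obtain g where g: "\<And>\<delta>0. \<delta>0 \<in> G \<Longrightarrow> g \<delta>0 \<in> N \<and> is_lead (g \<delta>0) \<delta>0 \<and> g \<delta>0 (fst \<delta>0) (snd \<delta>0) = 1"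
    by metis
  interpret standard_basis p e B E G red g
  proof
    show "finite G" unfolding G_def using B F(1) by (rule finite_SigmaI)
    show "fst \<delta> \<in> B" if "\<delta> \<in> E" for \<delta> using that by (auto simp: E_def is_lead_def)
  qed (use red g in auto)
  obtain Q where Q: "\<And>\<delta>. Q \<delta> = f (fst \<delta>) (snd \<delta>) - (\<Sum>\<delta>'\<in>{\<delta>'\<in>E. key \<delta>' < key \<delta>}. Q \<delta>' * shift \<delta>' \<delta>)"
    using division_recursion[of "\<lambda>\<delta>. f (fst \<delta>) (snd \<delta>)"] by blast
  define s where "s = (\<Sum>\<delta>0\<in>G. scal (quotients Q \<delta>0) (g \<delta>0))"
  have s: "s \<in> N"
    unfolding s_def
  proof (rule sum_closed[OF zero add])
    fix \<delta>0 assume "\<delta>0 \<in> G"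
    moreover have "g ` G \<subseteq> vecs C B" using g N by blast
    ultimately show "scal (quotients Q \<delta>0) (g \<delta>0) \<in> N"
      using g quot[OF standard_basis_axioms _ Q] by (intro scal) auto
  qed
  have diff: "f j \<alpha> - s j \<alpha> = (if (j, \<alpha>) \<in> E then 0 else Q (j, \<alpha>))" if "j \<in> B" for j \<alpha>
    using division_formula[OF Q that, of \<alpha>] by (simp add: s_def fun_sum_apply scal_def)
  have "f j \<alpha> = s j \<alpha>" for j \<alpha>
  proof (rule ccontr)
    assume ne: "f j \<alpha> \<noteq> s j \<alpha>"
    have "j \<in> B"
    proof (rule ccontr)
      assume "j \<notin> B"
      then have "f j = 0" "s j = 0" using f s N by (auto simp: vecs_def)
      then show False using ne by simp
    qed
    moreover have "(f - s) j \<alpha> \<noteq> 0" using ne by simp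
    ultimately obtain \<delta> where \<delta>: "is_lead (f - s) \<delta>" by (rule is_lead_exists)
    define d where "d = Suc (Max ((\<lambda>\<delta>. deg (snd \<delta>)) ` {\<delta>'. fst \<delta>' \<in> B \<and> key \<delta>' \<le> key \<delta>}))"
    have d: "deg \<alpha>' < d" if "j' \<in> B" "key (j', \<alpha>') \<le> key \<delta>" for j' \<alpha>'
      unfolding d_def less_Suc_eq_le using that finite_key_le[of "key \<delta>"]
      by (intro Max_ge) (auto intro!: image_eqI[of _ _ "(j', \<alpha>')"])
    obtain h where h: "h \<in> N" "vagree d f h" using adh by blast
    have same: "(h - s) j' \<alpha>' = (f - s) j' \<alpha>'" if "j' \<in> B" "key (j', \<alpha>') \<le> key \<delta>" for j' \<alpha>'
      using h(2) d[OF that] by (simp add: vagree_def)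
    have "is_lead (h - s) \<delta>"
      unfolding is_lead_def
    proof (intro conjI ballI allI impI)
      show \<delta>B: "fst \<delta> \<in> B" using \<delta> by (simp add: is_lead_def)
      show "(h - s) (fst \<delta>) (snd \<delta>) \<noteq> 0"
        using same[OF \<delta>B, of "snd \<delta>"] \<delta> by (simp add: is_lead_def)
      fix j' \<alpha>' assume j': "j' \<in> B" and nz: "(h - s) j' \<alpha>' \<noteq> 0"
      show "key \<delta> \<le> key (j', \<alpha>')"
      proof (rule ccontr)
        assume *: "\<not> key \<delta> \<le> key (j', \<alpha>')"
        then have "(f - s) j' \<alpha>' \<noteq> 0" using same[OF j', of \<alpha>'] nz by simp
        then show False using \<delta> j' * by (simp add: is_lead_def)
      qed
    qed
    moreover have "h - s \<in> N"
    proof -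
      have "mfps_monom (-1) 0 \<in> C"
        by (auto simp: polynomials_def mfps_monom_def intro!: subsetD[OF poly] finite_subset[of _ "{0}"])
      then have "h + scal (mfps_monom (-1) 0) s \<in> N" using h(1) s by (intro add scal)
      moreover have "h + scal (mfps_monom (-1) 0) s = h - s"
        by (simp add: fun_eq_iff scal_def mfps_mult_const)
      ultimately show ?thesis by simp
    qed
    ultimately have "\<delta> \<in> E" by (auto simp: E_def)
    moreover have "fst \<delta> \<in> B" "(f - s) (fst \<delta>) (snd \<delta>) \<noteq> 0" using \<delta> by (auto simp: is_lead_def)
    ultimately show False using diff[of "fst \<delta>" "snd \<delta>"] by simp
  qed
  then have "f = s" by (intro ext)
  then show ?thesis using s by simp
qed

text \<open>Division treats vectors with one index; operators have two, \<open>\<beta>\<close> and \<open>k\<close>.\<close>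

lemma closed_of_vec_closed:
  fixes C :: "('k::field, 'n::finite) mfps set"
  assumes vec: "\<And>(N :: ('n expo \<times> nat, 'k, 'n) vec set) f. N \<subseteq> vecs C B \<Longrightarrow> 0 \<in> N \<Longrightarrow>
      (\<And>u v. u \<in> N \<Longrightarrow> v \<in> N \<Longrightarrow> u + v \<in> N) \<Longrightarrow> (\<And>c v. c \<in> C \<Longrightarrow> v \<in> N \<Longrightarrow> scal c v \<in> N) \<Longrightarrow>
      f \<in> vecs C B \<Longrightarrow> (\<And>d. \<exists>h\<in>N. vagree d f h) \<Longrightarrow> f \<in> N"
    and N: "N \<subseteq> free C B" "submodule C N" and f: "f \<in> free C B" "adherent N f"
  shows "f \<in> N"
proof -
  let ?U = "\<lambda>v :: ('k, 'n) hop. case_prod v"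
  have vecs: "?U v \<in> vecs C B" if v: "v \<in> free C B" for v
    unfolding vecs_def
  proof (intro CollectI conjI allI impI)
    fix b :: "'n expo \<times> nat"
    obtain \<beta> k where b: "b = (\<beta>, k)" by (cases b)
    show "?U v b \<in> C" using v by (simp add: free_def b)
    show "?U v b = 0" if "b \<notin> B" using v that by (auto simp: free_def supp_def b)
  qed
  have "?U f \<in> ?U ` N"
  proof (rule vec)
    show "?U ` N \<subseteq> vecs C B" using vecs N(1) by blast
    have "?U 0 = 0" by (simp add: fun_eq_iff split_beta)
    then show "0 \<in> ?U ` N" using N(2) unfolding submodule_def by (metis imageI)
    show "u + v \<in> ?U ` N" if uv: "u \<in> ?U ` N" "v \<in> ?U ` N" for u v
    proof -
      obtain u' v' where *: "u = ?U u'" "v = ?U v'" "u' \<in> N" "v' \<in> N" using uv by blast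
      have "?U u' + ?U v' = ?U (u' + v')" by (simp add: fun_eq_iff split_beta)
      moreover have "u' + v' \<in> N" using N(2) * by (simp add: submodule_def)
      ultimately show ?thesis unfolding * by (metis imageI)
    qed
    show "scal c v \<in> ?U ` N" if c: "c \<in> C" and v: "v \<in> ?U ` N" for c v
    proof -
      obtain v' where *: "v = ?U v'" "v' \<in> N" using v by blast
      have "scal c (?U v') = ?U (lmul c v')" by (simp add: fun_eq_iff split_beta scal_def lmul_def)
      moreover have "lmul c v' \<in> N" using N(2) c * by (simp add: submodule_def)
      ultimately show ?thesis unfolding * by (metis imageI)
    qed
    show "?U f \<in> vecs C B" using f(1) by (rule vecs)
    show "\<exists>h\<in>?U ` N. vagree d (?U f) h" for d
    proof -
      obtain h where "h \<in> N" "agree d f h" using f(2) by (rule adherentE)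
      then show ?thesis by (intro bexI[of _ "?U h"]) (auto simp: vagree_def agree_def)
    qed
  qed
  then obtain h where h: "h \<in> N" "?U f = ?U h" by blast
  have "f = h"
  proof (intro ext)
    fix \<beta> k \<alpha> show "f \<beta> k \<alpha> = h \<beta> k \<alpha>" using fun_cong[OF h(2), of "(\<beta>, k)"] by simp
  qed
  then show ?thesis using h(1) by simp
qed

section \<open>Closedness for formal power series\<close>

lemma coefficient_ring_formal: "coefficient_ring (formal_series :: ('k::field, 'n::finite) mfps set)"
proof
  fix B :: "('n expo \<times> nat) set" and N :: "('k, 'n) hop set" and f
  assume B: "finite B" and H: "N \<subseteq> free formal_series B" "submodule formal_series N" "f \<in> free formal_series B"
    "adherent N f"
  show "f \<in> N"
  proof (rule closed_of_vec_closed[OF _ H])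
    fix N :: "('n expo \<times> nat, 'k, 'n) vec set" and f
    assume N: "N \<subseteq> vecs formal_series B" "0 \<in> N" "\<And>u v. u \<in> N \<Longrightarrow> v \<in> N \<Longrightarrow> u + v \<in> N"
      "\<And>c v. c \<in> formal_series \<Longrightarrow> v \<in> N \<Longrightarrow> scal c v \<in> N"
      and f: "f \<in> vecs formal_series B" "\<And>d. \<exists>h\<in>N. vagree d f h"
    show "f \<in> N"
      by (rule closed_by_division[OF _ B N f]) (simp_all add: formal_series_def)
  qed
qed (simp_all add: formal_series_def)

section \<open>Closedness for convergent power series\<close>

definition norm_sum :: "(complex, 'n::finite) mfps \<Rightarrow> real \<Rightarrow> 'n expo set \<Rightarrow> real" where
  "norm_sum f r Z = (\<Sum>\<alpha>\<in>Z. norm (f \<alpha>) * r ^ deg \<alpha>)"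

lemma convergentI:
  assumes r: "r > 0" and M: "\<And>Z. finite Z \<Longrightarrow> norm_sum f r Z \<le> M"
  shows "f \<in> convergent_series"
proof -
  have "eventually (\<lambda>Z. (\<Sum>\<alpha>\<in>Z. norm (f \<alpha>) * r ^ deg \<alpha>) \<le> M) (finite_subsets_at_top UNIV)"
    using M by (intro eventually_finite_subsets_at_top_weakI) (simp add: norm_sum_def)
  then have "(\<lambda>\<alpha>. norm (f \<alpha>) * r ^ deg \<alpha>) summable_on UNIV"
    using r by (intro nonneg_bounded_partial_sums_imp_summable_on) auto
  then show ?thesis using r by (auto simp: convergent_series_def)
qed

lemma convergentE:
  assumes "f \<in> convergent_series"
  obtains r M where "r > 0" "M \<ge> 0" "\<And>Z. finite Z \<Longrightarrow> norm_sum f r Z \<le> M"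
proof -
  obtain r where r: "r > 0" "(\<lambda>\<alpha>. norm (f \<alpha>) * r ^ deg \<alpha>) summable_on UNIV"
    using assms by (auto simp: convergent_series_def)
  let ?M = "infsum (\<lambda>\<alpha>. norm (f \<alpha>) * r ^ deg \<alpha>) UNIV"
  have "norm_sum f r Z \<le> ?M" if "finite Z" for Z
    unfolding norm_sum_def using r that by (intro finite_sum_le_infsum) auto
  moreover from this[of "{}"] have "0 \<le> ?M" by (simp add: norm_sum_def)
  ultimately show ?thesis using r(1) that by blast
qed

lemma norm_sum_mono: "0 < r \<Longrightarrow> r \<le> r' \<Longrightarrow> norm_sum f r Z \<le> norm_sum f r' Z"
  unfolding norm_sum_def by (intro sum_mono mult_left_mono power_mono) auto

lemma convergent_of_le:
  assumes "f \<in> convergent_series" "\<And>\<alpha>. norm (g \<alpha>) \<le> norm (f \<alpha>)"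
  shows "g \<in> convergent_series"
proof -
  obtain r M where r: "r > 0" "\<And>Z. finite Z \<Longrightarrow> norm_sum f r Z \<le> M" using assms(1) by (rule convergentE) blast
  have "norm_sum g r Z \<le> norm_sum f r Z" for Z
    unfolding norm_sum_def using r(1) by (intro sum_mono mult_right_mono assms(2)) simp
  then show ?thesis using r by (intro convergentI[of r]) (auto intro: order_trans)
qed

lemma convergent_polynomials: "(polynomials :: (complex, 'n::finite) mfps set) \<subseteq> convergent_series"
proof
  fix f :: "(complex, 'n) mfps" assume "f \<in> polynomials"
  then have fin: "finite {\<alpha>. f \<alpha> \<noteq> 0}" by (simp add: polynomials_def)
  show "f \<in> convergent_series"
  proof (rule convergentI)
    fix Z :: "'n expo set" assume "finite Z"
    then have "norm_sum f 1 Z = (\<Sum>\<alpha>\<in>Z \<inter> {\<alpha>. f \<alpha> \<noteq> 0}. norm (f \<alpha>) * 1 ^ deg \<alpha>)"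
      unfolding norm_sum_def by (intro sum.mono_neutral_right) auto
    also have "\<dots> \<le> norm_sum f 1 {\<alpha>. f \<alpha> \<noteq> 0}"
      unfolding norm_sum_def using fin by (intro sum_mono2) auto
    finally show "norm_sum f 1 Z \<le> norm_sum f 1 {\<alpha>. f \<alpha> \<noteq> 0}" .
  qed simp
qed

lemma convergent_add:
  assumes "f \<in> convergent_series" "g \<in> convergent_series"
  shows "f + g \<in> convergent_series"
proof -
  obtain r M where r: "r > 0" "\<And>Z. finite Z \<Longrightarrow> norm_sum f r Z \<le> M" using assms(1) by (rule convergentE) blast
  obtain s L where s: "s > 0" "\<And>Z. finite Z \<Longrightarrow> norm_sum g s Z \<le> L" using assms(2) by (rule convergentE) blast
  let ?t = "min r s"
  have t: "?t > 0" using r s by simp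
  show ?thesis
  proof (rule convergentI[OF t])
    fix Z :: "'a expo set" assume Z: "finite Z"
    have "norm_sum (f + g) ?t Z \<le> norm_sum f ?t Z + norm_sum g ?t Z"
      unfolding norm_sum_def sum.distrib[symmetric] using t
      by (intro sum_mono) (simp add: distrib_right[symmetric] mult_right_mono norm_triangle_ineq)
    also have "\<dots> \<le> norm_sum f r Z + norm_sum g s Z"
      using t by (intro add_mono norm_sum_mono) auto
    also have "\<dots> \<le> M + L" using r(2)[OF Z] s(2)[OF Z] by (rule add_mono)
    finally show "norm_sum (f + g) ?t Z \<le> M + L" .
  qed
qed

lemma convergent_mult:
  assumes "f \<in> convergent_series" "g \<in> convergent_series"
  shows "mfps_mult f g \<in> convergent_series"
proof -
  obtain r M where r: "r > 0" "M \<ge> 0" "\<And>Z. finite Z \<Longrightarrow> norm_sum f r Z \<le> M" using assms(1) by (rule convergentE) blast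
  obtain s L where s: "s > 0" "L \<ge> 0" "\<And>Z. finite Z \<Longrightarrow> norm_sum g s Z \<le> L" using assms(2) by (rule convergentE) blast
  let ?t = "min r s"
  have t: "?t > 0" using r s by simp
  let ?F = "\<lambda>\<alpha>. norm (f \<alpha>) * ?t ^ deg \<alpha>" and ?G = "\<lambda>\<alpha>. norm (g \<alpha>) * ?t ^ deg \<alpha>"
  show ?thesis
  proof (rule convergentI[OF t])
    fix Z :: "'a expo set" assume Z: "finite Z"
    define X where "X = (\<Union>\<alpha>\<in>Z. {..\<alpha>})"
    have X: "finite X" using Z by (auto simp: X_def)
    have "norm_sum (mfps_mult f g) ?t Z \<le> (\<Sum>\<alpha>\<in>Z. \<Sum>\<gamma>\<in>{..\<alpha>}. ?F \<gamma> * ?G (\<alpha> - \<gamma>))"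
      unfolding norm_sum_def
    proof (rule sum_mono)
      fix \<alpha>
      have "norm (mfps_mult f g \<alpha>) * ?t ^ deg \<alpha> \<le> (\<Sum>\<gamma>\<in>{..\<alpha>}. norm (f \<gamma> * g (\<alpha> - \<gamma>))) * ?t ^ deg \<alpha>"
        unfolding mfps_mult_eq using t by (intro mult_right_mono norm_sum) simp
      also have "\<dots> = (\<Sum>\<gamma>\<in>{..\<alpha>}. ?F \<gamma> * ?G (\<alpha> - \<gamma>))"
        unfolding sum_distrib_right
      proof (rule sum.cong)
        fix \<gamma> assume "\<gamma> \<in> {..\<alpha>}"
        then have "deg (\<alpha> - \<gamma>) + deg \<gamma> = deg \<alpha>" using deg_diff by auto
        then have "?t ^ deg \<alpha> = ?t ^ deg (\<alpha> - \<gamma>) * ?t ^ deg \<gamma>" by (metis power_add)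
        then show "norm (f \<gamma> * g (\<alpha> - \<gamma>)) * ?t ^ deg \<alpha> = ?F \<gamma> * ?G (\<alpha> - \<gamma>)"
          by (simp add: norm_mult mult_ac)
      qed simp
      finally show "norm (mfps_mult f g \<alpha>) * ?t ^ deg \<alpha> \<le> (\<Sum>\<gamma>\<in>{..\<alpha>}. ?F \<gamma> * ?G (\<alpha> - \<gamma>))" .
    qed
    also have "\<dots> = (\<Sum>(\<gamma>, \<epsilon>)\<in>(\<lambda>(\<alpha>, \<gamma>). (\<gamma>, \<alpha> - \<gamma>)) ` (SIGMA \<alpha>:Z. {..\<alpha>}). ?F \<gamma> * ?G \<epsilon>)"
    proof -
      have "inj_on (\<lambda>(\<alpha>, \<gamma>). (\<gamma>, \<alpha> - \<gamma>)) (SIGMA \<alpha>:Z. {..\<alpha>})"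
      proof (rule inj_onI)
        fix x y assume x: "x \<in> (SIGMA \<alpha>:Z. {..\<alpha>})" and y: "y \<in> (SIGMA \<alpha>:Z. {..\<alpha>})"
          and eq: "(case x of (\<alpha>, \<gamma>) \<Rightarrow> (\<gamma>, \<alpha> - \<gamma>)) = (case y of (\<alpha>, \<gamma>) \<Rightarrow> (\<gamma>, \<alpha> - \<gamma>))"
        obtain \<alpha> \<gamma> \<alpha>' \<gamma>' where xy: "x = (\<alpha>, \<gamma>)" "y = (\<alpha>', \<gamma>')" by (cases x; cases y)
        then have "\<gamma> \<le> \<alpha>" "\<gamma>' \<le> \<alpha>'" "\<gamma> = \<gamma>'" "\<alpha> - \<gamma> = \<alpha>' - \<gamma>'" using x y eq by auto
        then show "x = y" unfolding xy by (metis expo_diff_add)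
      qed
      then show ?thesis using Z by (subst sum.reindex) (auto simp: sum.Sigma split_beta)
    qed
    also have "\<dots> \<le> (\<Sum>(\<gamma>, \<epsilon>)\<in>X \<times> X. ?F \<gamma> * ?G \<epsilon>)"
    proof (rule sum_mono2)
      show "finite (X \<times> X)" using X by simp
      show "(\<lambda>(\<alpha>, \<gamma>). (\<gamma>, \<alpha> - \<gamma>)) ` (SIGMA \<alpha>:Z. {..\<alpha>}) \<subseteq> X \<times> X"
        by (auto simp: X_def intro!: bexI)
    qed (use t in auto)
    also have "\<dots> = norm_sum f ?t X * norm_sum g ?t X"
      unfolding norm_sum_def by (simp add: sum_product sum.cartesian_product)
    also have "\<dots> \<le> M * L"
    proof (rule mult_mono)
      show "norm_sum f ?t X \<le> M" using norm_sum_mono[OF t, of r f X] r(3)[OF X] by simp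
      show "norm_sum g ?t X \<le> L" using norm_sum_mono[OF t, of s g X] s(3)[OF X] by simp
      show "0 \<le> norm_sum g ?t X" using t by (auto simp: norm_sum_def intro!: sum_nonneg)
    qed (use r in auto)
    finally show "norm_sum (mfps_mult f g) ?t Z \<le> M * L" .
  qed
qed

text \<open>Halving the radius absorbs the factor \<open>\<alpha>\<^sub>i + 1 \<le> 2\<^sup>|\<^sup>\<alpha>\<^sup>|\<close>.\<close>

lemma convergent_deriv:
  fixes f :: "(complex, 'n::finite) mfps"
  assumes "f \<in> convergent_series"
  shows "mfps_deriv (single i) f \<in> convergent_series"
proof -
  obtain r M where r: "r > 0" "\<And>Z. finite Z \<Longrightarrow> norm_sum f r Z \<le> M" using assms by (rule convergentE) blast
  show ?thesis
  proof (rule convergentI)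
    show "r / 2 > 0" using r by simp
    fix Z :: "'n expo set" assume Z: "finite Z"
    have le: "norm (mfps_deriv (single i) f \<alpha>) * (r / 2) ^ deg \<alpha>
        \<le> norm (f (\<alpha> + single i)) * r ^ deg (\<alpha> + single i) / r" for \<alpha> :: "'n expo"
    proof -
      have "real (\<alpha> i + 1) \<le> 2 ^ deg \<alpha>"
      proof -
        have "\<alpha> i + 1 \<le> deg \<alpha> + 1" using le_deg[of \<alpha> i] by simp
        also have "\<dots> \<le> 2 ^ deg \<alpha>" by (metis Suc_eq_plus1 Suc_leI less_exp)
        finally show ?thesis by (metis of_nat_le_iff of_nat_numeral of_nat_power)
      qed
      then have "real (\<alpha> i + 1) * norm (f (\<alpha> + single i)) * (r / 2) ^ deg \<alpha>
          \<le> 2 ^ deg \<alpha> * norm (f (\<alpha> + single i)) * (r / 2) ^ deg \<alpha>"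
        using r by (intro mult_right_mono) auto
      also have "\<dots> = norm (f (\<alpha> + single i)) * r ^ deg (\<alpha> + single i) / r"
        using r by (simp add: power_divide)
      moreover have "norm (mfps_deriv (single i) f \<alpha>) = real (\<alpha> i + 1) * norm (f (\<alpha> + single i))"
        unfolding deriv_single norm_mult norm_of_nat ..
      ultimately show ?thesis by simp
    qed
    have "norm_sum (mfps_deriv (single i) f) (r / 2) Z
        \<le> (\<Sum>\<alpha>\<in>Z. norm (f (\<alpha> + single i)) * r ^ deg (\<alpha> + single i) / r)"
      unfolding norm_sum_def by (intro sum_mono le)
    also have "\<dots> = norm_sum f r ((\<lambda>\<alpha>. \<alpha> + single i) ` Z) / r"
      unfolding norm_sum_def sum_divide_distrib[symmetric]
      by (subst sum.reindex) (auto simp: inj_on_def)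
    also have "\<dots> \<le> M / r" using r Z by (intro divide_right_mono) auto
    finally show "norm_sum (mfps_deriv (single i) f) (r / 2) Z \<le> M / r" .
  qed
qed

context monomial_order
begin

lemma mono_code_ge: "2 ^ deg \<alpha> \<le> mono_code \<alpha>"
proof -
  have "2 ^ deg \<alpha> = (\<Prod>i\<in>UNIV. 2 ^ \<alpha> i :: nat)" by (simp add: deg_def power_sum)
  also have "\<dots> \<le> mono_code \<alpha>"
    unfolding mono_code_def using prime_p prime_ge_2_nat by (intro prod_mono) (auto intro: power_mono)
  finally show ?thesis .
qed

lemma mono_code_le: "mono_code \<alpha> \<le> Max (range p) ^ deg \<alpha>"
proof -
  have "mono_code \<alpha> \<le> (\<Prod>i\<in>UNIV. Max (range p) ^ \<alpha> i)"
    unfolding mono_code_def by (intro prod_mono) (auto intro: power_mono)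
  then show ?thesis by (simp add: deg_def power_sum)
qed

definition key_norm :: "('b, complex, 'n) vec \<Rightarrow> nat \<Rightarrow> ('b \<times> 'n expo) set \<Rightarrow> real" where
  "key_norm v s Y = (\<Sum>\<delta>\<in>Y. norm (v (fst \<delta>) (snd \<delta>)) / real (key \<delta>) ^ s)"

lemma key_norm_antimono: "s \<le> s' \<Longrightarrow> key_norm v s' Y \<le> key_norm v s Y"
proof -
  assume s: "s \<le> s'"
  have "norm (v (fst \<delta>) (snd \<delta>)) / real (key \<delta>) ^ s' \<le> norm (v (fst \<delta>) (snd \<delta>)) / real (key \<delta>) ^ s" for \<delta>
  proof -
    have "1 \<le> real (key \<delta>)" using key_pos[of \<delta>] by linarith
    then show ?thesis using s by (intro divide_left_mono power_increasing mult_pos_pos) auto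
  qed
  then show ?thesis unfolding key_norm_def by (intro sum_mono)
qed

text \<open>The key grows at least like \<open>2\<^sup>|\<^sup>\<alpha>\<^sup>|\<close>, so its \<open>s\<close>-th power outgrows the inverse powers of any given radius of
  convergence.\<close>

lemma key_norm_bounded:
  assumes v: "\<And>j. j \<in> B \<Longrightarrow> v j \<in> convergent_series"
  obtains s M where "\<And>Y. finite Y \<Longrightarrow> fst ` Y \<subseteq> B \<Longrightarrow> key_norm v s Y \<le> M"
proof -
  have "\<forall>j\<in>B. \<exists>x :: nat \<times> real. \<forall>Z. finite Z \<longrightarrow>
      (\<Sum>\<alpha>\<in>Z. norm (v j \<alpha>) / real (key (j, \<alpha>)) ^ fst x) \<le> snd x"
  proof
    fix j assume j: "j \<in> B"
    obtain r M where r: "r > 0" "M \<ge> 0" "\<And>Z. finite Z \<Longrightarrow> norm_sum (v j) r Z \<le> M"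
      using v[OF j] by (rule convergentE) blast
    obtain s where s: "(1 / 2) ^ s < r" using real_arch_pow_inv[of r "1 / 2"] r(1) by auto
    have "norm (v j \<alpha>) / real (key (j, \<alpha>)) ^ s \<le> norm (v j \<alpha>) * r ^ deg \<alpha>" for \<alpha>
    proof -
      have "2 ^ deg \<alpha> \<le> key (j, \<alpha>)"
        using mono_code_ge[of \<alpha>] prime_e[of j] by (auto simp: key_def dest!: prime_gt_0_nat intro: order_trans)
      then have "(2 ^ deg \<alpha>) ^ s \<le> real (key (j, \<alpha>)) ^ s"
        by (intro power_mono) (metis of_nat_le_iff of_nat_numeral of_nat_power, simp)
      then have "norm (v j \<alpha>) / real (key (j, \<alpha>)) ^ s \<le> norm (v j \<alpha>) / (2 ^ deg \<alpha>) ^ s"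
        using key_pos[of "(j, \<alpha>)"] by (intro divide_left_mono mult_pos_pos) auto
      also have "\<dots> = norm (v j \<alpha>) * ((1 / 2) ^ s) ^ deg \<alpha>"
        by (simp add: power_mult[symmetric] mult.commute power_divide)
      also have "\<dots> \<le> norm (v j \<alpha>) * r ^ deg \<alpha>"
        using s by (intro mult_left_mono power_mono) auto
      finally show ?thesis .
    qed
    then have "(\<Sum>\<alpha>\<in>Z. norm (v j \<alpha>) / real (key (j, \<alpha>)) ^ s) \<le> norm_sum (v j) r Z" for Z
      unfolding norm_sum_def by (rule sum_mono)
    then have "(\<Sum>\<alpha>\<in>Z. norm (v j \<alpha>) / real (key (j, \<alpha>)) ^ s) \<le> M" if "finite Z" for Z
      using r(3)[OF that] by (rule order_trans)
    then show "\<exists>x :: nat \<times> real. \<forall>Z. finite Z \<longrightarrow>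
        (\<Sum>\<alpha>\<in>Z. norm (v j \<alpha>) / real (key (j, \<alpha>)) ^ fst x) \<le> snd x"
      by (intro exI[of _ "(s, M)"]) simp
  qed
  from bchoice[OF this] obtain h where h: "\<forall>j\<in>B. \<forall>Z. finite Z \<longrightarrow>
      (\<Sum>\<alpha>\<in>Z. norm (v j \<alpha>) / real (key (j, \<alpha>)) ^ fst (h j)) \<le> snd (h j)" by blast
  define s where "s j = fst (h j)" for j
  define M where "M j = snd (h j)" for j
  have sM: "(\<Sum>\<alpha>\<in>Z. norm (v j \<alpha>) / real (key (j, \<alpha>)) ^ s j) \<le> M j" if "j \<in> B" "finite Z" for j Z
    using h that unfolding s_def M_def by blast
  define s0 where "s0 = (\<Sum>j\<in>B. s j)"
  show ?thesis
  proof (rule that[of s0 "\<Sum>j\<in>B. M j"])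
    fix Y :: "('b \<times> 'n expo) set" assume Y: "finite Y" "fst ` Y \<subseteq> B"
    have "key_norm v s0 Y \<le> key_norm v s0 (B \<times> snd ` Y)"
      unfolding key_norm_def using Y finite_B by (intro sum_mono2) force+
    also have "\<dots> = (\<Sum>j\<in>B. \<Sum>\<alpha>\<in>snd ` Y. norm (v j \<alpha>) / real (key (j, \<alpha>)) ^ s0)"
      unfolding key_norm_def by (simp add: sum.cartesian_product split_beta)
    also have "\<dots> \<le> (\<Sum>j\<in>B. M j)"
    proof (rule sum_mono)
      fix j assume j: "j \<in> B"
      have "s j \<le> s0" unfolding s0_def using j finite_B by (intro member_le_sum) auto
      then have "norm (v j \<alpha>) / real (key (j, \<alpha>)) ^ s0 \<le> norm (v j \<alpha>) / real (key (j, \<alpha>)) ^ s j" for \<alpha>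
        using key_norm_antimono[of "s j" s0 v "{(j, \<alpha>)}"] by (simp add: key_norm_def)
      then have "(\<Sum>\<alpha>\<in>snd ` Y. norm (v j \<alpha>) / real (key (j, \<alpha>)) ^ s0)
          \<le> (\<Sum>\<alpha>\<in>snd ` Y. norm (v j \<alpha>) / real (key (j, \<alpha>)) ^ s j)" by (intro sum_mono)
      also have "\<dots> \<le> M j" using Y j by (intro sM) auto
      finally show "(\<Sum>\<alpha>\<in>snd ` Y. norm (v j \<alpha>) / real (key (j, \<alpha>)) ^ s0) \<le> M j" .
    qed
    finally show "key_norm v s0 Y \<le> (\<Sum>j\<in>B. M j)" .
  qed
qed

text \<open>Keys are integers, so each key larger than \<open>K\<close> exceeds it at least by the factor
  \<open>(K + 1) / K\<close>; raised to a high power, this factor outweighs any convergent tail.\<close>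

lemma key_norm_tail:
  assumes v: "\<And>j. j \<in> B \<Longrightarrow> v j \<in> convergent_series" and K: "0 < K"
  shows "\<exists>s. \<forall>s' Y. s \<le> s' \<longrightarrow> finite Y \<longrightarrow> fst ` Y \<subseteq> B \<longrightarrow> (\<forall>\<delta>\<in>Y. K < key \<delta>)
    \<longrightarrow> key_norm v s' Y \<le> 1 / (2 * real K ^ s')"
proof -
  obtain s0 M where s0: "\<And>Y. finite Y \<Longrightarrow> fst ` Y \<subseteq> B \<Longrightarrow> key_norm v s0 Y \<le> M"
  proof (rule key_norm_bounded[of v])
    show "v j \<in> convergent_series" if "j \<in> B" for j using v that .
  qed (rule that)
  let ?q = "real K / (real K + 1)"
  have q: "0 < ?q" "?q < 1" using K by auto
  \<comment> \<open>\<open>L q\<^sup>m \<le> 1\<close> is what the bound on the tail amounts to for \<open>s' = s0 + m\<close>\<close>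
  define L where "L = 2 * (\<bar>M\<bar> + 1) * real K ^ s0"
  have L: "L > 0" using K by (simp add: L_def add_pos_nonneg mult_pos_pos)
  obtain t where t: "?q ^ t < 1 / L" using real_arch_pow_inv[of "1 / L" ?q] q L by auto
  show ?thesis
  proof (intro exI[of _ "s0 + t"] allI impI)
    fix s' and Y :: "('b \<times> 'n expo) set"
    assume s': "s0 + t \<le> s'" and Y: "finite Y" "fst ` Y \<subseteq> B" "\<forall>\<delta>\<in>Y. K < key \<delta>"
    define m where "m = s' - s0"
    have m: "s' = s0 + m" "t \<le> m" using s' by (auto simp: m_def)
    have "key_norm v s' Y \<le> (\<Sum>\<delta>\<in>Y. norm (v (fst \<delta>) (snd \<delta>)) / real (key \<delta>) ^ s0 / (real K + 1) ^ m)"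
      unfolding key_norm_def
    proof (rule sum_mono)
      fix \<delta> assume "\<delta> \<in> Y"
      then have k: "real K + 1 \<le> real (key \<delta>)" using bspec[OF Y(3), of \<delta>] by linarith
      have "norm (v (fst \<delta>) (snd \<delta>)) / real (key \<delta>) ^ s'
          = norm (v (fst \<delta>) (snd \<delta>)) / real (key \<delta>) ^ s0 / real (key \<delta>) ^ m"
        unfolding m(1) by (simp add: power_add)
      also have "\<dots> \<le> norm (v (fst \<delta>) (snd \<delta>)) / real (key \<delta>) ^ s0 / (real K + 1) ^ m"
        using k K by (intro divide_left_mono power_mono mult_pos_pos zero_less_power) auto
      finally show "norm (v (fst \<delta>) (snd \<delta>)) / real (key \<delta>) ^ s'
          \<le> norm (v (fst \<delta>) (snd \<delta>)) / real (key \<delta>) ^ s0 / (real K + 1) ^ m" .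
    qed
    also have "\<dots> = key_norm v s0 Y / (real K + 1) ^ m"
      unfolding key_norm_def by (rule sum_divide_distrib[symmetric])
    also have "\<dots> \<le> (\<bar>M\<bar> + 1) / (real K + 1) ^ m"
      using s0[OF Y(1,2)] by (intro divide_right_mono) auto
    also have "\<dots> = L * ?q ^ m * (1 / (2 * real K ^ s'))"
      using K unfolding m(1) L_def by (simp add: power_add power_divide field_simps)
    also have "\<dots> \<le> 1 * (1 / (2 * real K ^ s'))"
    proof (rule mult_right_mono)
      have "?q ^ m \<le> ?q ^ t" using m(2) q by (intro power_decreasing) auto
      then have "L * ?q ^ m \<le> L * (1 / L)" using t L by (intro mult_left_mono) auto
      then show "L * ?q ^ m \<le> 1" using L by simp
    qed simp
    finally show "key_norm v s' Y \<le> 1 / (2 * real K ^ s')" by simp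
  qed
qed

end

text \<open>For a norm in which the tail of each generator weighs at most half of its leading term, the
  recursion of the division is a contraction, and bounds the quotients by the dividend. As the
  recursion refers to smaller keys only, this can be seen on finite partial sums.\<close>

lemma convergent_quotients:
  fixes g :: "'b \<times> 'n::finite expo \<Rightarrow> ('b, complex, 'n) vec"
  assumes sb: "standard_basis p e B E G red g" and g: "g ` G \<subseteq> vecs convergent_series B"
    and f: "f \<in> vecs convergent_series B"
    and Q: "\<And>\<delta>. Q \<delta> = f (fst \<delta>) (snd \<delta>)
         - (\<Sum>\<delta>'\<in>{\<delta>'\<in>E. monomial_order.key p e \<delta>' < monomial_order.key p e \<delta>}.
              Q \<delta>' * standard_basis.shift red g \<delta>' \<delta>)"
    and \<delta>0: "\<delta>0 \<in> G"
  shows "standard_basis.quotients E red Q \<delta>0 \<in> convergent_series"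
proof -
  interpret standard_basis p e B E G red g by fact
  have "\<forall>\<delta>1\<in>G. \<exists>s. \<forall>s' Y. s \<le> s' \<longrightarrow> finite Y \<longrightarrow> fst ` Y \<subseteq> B \<longrightarrow> (\<forall>\<delta>\<in>Y. key \<delta>1 < key \<delta>)
      \<longrightarrow> key_norm (g \<delta>1) s' Y \<le> 1 / (2 * real (key \<delta>1) ^ s')"
  proof
    fix \<delta>1 assume "\<delta>1 \<in> G"
    then have "g \<delta>1 j \<in> convergent_series" for j using g by (auto simp: vecs_def)
    then show "\<exists>s. \<forall>s' Y. s \<le> s' \<longrightarrow> finite Y \<longrightarrow> fst ` Y \<subseteq> B \<longrightarrow> (\<forall>\<delta>\<in>Y. key \<delta>1 < key \<delta>)
      \<longrightarrow> key_norm (g \<delta>1) s' Y \<le> 1 / (2 * real (key \<delta>1) ^ s')" by (intro key_norm_tail key_pos)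
  qed
  from bchoice[OF this] obtain s1 where s1': "\<forall>\<delta>1\<in>G. \<forall>s' Y. s1 \<delta>1 \<le> s' \<longrightarrow> finite Y \<longrightarrow> fst ` Y \<subseteq> B
      \<longrightarrow> (\<forall>\<delta>\<in>Y. key \<delta>1 < key \<delta>) \<longrightarrow> key_norm (g \<delta>1) s' Y \<le> 1 / (2 * real (key \<delta>1) ^ s')"
    by blast
  have s1: "key_norm (g \<delta>1) s' Y \<le> 1 / (2 * real (key \<delta>1) ^ s')"
    if "\<delta>1 \<in> G" "s1 \<delta>1 \<le> s'" "finite Y" "fst ` Y \<subseteq> B" "\<forall>\<delta>\<in>Y. key \<delta>1 < key \<delta>" for \<delta>1 s' Y
    using s1' that by blast
  have "f j \<in> convergent_series" for j using f by (auto simp: vecs_def)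
  then obtain s0 M where s0: "\<And>Y. finite Y \<Longrightarrow> fst ` Y \<subseteq> B \<Longrightarrow> key_norm f s0 Y \<le> M"
    by (rule key_norm_bounded[of f]) (rule that)
  define s where "s = s0 + (\<Sum>\<delta>1\<in>G. s1 \<delta>1)"
  have s_s1: "s1 \<delta>1 \<le> s" if "\<delta>1 \<in> G" for \<delta>1
    using member_le_sum[of \<delta>1 G s1] that finite_G by (simp add: s_def)
  let ?w = "\<lambda>\<delta>. 1 / real (key \<delta>) ^ s"
  have shift_bound: "(\<Sum>\<delta>\<in>{\<delta>\<in>Y. key \<delta>' < key \<delta>}. norm (shift \<delta>' \<delta>) * ?w \<delta>) \<le> ?w \<delta>' / 2"
    if Y: "finite Y" "fst ` Y \<subseteq> B" and \<delta>': "\<delta>' \<in> E" for \<delta>' Y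
  proof -
    let ?c = "cofactor \<delta>'"
    let ?Y = "{\<delta>\<in>Y. key \<delta>' < key \<delta> \<and> ?c \<le> snd \<delta>}"
    let ?h = "\<lambda>\<delta>. (fst \<delta>, snd \<delta> - ?c)"
    have key_h: "key \<delta> = key (?h \<delta>) * mono_code ?c" if "?c \<le> snd \<delta>" for \<delta>
      using key_diff[OF that, of "fst \<delta>"] by simp
    have "(\<Sum>\<delta>\<in>{\<delta>\<in>Y. key \<delta>' < key \<delta>}. norm (shift \<delta>' \<delta>) * ?w \<delta>)
        = (\<Sum>\<delta>\<in>?Y. norm (g (red \<delta>') (fst \<delta>) (snd \<delta> - ?c)) * ?w \<delta>)"
      using Y by (intro sum.mono_neutral_cong_right) (auto simp: shift_def)
    also have "\<dots> = (\<Sum>\<delta>\<in>?Y. norm (g (red \<delta>') (fst (?h \<delta>)) (snd (?h \<delta>))) / real (key (?h \<delta>)) ^ s)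
        / real (mono_code ?c) ^ s"
      unfolding sum_divide_distrib
    proof (rule sum.cong)
      fix \<delta> assume "\<delta> \<in> ?Y"
      then have "real (key \<delta>) ^ s = real (key (?h \<delta>)) ^ s * real (mono_code ?c) ^ s"
        using key_h[of \<delta>] by (simp add: power_mult_distrib)
      then show "norm (g (red \<delta>') (fst \<delta>) (snd \<delta> - ?c)) * ?w \<delta>
          = norm (g (red \<delta>') (fst (?h \<delta>)) (snd (?h \<delta>))) / real (key (?h \<delta>)) ^ s / real (mono_code ?c) ^ s"
        by simp
    qed simp
    also have "(\<Sum>\<delta>\<in>?Y. norm (g (red \<delta>') (fst (?h \<delta>)) (snd (?h \<delta>))) / real (key (?h \<delta>)) ^ s)
        = key_norm (g (red \<delta>')) s (?h ` ?Y)"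
    proof -
      have "inj_on ?h ?Y"
      proof (rule inj_onI)
        fix x y assume "x \<in> ?Y" "y \<in> ?Y" "?h x = ?h y"
        then have "fst x = fst y" "snd x - ?c + ?c = snd y - ?c + ?c" "?c \<le> snd x" "?c \<le> snd y" by auto
        then show "x = y" by (simp add: prod_eq_iff)
      qed
      then show ?thesis unfolding key_norm_def by (simp add: sum.reindex)
    qed
    also have "key_norm (g (red \<delta>')) s (?h ` ?Y) \<le> 1 / (2 * real (key (red \<delta>')) ^ s)"
    proof (rule s1[OF red_G[OF \<delta>'] s_s1[OF red_G[OF \<delta>']]])
      show "finite (?h ` ?Y)" using Y by simp
      show "fst ` ?h ` ?Y \<subseteq> B" using Y(2) by auto
      show "\<forall>\<delta>\<in>?h ` ?Y. key (red \<delta>') < key \<delta>"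
      proof
        fix \<epsilon> assume "\<epsilon> \<in> ?h ` ?Y"
        then obtain \<delta> where \<delta>: "\<epsilon> = ?h \<delta>" "\<delta> \<in> ?Y" by blast
        then have "key (red \<delta>') * mono_code ?c < key \<epsilon> * mono_code ?c"
          using key_h[of \<delta>] key_red[OF \<delta>'] by simp
        then show "key (red \<delta>') < key \<epsilon>" by simp
      qed
    qed
    then have "key_norm (g (red \<delta>')) s (?h ` ?Y) / real (mono_code ?c) ^ s
        \<le> 1 / (2 * real (key (red \<delta>')) ^ s) / real (mono_code ?c) ^ s"
      by (intro divide_right_mono) auto
    also have "\<dots> = ?w \<delta>' / 2" using key_red[OF \<delta>'] by (simp add: power_mult_distrib)
    finally show ?thesis .
  qed
  have Q_bound: "(\<Sum>\<delta>\<in>{\<delta>. fst \<delta> \<in> B \<and> key \<delta> \<le> X}. norm (Q \<delta>) * ?w \<delta>) \<le> 2 * M" for X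
  proof -
    let ?F = "{\<delta>. fst \<delta> \<in> B \<and> key \<delta> \<le> X}"
    let ?S = "\<Sum>\<delta>\<in>?F. norm (Q \<delta>) * ?w \<delta>"
    have F: "finite ?F" by (rule finite_key_le)
    have EF: "finite (E \<inter> ?F)" using F by blast
    have "norm (Q \<delta>) * ?w \<delta> \<le> norm (f (fst \<delta>) (snd \<delta>)) / real (key \<delta>) ^ s
        + (\<Sum>\<delta>'\<in>E \<inter> ?F. if key \<delta>' < key \<delta> then norm (Q \<delta>') * (norm (shift \<delta>' \<delta>) * ?w \<delta>) else 0)"
      if \<delta>: "\<delta> \<in> ?F" for \<delta>
    proof -
      let ?R = "{\<delta>'\<in>E. key \<delta>' < key \<delta>}"
      have R: "?R = {\<delta>' \<in> E \<inter> ?F. key \<delta>' < key \<delta>}" using \<delta> E_B by auto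
      have "norm (Q \<delta>) \<le> norm (f (fst \<delta>) (snd \<delta>)) + norm (\<Sum>\<delta>'\<in>?R. Q \<delta>' * shift \<delta>' \<delta>)"
        using arg_cong[OF Q[of \<delta>], of norm]
          norm_triangle_ineq4[of "f (fst \<delta>) (snd \<delta>)" "\<Sum>\<delta>'\<in>?R. Q \<delta>' * shift \<delta>' \<delta>"] by linarith
      also have "norm (\<Sum>\<delta>'\<in>?R. Q \<delta>' * shift \<delta>' \<delta>) \<le> (\<Sum>\<delta>'\<in>?R. norm (Q \<delta>') * norm (shift \<delta>' \<delta>))"
        using norm_sum[of "\<lambda>\<delta>'. Q \<delta>' * shift \<delta>' \<delta>" ?R] by (simp add: norm_mult)
      finally have "norm (Q \<delta>) * ?w \<delta>
          \<le> (norm (f (fst \<delta>) (snd \<delta>)) + (\<Sum>\<delta>'\<in>?R. norm (Q \<delta>') * norm (shift \<delta>' \<delta>))) * ?w \<delta>"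
        by (intro mult_right_mono) auto
      also have "\<dots> = norm (f (fst \<delta>) (snd \<delta>)) / real (key \<delta>) ^ s
          + (\<Sum>\<delta>'\<in>?R. norm (Q \<delta>') * (norm (shift \<delta>' \<delta>) * ?w \<delta>))"
        by (simp add: add_divide_distrib sum_divide_distrib)
      also have "(\<Sum>\<delta>'\<in>?R. norm (Q \<delta>') * (norm (shift \<delta>' \<delta>) * ?w \<delta>))
          = (\<Sum>\<delta>'\<in>E \<inter> ?F. if key \<delta>' < key \<delta> then norm (Q \<delta>') * (norm (shift \<delta>' \<delta>) * ?w \<delta>) else 0)"
        unfolding R using EF by (rule sum.inter_filter)
      finally show ?thesis .
    qed
    then have "?S \<le> key_norm f s ?F + (\<Sum>\<delta>\<in>?F. \<Sum>\<delta>'\<in>E \<inter> ?F.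
        if key \<delta>' < key \<delta> then norm (Q \<delta>') * (norm (shift \<delta>' \<delta>) * ?w \<delta>) else 0)"
      unfolding key_norm_def sum.distrib[symmetric] by (rule sum_mono)
    also have "(\<Sum>\<delta>\<in>?F. \<Sum>\<delta>'\<in>E \<inter> ?F.
        if key \<delta>' < key \<delta> then norm (Q \<delta>') * (norm (shift \<delta>' \<delta>) * ?w \<delta>) else 0)
      = (\<Sum>\<delta>'\<in>E \<inter> ?F. norm (Q \<delta>') * (\<Sum>\<delta>\<in>{\<delta>\<in>?F. key \<delta>' < key \<delta>}. norm (shift \<delta>' \<delta>) * ?w \<delta>))"
      unfolding sum.inter_filter[OF F] sum_distrib_left
      by (subst sum.swap) (intro sum.cong refl, simp)
    also have "\<dots> \<le> (\<Sum>\<delta>'\<in>E \<inter> ?F. norm (Q \<delta>') * (?w \<delta>' / 2))"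
      using F by (intro sum_mono mult_left_mono shift_bound) auto
    also have "\<dots> \<le> (\<Sum>\<delta>'\<in>?F. norm (Q \<delta>') * (?w \<delta>' / 2))"
      using F by (intro sum_mono2) auto
    also have "\<dots> = ?S / 2" by (simp add: sum_divide_distrib)
    also have "key_norm f s ?F \<le> M"
    proof -
      have "key_norm f s ?F \<le> key_norm f s0 ?F" by (rule key_norm_antimono) (simp add: s_def)
      also have "\<dots> \<le> M" using F by (intro s0) auto
      finally show ?thesis .
    qed
    finally show ?thesis by simp
  qed
  \<comment> \<open>the largest prime gives the radius: \<open>mono_code \<gamma>\<close> is at most its power with exponent \<open>deg \<gamma>\<close>\<close>
  let ?pm = "real (Max (range p))"
  have p1: "1 \<le> ?pm"
  proof -
    have "p undefined \<le> Max (range p)" by simp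
    moreover have "0 < p undefined" using prime_p prime_gt_0_nat by blast
    ultimately show ?thesis by linarith
  qed
  show ?thesis
  proof (rule convergentI[of "1 / ?pm ^ s"])
    show "1 / ?pm ^ s > 0" using p1 by simp
    fix Z :: "'n expo set" assume Z: "finite Z"
    let ?h = "\<lambda>\<gamma>. (fst \<delta>0, snd \<delta>0 + \<gamma>)"
    define X where "X = Max (insert 0 (key ` ?h ` Z))"
    have "norm (quotients Q \<delta>0 \<gamma>) * (1 / ?pm ^ s) ^ deg \<gamma> \<le> real (key \<delta>0) ^ s * (norm (Q (?h \<gamma>)) * ?w (?h \<gamma>))" for \<gamma>
    proof -
      have "real (mono_code \<gamma>) ^ s \<le> (?pm ^ deg \<gamma>) ^ s"
        using mono_code_le[of \<gamma>] by (intro power_mono) (metis of_nat_le_iff of_nat_power, simp)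
      then have "1 / (?pm ^ deg \<gamma>) ^ s \<le> 1 / real (mono_code \<gamma>) ^ s"
        using mono_code_pos[of \<gamma>] p1 by (intro divide_left_mono mult_pos_pos zero_less_power) auto
      then have "(1 / ?pm ^ s) ^ deg \<gamma> \<le> 1 / real (mono_code \<gamma>) ^ s"
        by (simp add: power_divide power_mult[symmetric] mult.commute)
      also have "\<dots> = real (key \<delta>0) ^ s * ?w (?h \<gamma>)"
        using key_add[of "fst \<delta>0" "snd \<delta>0" \<gamma>] key_pos[of \<delta>0] by (simp add: power_mult_distrib)
      finally have "norm (quotients Q \<delta>0 \<gamma>) * (1 / ?pm ^ s) ^ deg \<gamma>
          \<le> norm (Q (?h \<gamma>)) * (real (key \<delta>0) ^ s * ?w (?h \<gamma>))"
        by (intro mult_mono) (auto simp: quotients_def)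
      then show ?thesis by (simp only: mult.left_commute)
    qed
    then have "norm_sum (quotients Q \<delta>0) (1 / ?pm ^ s) Z
        \<le> (\<Sum>\<gamma>\<in>Z. real (key \<delta>0) ^ s * (norm (Q (?h \<gamma>)) * ?w (?h \<gamma>)))"
      unfolding norm_sum_def by (rule sum_mono)
    also have "\<dots> = real (key \<delta>0) ^ s * (\<Sum>\<delta>\<in>?h ` Z. norm (Q \<delta>) * ?w \<delta>)"
      unfolding sum_distrib_left[symmetric] by (subst sum.reindex) (auto simp: inj_on_def)
    also have "(\<Sum>\<delta>\<in>?h ` Z. norm (Q \<delta>) * ?w \<delta>) \<le> (\<Sum>\<delta>\<in>{\<delta>. fst \<delta> \<in> B \<and> key \<delta> \<le> X}. norm (Q \<delta>) * ?w \<delta>)"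
    proof (rule sum_mono2)
      show "finite {\<delta>. fst \<delta> \<in> B \<and> key \<delta> \<le> X}" by (rule finite_key_le)
      show "?h ` Z \<subseteq> {\<delta>. fst \<delta> \<in> B \<and> key \<delta> \<le> X}"
      proof
        fix \<delta> assume \<delta>: "\<delta> \<in> ?h ` Z"
        have "key \<delta> \<le> X" unfolding X_def using \<delta> Z by (intro Max_ge) auto
        moreover have "fst \<delta> \<in> B" using \<delta> lead_g[OF \<delta>0] by (auto simp: is_lead_def)
        ultimately show "\<delta> \<in> {\<delta>. fst \<delta> \<in> B \<and> key \<delta> \<le> X}" by blast
      qed
    qed auto
    also have "\<dots> \<le> 2 * M" by (rule Q_bound)
    finally show "norm_sum (quotients Q \<delta>0) (1 / ?pm ^ s) Z \<le> real (key \<delta>0) ^ s * (2 * M)"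
      by (simp add: mult_left_mono)
  qed
qed

lemma coefficient_ring_convergent:
  "coefficient_ring (convergent_series :: (complex, 'n::finite) mfps set)"
proof
  fix B :: "('n expo \<times> nat) set" and N :: "(complex, 'n) hop set" and f
  assume B: "finite B" and H: "N \<subseteq> free convergent_series B" "submodule convergent_series N"
    "f \<in> free convergent_series B" "adherent N f"
  show "f \<in> N"
  proof (rule closed_of_vec_closed[OF _ H])
    fix N :: "('n expo \<times> nat, complex, 'n) vec set" and f
    assume N: "N \<subseteq> vecs convergent_series B" "0 \<in> N" "\<And>u v. u \<in> N \<Longrightarrow> v \<in> N \<Longrightarrow> u + v \<in> N"
      "\<And>c v. c \<in> convergent_series \<Longrightarrow> v \<in> N \<Longrightarrow> scal c v \<in> N"
      and f: "f \<in> vecs convergent_series B" "\<And>d. \<exists>h\<in>N. vagree d f h"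
    show "f \<in> N"
    proof (rule closed_by_division[OF convergent_polynomials B N(1,2) _ _ f])
      fix p :: "'n \<Rightarrow> nat" and e E G red and g :: "('n expo \<times> nat) \<times> 'n expo \<Rightarrow> _" and Q \<delta>0
      assume sb: "standard_basis p e B E G red g" "g ` G \<subseteq> vecs convergent_series B"
        and Q: "\<And>\<delta>. Q \<delta> = f (fst \<delta>) (snd \<delta>)
         - (\<Sum>\<delta>'\<in>{\<delta>'\<in>E. monomial_order.key p e \<delta>' < monomial_order.key p e \<delta>}.
              Q \<delta>' * standard_basis.shift red g \<delta>' \<delta>)"
        and \<delta>0: "\<delta>0 \<in> G"
      show "standard_basis.quotients E red Q \<delta>0 \<in> convergent_series"
        using sb f(1) Q \<delta>0 by (rule convergent_quotients)
    qed (rule N(3,4), assumption+)+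
  qed
next
  fix c :: "(complex, 'n) mfps" and u e assume "c \<in> convergent_series"
  then show "slice u e c \<in> convergent_series" by (rule convergent_of_le) (simp add: slice_def)
qed (auto intro: convergent_add convergent_mult convergent_deriv convergent_polynomials[THEN subsetD])

section \<open>Localization of the polynomial ring\<close>

lemma polynomials_add: "f \<in> polynomials \<Longrightarrow> g \<in> polynomials \<Longrightarrow> f + g \<in> polynomials"
proof -
  assume "f \<in> polynomials" "g \<in> polynomials"
  then have fin: "finite ({\<alpha>. f \<alpha> \<noteq> 0} \<union> {\<alpha>. g \<alpha> \<noteq> 0})" by (simp add: polynomials_def)
  show "f + g \<in> polynomials"
    unfolding polynomials_def using fin by (intro CollectI) (rule finite_subset[rotated], assumption, auto)
qed

lemma polynomials_mult: "f \<in> polynomials \<Longrightarrow> g \<in> polynomials \<Longrightarrow> mfps_mult f g \<in> polynomials"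
proof -
  assume "f \<in> polynomials" "g \<in> polynomials"
  then have fin: "finite ((\<lambda>(\<gamma>, \<delta>). \<gamma> + \<delta>) ` ({\<alpha>. f \<alpha> \<noteq> 0} \<times> {\<alpha>. g \<alpha> \<noteq> 0}))" by (simp add: polynomials_def)
  have "{\<alpha>. mfps_mult f g \<alpha> \<noteq> 0} \<subseteq> (\<lambda>(\<gamma>, \<delta>). \<gamma> + \<delta>) ` ({\<alpha>. f \<alpha> \<noteq> 0} \<times> {\<alpha>. g \<alpha> \<noteq> 0})"
  proof
    fix \<alpha> assume "\<alpha> \<in> {\<alpha>. mfps_mult f g \<alpha> \<noteq> 0}"
    then have "(\<Sum>\<gamma>\<in>{..\<alpha>}. f \<gamma> * g (\<alpha> - \<gamma>)) \<noteq> 0" by (simp add: mfps_mult_eq)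
    then obtain \<gamma> where "\<gamma> \<in> {..\<alpha>}" "f \<gamma> * g (\<alpha> - \<gamma>) \<noteq> 0" by (rule sum.not_neutral_contains_not_neutral)
    then show "\<alpha> \<in> (\<lambda>(\<gamma>, \<delta>). \<gamma> + \<delta>) ` ({\<alpha>. f \<alpha> \<noteq> 0} \<times> {\<alpha>. g \<alpha> \<noteq> 0})"
      by (intro image_eqI[of _ _ "(\<gamma>, \<alpha> - \<gamma>)"]) auto
  qed
  then show ?thesis unfolding polynomials_def using fin by (intro CollectI) (rule finite_subset)
qed

lemma polynomials_deriv:
  assumes "f \<in> polynomials"
  shows "mfps_deriv (single i) f \<in> polynomials"
proof -
  have "finite ((\<lambda>\<alpha>. \<alpha> - single i) ` {\<alpha>. f \<alpha> \<noteq> 0})" using assms by (simp add: polynomials_def)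
  moreover have "{\<alpha>. mfps_deriv (single i) f \<alpha> \<noteq> 0} \<subseteq> (\<lambda>\<alpha>. \<alpha> - single i) ` {\<alpha>. f \<alpha> \<noteq> 0}"
  proof
    fix \<alpha> assume "\<alpha> \<in> {\<alpha>. mfps_deriv (single i) f \<alpha> \<noteq> 0}"
    then have "f (\<alpha> + single i) \<noteq> 0" by (auto simp: deriv_single)
    then show "\<alpha> \<in> (\<lambda>\<alpha>. \<alpha> - single i) ` {\<alpha>. f \<alpha> \<noteq> 0}"
      by (intro image_eqI[of _ _ "\<alpha> + single i"]) auto
  qed
  ultimately show ?thesis unfolding polynomials_def by (intro CollectI) (rule finite_subset)
qed

lemma polynomials_slice:
  assumes "f \<in> polynomials"
  shows "slice u e f \<in> polynomials"
proof -
  have "finite {\<alpha>. f \<alpha> \<noteq> 0}" using assms by (simp add: polynomials_def)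
  then have "finite {\<alpha>. slice u e f \<alpha> \<noteq> 0}" by (rule finite_subset[rotated]) (auto simp: slice_def)
  then show ?thesis by (simp add: polynomials_def)
qed

lemma polynomials_uminus: "f \<in> polynomials \<Longrightarrow> - f \<in> polynomials"
  by (simp add: polynomials_def)

lemma polynomials_diff: "f \<in> polynomials \<Longrightarrow> g \<in> polynomials \<Longrightarrow> f - g \<in> polynomials"
  using polynomials_add[of f "- g"] polynomials_uminus[of g] by simp

lemma mfps_inverse_exists:
  fixes q :: "('k::field, 'n::finite) mfps"
  assumes "q 0 \<noteq> 0"
  obtains g where "mfps_mult q g = mfps_one"
proof -
  obtain g where g: "\<And>\<alpha>. g \<alpha> = (mfps_one \<alpha> - (\<Sum>\<gamma>\<in>{..\<alpha>} - {0}. q \<gamma> * g (\<alpha> - \<gamma>))) / q 0"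
  proof (rule causal_fixpoint[where h = deg
        and F = "\<lambda>g \<alpha>. (mfps_one \<alpha> - (\<Sum>\<gamma>\<in>{..\<alpha>} - {0}. q \<gamma> * g (\<alpha> - \<gamma>))) / q 0"])
    fix g g' :: "('k, 'n) mfps" and \<alpha> :: "'n expo"
    assume *: "\<And>\<beta>. deg \<beta> < deg \<alpha> \<Longrightarrow> g \<beta> = g' \<beta>"
    have "g (\<alpha> - \<gamma>) = g' (\<alpha> - \<gamma>)" if "\<gamma> \<in> {..\<alpha>} - {0}" for \<gamma>
    proof (rule *)
      have "deg (\<alpha> - \<gamma>) + deg \<gamma> = deg \<alpha>" using that deg_diff by auto
      moreover have "deg \<gamma> \<noteq> 0" using that by auto
      ultimately show "deg (\<alpha> - \<gamma>) < deg \<alpha>" by linarith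
    qed
    then have "(\<Sum>\<gamma>\<in>{..\<alpha>} - {0}. q \<gamma> * g (\<alpha> - \<gamma>)) = (\<Sum>\<gamma>\<in>{..\<alpha>} - {0}. q \<gamma> * g' (\<alpha> - \<gamma>))"
      by (intro sum.cong) simp_all
    then show "(mfps_one \<alpha> - (\<Sum>\<gamma>\<in>{..\<alpha>} - {0}. q \<gamma> * g (\<alpha> - \<gamma>))) / q 0
        = (mfps_one \<alpha> - (\<Sum>\<gamma>\<in>{..\<alpha>} - {0}. q \<gamma> * g' (\<alpha> - \<gamma>))) / q 0"
      by (simp only:)
  qed (rule that)
  have "mfps_mult q g \<alpha> = mfps_one \<alpha>" for \<alpha>
  proof -
    have "mfps_mult q g \<alpha> = q 0 * g \<alpha> + (\<Sum>\<gamma>\<in>{..\<alpha>} - {0}. q \<gamma> * g (\<alpha> - \<gamma>))"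
      unfolding mfps_mult_eq by (subst sum.remove[of _ 0]) auto
    moreover have "q 0 * g \<alpha> = mfps_one \<alpha> - (\<Sum>\<gamma>\<in>{..\<alpha>} - {0}. q \<gamma> * g (\<alpha> - \<gamma>))"
      by (subst g) (simp add: assms)
    ultimately show ?thesis by simp
  qed
  then have "mfps_mult q g = mfps_one" by (intro ext)
  then show ?thesis by (rule that)
qed

lemma local_fractions_iff:
  "f \<in> local_fractions \<longleftrightarrow> (\<exists>q\<in>polynomials. q 0 \<noteq> 0 \<and> mfps_mult q f \<in> polynomials)"
  by (auto simp: local_fractions_def)

lemma local_fractionsI:
  "q \<in> polynomials \<Longrightarrow> q 0 \<noteq> 0 \<Longrightarrow> mfps_mult q f \<in> polynomials \<Longrightarrow> f \<in> local_fractions"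
  unfolding local_fractions_iff by blast

lemma local_fractionsE:
  assumes "f \<in> local_fractions"
  obtains q where "q \<in> polynomials" "q 0 \<noteq> 0" "mfps_mult q f \<in> polynomials"
  using assms unfolding local_fractions_iff by blast

lemma polynomials_local_fractions: "polynomials \<subseteq> local_fractions"
proof
  fix f :: "('b, 'a) mfps" assume "f \<in> polynomials"
  moreover have "mfps_one 0 \<noteq> (0 :: 'b)" by (simp add: mfps_one_def)
  ultimately show "f \<in> local_fractions"
    by (intro local_fractionsI[OF one_polynomial]) simp_all
qed

lemma local_fractions_add:
  assumes "f \<in> local_fractions" "g \<in> local_fractions"
  shows "f + g \<in> local_fractions"
proof -
  obtain q where q: "q \<in> polynomials" "q 0 \<noteq> 0" "mfps_mult q f \<in> polynomials"
    using assms(1) by (rule local_fractionsE)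
  obtain r where r: "r \<in> polynomials" "r 0 \<noteq> 0" "mfps_mult r g \<in> polynomials"
    using assms(2) by (rule local_fractionsE)
  have "mfps_mult (mfps_mult q r) (f + g) = mfps_mult r (mfps_mult q f) + mfps_mult q (mfps_mult r g)"
    unfolding mfps_mult_add_right mfps_mult_assoc[symmetric] mfps_mult_commute[of r q] ..
  then have "mfps_mult (mfps_mult q r) (f + g) \<in> polynomials"
    using q r by (simp only: polynomials_add polynomials_mult)
  moreover have "mfps_mult q r 0 \<noteq> 0" using q r by (simp add: mfps_mult_at_zero)
  ultimately show ?thesis by (intro local_fractionsI[OF polynomials_mult[OF q(1) r(1)]])
qed

lemma local_fractions_mult:
  assumes "f \<in> local_fractions" "g \<in> local_fractions"
  shows "mfps_mult f g \<in> local_fractions"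
proof -
  obtain q where q: "q \<in> polynomials" "q 0 \<noteq> 0" "mfps_mult q f \<in> polynomials"
    using assms(1) by (rule local_fractionsE)
  obtain r where r: "r \<in> polynomials" "r 0 \<noteq> 0" "mfps_mult r g \<in> polynomials"
    using assms(2) by (rule local_fractionsE)
  have "mfps_mult (mfps_mult q r) (mfps_mult f g) = mfps_mult (mfps_mult q f) (mfps_mult r g)"
    by (metis mfps_mult_assoc mfps_mult_commute)
  then have "mfps_mult (mfps_mult q r) (mfps_mult f g) \<in> polynomials"
    using q r by (simp only: polynomials_mult)
  moreover have "mfps_mult q r 0 \<noteq> 0" using q r by (simp add: mfps_mult_at_zero)
  ultimately show ?thesis by (intro local_fractionsI[OF polynomials_mult[OF q(1) r(1)]])
qed

lemma local_fractions_cancel: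
  assumes "q \<in> polynomials" "q 0 \<noteq> 0" "mfps_mult q f \<in> local_fractions"
  shows "f \<in> local_fractions"
proof -
  obtain r where r: "r \<in> polynomials" "r 0 \<noteq> 0" "mfps_mult r (mfps_mult q f) \<in> polynomials"
    using assms(3) by (rule local_fractionsE)
  have "mfps_mult r q 0 \<noteq> 0" using assms r by (simp add: mfps_mult_at_zero)
  moreover have "mfps_mult (mfps_mult r q) f \<in> polynomials" unfolding mfps_mult_assoc by (rule r(3))
  ultimately show ?thesis by (rule local_fractionsI[OF polynomials_mult[OF r(1) assms(1)]])
qed

lemma local_fractions_uminus: "f \<in> local_fractions \<Longrightarrow> - f \<in> local_fractions"
  using local_fractions_mult[of "mfps_monom (-1) 0" f] polynomials_local_fractions monom_polynomial
  by (auto simp: mfps_mult_minus_one)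

lemma local_fractions_sum: "(\<And>i. i \<in> I \<Longrightarrow> f i \<in> local_fractions) \<Longrightarrow> sum f I \<in> local_fractions"
  using polynomials_local_fractions zero_polynomial by (intro sum_closed local_fractions_add) auto

lemma local_fractions_deriv:
  assumes "f \<in> local_fractions"
  shows "mfps_deriv (single i) f \<in> local_fractions"
proof -
  obtain q where q: "q \<in> polynomials" "q 0 \<noteq> 0" "mfps_mult q f \<in> polynomials"
    using assms(1) by (rule local_fractionsE)
  let ?d = "mfps_deriv (single i)"
  have "mfps_mult q (?d f) = ?d (mfps_mult q f) + - (mfps_mult (?d q) f)"
    by (simp add: deriv_mult)
  moreover have "?d (mfps_mult q f) \<in> local_fractions"
    using polynomials_deriv[OF q(3)] polynomials_local_fractions by blast
  moreover have "mfps_mult (?d q) f \<in> local_fractions"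
    using polynomials_deriv[OF q(1)] polynomials_local_fractions assms by (intro local_fractions_mult) auto
  ultimately have "mfps_mult q (?d f) \<in> local_fractions"
    by (simp only: local_fractions_add local_fractions_uminus)
  then show ?thesis by (rule local_fractions_cancel[OF q(1,2)])
qed

lemma slice_mult:
  assumes W: "finite W" "\<And>\<gamma>. q \<gamma> \<noteq> 0 \<Longrightarrow> (\<Sum>i\<in>UNIV. u i * real (\<gamma> i)) \<in> W"
  shows "slice u e (mfps_mult q f) = (\<Sum>e'\<in>W. mfps_mult (slice u e' q) (slice u (e - e') f))"
proof
  fix \<alpha>
  let ?l = "\<lambda>\<gamma>. \<Sum>i\<in>UNIV. u i * real (\<gamma> i)"
  have l: "?l (\<alpha> - \<gamma>) = ?l \<alpha> - ?l \<gamma>" if "\<gamma> \<le> \<alpha>" for \<gamma>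
  proof -
    have "?l ((\<alpha> - \<gamma>) + \<gamma>) = ?l (\<alpha> - \<gamma>) + ?l \<gamma>" by (simp add: distrib_left sum.distrib)
    then show ?thesis using that by simp
  qed
  have "(\<Sum>e'\<in>W. mfps_mult (slice u e' q) (slice u (e - e') f)) \<alpha>
      = (\<Sum>\<gamma>\<in>{..\<alpha>}. \<Sum>e'\<in>W. slice u e' q \<gamma> * slice u (e - e') f (\<alpha> - \<gamma>))"
    unfolding fun_sum_apply mfps_mult_eq by (rule sum.swap)
  also have "\<dots> = (\<Sum>\<gamma>\<in>{..\<alpha>}. if ?l \<alpha> = e then q \<gamma> * f (\<alpha> - \<gamma>) else 0)"
  proof (rule sum.cong)
    fix \<gamma> assume \<gamma>: "\<gamma> \<in> {..\<alpha>}"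
    have "(\<Sum>e'\<in>W. slice u e' q \<gamma> * slice u (e - e') f (\<alpha> - \<gamma>))
        = (\<Sum>e'\<in>W. if e' = ?l \<gamma> then (if ?l \<alpha> = e then q \<gamma> * f (\<alpha> - \<gamma>) else 0) else 0)"
      using l[of \<gamma>] \<gamma> by (intro sum.cong) (auto simp: slice_def)
    also have "\<dots> = (if ?l \<alpha> = e then q \<gamma> * f (\<alpha> - \<gamma>) else 0)"
      using W by (cases "q \<gamma> = 0") auto
    finally show "(\<Sum>e'\<in>W. slice u e' q \<gamma> * slice u (e - e') f (\<alpha> - \<gamma>))
        = (if ?l \<alpha> = e then q \<gamma> * f (\<alpha> - \<gamma>) else 0)" .
  qed simp
  also have "\<dots> = slice u e (mfps_mult q f) \<alpha>" by (simp add: slice_def mfps_mult_eq)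
  finally show "slice u e (mfps_mult q f) \<alpha> = (\<Sum>e'\<in>W. mfps_mult (slice u e' q) (slice u (e - e') f)) \<alpha>" ..
qed

text \<open>Slices of \<open>f = p / q\<close> are computed from the top: comparing terms of weight \<open>e\<close> in \<open>q f = p\<close>
  expresses the product of the slice of \<open>f\<close> at \<open>e\<close> with the slice of \<open>q\<close> at \<open>0\<close>, which is again
  invertible, by slices of \<open>f\<close> at larger weights.\<close>

lemma local_fractions_slice:
  assumes f: "f \<in> local_fractions" and u: "\<And>i. u i \<le> 0"
  shows "slice u e f \<in> local_fractions"
proof -
  obtain q where q: "q \<in> polynomials" "q 0 \<noteq> 0" "mfps_mult q f \<in> polynomials"
    using f by (rule local_fractionsE)
  let ?l = "\<lambda>\<gamma> :: 'a expo. \<Sum>i\<in>UNIV. u i * real (\<gamma> i)"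
  define W where "W = insert 0 (?l ` {\<gamma>. q \<gamma> \<noteq> 0})"
  have finW: "finite W" using q(1) by (simp add: W_def polynomials_def)
  have l: "?l \<gamma> \<le> 0" for \<gamma> :: "'a expo" by (intro sum_nonpos mult_nonpos_nonneg u) simp
  have W0: "e' \<le> 0" if "e' \<in> W" for e' using that l by (auto simp: W_def)
  \<comment> \<open>every nonzero weight in \<open>q\<close> is at most \<open>- \<epsilon>\<close>, so the induction advances in steps of \<open>\<epsilon>\<close>\<close>
  define \<epsilon> where "\<epsilon> = Min (insert 1 (uminus ` (W - {0})))"
  have \<epsilon>: "0 < \<epsilon>"
    unfolding \<epsilon>_def using finW W0 by (subst Min_gr_iff) (auto simp: less_le)
  have le_\<epsilon>: "e' \<le> - \<epsilon>" if "e' \<in> W - {0}" for e'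
  proof -
    have "\<epsilon> \<le> - e'" unfolding \<epsilon>_def using finW that by (intro Min_le) auto
    then show ?thesis by simp
  qed
  have "\<forall>e. e > - (real n * \<epsilon>) \<longrightarrow> slice u e f \<in> local_fractions" for n
  proof (induction n)
    case 0
    show ?case
    proof (intro allI impI)
      fix e :: real assume e: "e > - (real 0 * \<epsilon>)"
      have "slice u e f \<alpha> = 0" for \<alpha> using l[of \<alpha>] e by (auto simp: slice_def)
      then have eq: "slice u e f = 0" by (intro ext) simp
      show "slice u e f \<in> local_fractions"
        unfolding eq by (rule subsetD[OF polynomials_local_fractions zero_polynomial])
    qed
  next
    case (Suc n)
    show ?case
    proof (intro allI impI)
      fix e assume e: "e > - (real (Suc n) * \<epsilon>)"
      have "slice u e (mfps_mult q f) = (\<Sum>e'\<in>W. mfps_mult (slice u e' q) (slice u (e - e') f))"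
        by (rule slice_mult[OF finW]) (auto simp: W_def)
      also have "\<dots> = mfps_mult (slice u 0 q) (slice u (e - 0) f)
          + (\<Sum>e'\<in>W - {0}. mfps_mult (slice u e' q) (slice u (e - e') f))"
        by (rule sum.remove[OF finW]) (simp add: W_def)
      finally have "mfps_mult (slice u 0 q) (slice u e f)
          = slice u e (mfps_mult q f) + - (\<Sum>e'\<in>W - {0}. mfps_mult (slice u e' q) (slice u (e - e') f))"
        by simp
      moreover have "slice u e (mfps_mult q f) \<in> local_fractions"
        using polynomials_slice[OF q(3)] polynomials_local_fractions by blast
      moreover have "(\<Sum>e'\<in>W - {0}. mfps_mult (slice u e' q) (slice u (e - e') f)) \<in> local_fractions"
      proof (intro local_fractions_sum local_fractions_mult)
        fix e' assume e': "e' \<in> W - {0}"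
        show "slice u e' q \<in> local_fractions"
          using polynomials_slice[OF q(1)] polynomials_local_fractions by blast
        have "e - e' > - (real n * \<epsilon>)" using e le_\<epsilon>[OF e'] by (simp add: distrib_right)
        then show "slice u (e - e') f \<in> local_fractions" using Suc by blast
      qed
      ultimately have "mfps_mult (slice u 0 q) (slice u e f) \<in> local_fractions"
        by (simp only: local_fractions_add local_fractions_uminus)
      then show "slice u e f \<in> local_fractions"
      proof (rule local_fractions_cancel[OF polynomials_slice[OF q(1)], rotated])
        show "slice u 0 q 0 \<noteq> 0" using q(2) by (simp add: slice_def)
      qed
    qed
  qed
  moreover obtain n where "- e / \<epsilon> < real n" using reals_Archimedean2 by blast
  then have "- e < real n * \<epsilon>" by (simp only: pos_divide_less_eq[OF \<epsilon>])
  then have "e > - (real n * \<epsilon>)" by linarith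
  ultimately show ?thesis by blast
qed

section \<open>Krull's intersection theorem\<close>

lemma mfps_mult_diff_right: "mfps_mult h (f - g) = mfps_mult h f - mfps_mult h g"
  by (simp add: mfps_mult_commute[of h] mfps_mult_diff_left)

lemma scal_add: "scal c (u + v) = scal c u + scal c v"
  by (simp add: scal_def fun_eq_iff mfps_mult_add_right)

lemma scal_add_left: "scal (c + d) v = scal c v + scal d v"
  by (simp add: scal_def fun_eq_iff mfps_mult_add_left)

lemma scal_diff_left: "scal (c - d) v = scal c v - scal d v"
  by (simp add: scal_def fun_eq_iff mfps_mult_diff_left)

lemma scal_scal: "scal c (scal d v) = scal (mfps_mult c d) v"
  by (simp add: scal_def mfps_mult_assoc)

lemma scal_zero [simp]: "scal c 0 = 0"
  by (simp add: scal_def fun_eq_iff)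

lemma scal_zero_left [simp]: "scal 0 v = 0"
  by (simp add: scal_def fun_eq_iff)

lemma scal_one [simp]: "scal mfps_one v = v"
  by (simp add: scal_def)

lemma scal_minus_one: "scal (mfps_monom (-1) 0) v = - v"
  by (simp add: scal_def fun_eq_iff mfps_mult_minus_one)

lemma scal_diff: "scal c (u - v) = scal c u - scal c v"
proof -
  have "scal c (u - v) + scal c v = scal c (u - v + v)" by (simp only: scal_add)
  then have "scal c (u - v) + scal c v = scal c u" by simp
  then show ?thesis by (simp only: eq_diff_eq)
qed

text \<open>The homogeneous part of degree \<open>K\<close> of the submodule that the elements \<open>w i\<close>, placed in
  degree \<open>i\<close>, for \<open>i < K\<close> generate over the Rees algebra of the maximal ideal of the origin.\<close>

inductive rees :: "(nat \<Rightarrow> ('b, 'k::field, 'n::finite) vec) \<Rightarrow> nat \<Rightarrow> ('b, 'k, 'n) vec \<Rightarrow> bool"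
  for w :: "nat \<Rightarrow> ('b, 'k::field, 'n::finite) vec" and K :: nat where
  rees_zero: "rees w K 0"
| rees_step: "rees w K v \<Longrightarrow> i < K \<Longrightarrow> c \<in> polynomials \<Longrightarrow> mfps_order_ge (K - i) c
    \<Longrightarrow> rees w K (v + scal c (w i))"

lemma rees_add:
  fixes w :: "nat \<Rightarrow> ('b, 'k::field, 'n::finite) vec"
  assumes u: "rees w K u" and v: "rees w K v"
  shows "rees w K (u + v)"
  using v
proof (rule rees.induct)
  show "rees w K (u + 0)" using u by simp
next
  fix v :: "('b, 'k, 'n) vec" and i and c :: "('k, 'n) mfps" assume "rees w K (u + v)" "i < K" "c \<in> polynomials" "mfps_order_ge (K - i) c"
  then have "rees w K (u + v + scal c (w i))" by (rule rees_step)
  then show "rees w K (u + (v + scal c (w i)))" by (simp only: add.assoc)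
qed

lemma rees_scal:
  fixes w :: "nat \<Rightarrow> ('b, 'k::field, 'n::finite) vec"
  assumes v: "rees w K v" and c: "c \<in> polynomials" "mfps_order_ge (K' - K) c" and le: "K \<le> K'"
  shows "rees w K' (scal c v)"
  using v
proof (rule rees.induct)
  show "rees w K' (scal c 0)" unfolding scal_zero by (rule rees_zero)
next
  fix v :: "('b, 'k, 'n) vec" and i and d :: "('k, 'n) mfps" assume *: "rees w K' (scal c v)" "i < K" "d \<in> polynomials" "mfps_order_ge (K - i) d"
  have "mfps_order_ge ((K' - K) + (K - i)) (mfps_mult c d)" using c(2) *(4) by (rule mfps_order_ge_mult)
  moreover have "(K' - K) + (K - i) = K' - i" using le *(2) by simp
  ultimately have "rees w K' (scal c v + scal (mfps_mult c d) (w i))"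
    using * le c by (intro rees_step polynomials_mult) auto
  then show "rees w K' (scal c (v + scal d (w i)))" by (simp only: scal_add scal_scal)
qed

lemma rees_gen:
  assumes "c \<in> polynomials" "mfps_order_ge (K - i) c" "i < K"
  shows "rees w K (scal c (w i))"
  using rees_step[OF rees_zero assms(3,1,2), of w] by simp

lemma rees_uminus: "rees w K v \<Longrightarrow> rees w K (- v)"
  using rees_scal[of w K v "mfps_monom (-1) 0" K] by (simp add: monom_polynomial scal_minus_one)

lemma diff_add_diff: "a - (b + (c + - d)) = a - b - (c - (d :: 'a :: ab_group_add))"
  by simp

lemma rees_order:
  fixes w :: "nat \<Rightarrow> ('b, 'k::field, 'n::finite) vec"
  assumes v: "rees w K v" and w: "\<And>i j. mfps_order_ge i (w i j)"
  shows "mfps_order_ge K (v j)"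
  using v
proof (rule rees.induct)
  show "mfps_order_ge K ((0 :: ('b, 'k, 'n) vec) j)"
    by (simp add: mfps_order_ge_def)
  fix v :: "('b, 'k, 'n) vec" and i and c :: "('k, 'n) mfps" assume *: "mfps_order_ge K (v j)" "i < K" "mfps_order_ge (K - i) c"
  have "mfps_order_ge ((K - i) + i) (mfps_mult c (w i j))" using *(3) w by (rule mfps_order_ge_mult)
  then show "mfps_order_ge K ((v + scal c (w i)) j)"
    using * by (simp add: scal_def mfps_order_ge_add)
qed

context monomial_order
begin

definition key_le :: "nat \<Rightarrow> ('b, 'k::field, 'n) vec \<Rightarrow> bool" where
  "key_le X v \<longleftrightarrow> (\<forall>j \<alpha>. v j \<alpha> \<noteq> 0 \<longrightarrow> j \<in> B \<and> key (j, \<alpha>) \<le> X)"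

lemma key_le_exists:
  assumes "v \<in> vecs polynomials B"
  obtains X where "key_le X v"
proof -
  have fin: "finite (Sigma B (\<lambda>j. {\<alpha>. v j \<alpha> \<noteq> 0}))"
    using assms finite_B by (intro finite_SigmaI) (auto simp: vecs_def polynomials_def)
  have "key_le (Max (insert 0 (key ` Sigma B (\<lambda>j. {\<alpha>. v j \<alpha> \<noteq> 0})))) v"
    unfolding key_le_def
  proof (intro allI impI conjI)
    fix j \<alpha> assume nz: "v j \<alpha> \<noteq> 0"
    show "j \<in> B"
    proof (rule ccontr)
      assume "j \<notin> B" then have "v j = 0" using assms by (simp add: vecs_def)
      then show False using nz by simp
    qed
    then show "key (j, \<alpha>) \<le> Max (insert 0 (key ` Sigma B (\<lambda>j. {\<alpha>. v j \<alpha> \<noteq> 0})))"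
      using fin nz by (intro Max_ge) auto
  qed
  then show ?thesis by (rule that)
qed

text \<open>The Rees algebra of polynomials is noetherian, so the sequence eventually stops giving new
  elements. Otherwise, reduce each \<open>w K\<close> modulo its predecessors to a smallest leading monomial. By
  Dickson's lemma, for the exponents together with the excess of the degree over \<open>K\<close>, one of these
  leading monomials divides a later one within the Rees algebra, which then can be reduced further.\<close>

lemma rees_stationary:
  fixes w :: "nat \<Rightarrow> ('b, 'k::field, 'n) vec"
  assumes w: "\<And>i. w i \<in> vecs polynomials B" "\<And>i j. mfps_order_ge i (w i j)"
  shows "\<exists>K. rees w K (w K)"
proof (rule ccontr)
  assume neg: "\<not> (\<exists>K. rees w K (w K))"
  have "\<exists>x. rees w K (snd x) \<and> key_le (fst x) (w K - snd x)
      \<and> (\<forall>X h. rees w K h \<longrightarrow> key_le X (w K - h) \<longrightarrow> fst x \<le> X)" for K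
  proof -
    let ?P = "\<lambda>x. rees w K (snd x) \<and> key_le (fst x) (w K - snd x)"
    obtain X where "key_le X (w K)" using w(1) by (rule key_le_exists)
    then have "?P (X, 0)" by (simp add: rees_zero)
    from ex_has_least_nat[of ?P, OF this, of fst] obtain x where
      x: "?P x" "\<forall>y. ?P y \<longrightarrow> fst x \<le> fst y" by blast
    have "fst x \<le> X" if "rees w K h" "key_le X (w K - h)" for X h
      using x(2)[rule_format, of "(X, h)"] that by simp
    then show ?thesis using x(1) by blast
  qed
  then have "\<forall>K. \<exists>x. rees w K (snd x) \<and> key_le (fst x) (w K - snd x)
      \<and> (\<forall>X h. rees w K h \<longrightarrow> key_le X (w K - h) \<longrightarrow> fst x \<le> X)" by blast
  from choice[OF this] obtain x where x: "\<forall>K. rees w K (snd (x K)) \<and> key_le (fst (x K)) (w K - snd (x K))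
      \<and> (\<forall>X h. rees w K h \<longrightarrow> key_le X (w K - h) \<longrightarrow> fst (x K) \<le> X)" by blast
  define h where "h K = snd (x K)" for K
  define X where "X K = fst (x K)" for K
  have h: "rees w K (h K)" and X: "key_le (X K) (w K - h K)" for K
    using x by (simp_all add: h_def X_def)
  have least: "X K \<le> Y" if "rees w K g" "key_le Y (w K - g)" for K Y g
    using x that by (simp add: X_def)
  define v where "v K = w K - h K" for K
  have "\<exists>\<delta>. fst \<delta> \<in> B \<and> v K (fst \<delta>) (snd \<delta>) \<noteq> 0 \<and> key \<delta> = X K" for K
  proof (rule ccontr)
    assume no: "\<not> (\<exists>\<delta>. fst \<delta> \<in> B \<and> v K (fst \<delta>) (snd \<delta>) \<noteq> 0 \<and> key \<delta> = X K)"
    have lt: "j \<in> B \<and> key (j, \<alpha>) < X K" if "v K j \<alpha> \<noteq> 0" for j \<alpha>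
    proof -
      have "j \<in> B \<and> key (j, \<alpha>) \<le> X K" using X[of K] that by (simp add: key_le_def v_def)
      moreover from this have "key (j, \<alpha>) \<noteq> X K" using no that by force
      ultimately show ?thesis by simp
    qed
    show False
    proof (cases "\<exists>j \<alpha>. v K j \<alpha> \<noteq> 0")
      case True
      then have "0 < X K" using lt by (metis less_nat_zero_code neq0_conv)
      have "key_le (X K - 1) (w K - h K)"
        unfolding key_le_def v_def[symmetric] using lt by (metis Suc_pred' \<open>0 < X K\<close> less_Suc_eq_le)
      then have "X K \<le> X K - 1" using h by (intro least)
      then show False using \<open>0 < X K\<close> by simp
    next
      case False
      then have "w K j \<alpha> = h K j \<alpha>" for j \<alpha> by (simp add: v_def)
      then have "w K = h K" by (intro ext)
      then show False using h[of K] neg by metis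
    qed
  qed
  then have "\<forall>K. \<exists>\<delta>. fst \<delta> \<in> B \<and> v K (fst \<delta>) (snd \<delta>) \<noteq> 0 \<and> key \<delta> = X K" by blast
  from choice[OF this] obtain \<delta> where
    \<delta>: "\<forall>K. fst (\<delta> K) \<in> B \<and> v K (fst (\<delta> K)) (snd (\<delta> K)) \<noteq> 0 \<and> key (\<delta> K) = X K" by blast
  have deg: "K \<le> deg (snd (\<delta> K))" for K
  proof (rule ccontr)
    assume "\<not> K \<le> deg (snd (\<delta> K))"
    moreover have "mfps_order_ge K (v K (fst (\<delta> K)))"
      unfolding v_def using mfps_order_ge_diff[OF w(2) rees_order[OF h w(2)]] by simp
    ultimately have "v K (fst (\<delta> K)) (snd (\<delta> K)) = 0" by (simp add: mfps_order_ge_def)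
    then show False using \<delta> by blast
  qed
  have "finite ((\<lambda>K. fst (\<delta> K)) ` UNIV)"
    using \<delta> by (intro finite_subset[OF _ finite_B]) blast
  then obtain K0 where inf: "infinite {K \<in> UNIV. fst (\<delta> K) = fst (\<delta> K0)}"
    using pigeonhole_infinite[OF infinite_UNIV_nat] by blast
  define \<psi> where "\<psi> = enumerate {K. fst (\<delta> K) = fst (\<delta> K0)}"
  have \<psi>: "strict_mono \<psi>" "fst (\<delta> (\<psi> k)) = fst (\<delta> K0)" for k
    using inf enumerate_in_set[of "{K. fst (\<delta> K) = fst (\<delta> K0)}" k]
    by (simp_all add: \<psi>_def strict_mono_enumerate)
  \<comment> \<open>the additional coordinate makes the quotient monomial divisible in the Rees algebra\<close>
  define a :: "nat \<Rightarrow> 'n option \<Rightarrow> nat" where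
    "a k x = (case x of None \<Rightarrow> deg (snd (\<delta> (\<psi> k))) - \<psi> k | Some i \<Rightarrow> snd (\<delta> (\<psi> k)) i)" for k x
  obtain \<phi> :: "nat \<Rightarrow> nat" where \<phi>: "strict_mono \<phi>" "\<And>k l. k \<le> l \<Longrightarrow> a (\<phi> k) \<le> a (\<phi> l)"
    by (rule dickson_seq[of a]) (rule that)
  define K where "K = \<psi> (\<phi> 0)"
  define K' where "K' = \<psi> (\<phi> 1)"
  have KK': "K < K'" unfolding K_def K'_def using \<psi>(1) \<phi>(1) by (simp add: strict_mono_less)
  have fst_eq: "fst (\<delta> K) = fst (\<delta> K')" unfolding K_def K'_def \<psi>(2) ..
  have le: "a (\<phi> 0) x \<le> a (\<phi> 1) x" for x using \<phi>(2)[of 0 1] by (simp add: le_fun_def)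
  have snd_le: "snd (\<delta> K) \<le> snd (\<delta> K')"
    using le[of "Some _"] by (auto simp: le_fun_def a_def K_def K'_def)
  have deg_le: "deg (snd (\<delta> K)) - K \<le> deg (snd (\<delta> K')) - K'"
    using le[of None] by (simp add: a_def K_def K'_def)
  define \<gamma> where "\<gamma> = snd (\<delta> K') - snd (\<delta> K)"
  have snd_eq: "snd (\<delta> K') = snd (\<delta> K) + \<gamma>" using snd_le by (simp add: \<gamma>_def)
  have deg_\<gamma>: "K' - K \<le> deg \<gamma>"
    using deg_le deg[of K] deg[of K'] snd_eq by simp
  have lead_ne: "v K (fst (\<delta> K')) (snd (\<delta> K)) \<noteq> 0" using \<delta> unfolding fst_eq[symmetric] by blast
  define c where "c = v K' (fst (\<delta> K')) (snd (\<delta> K')) / v K (fst (\<delta> K)) (snd (\<delta> K))"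
  let ?m = "mfps_monom c \<gamma>"
  have m: "?m \<in> polynomials" "mfps_order_ge (K' - K) ?m"
    using deg_\<gamma> monom_polynomial[of c \<gamma>] by (auto simp: mfps_order_ge_def) (auto simp: mfps_monom_def)
  have "rees w K' (h K' + (scal ?m (w K) + - scal ?m (h K)))"
    using KK' m by (intro rees_add h rees_uminus rees_scal[OF h m] rees_gen) auto
  moreover have "key_le (X K' - 1) (w K' - (h K' + (scal ?m (w K) + - scal ?m (h K))))"
  proof -
    have eq: "w K' - (h K' + (scal ?m (w K) + - scal ?m (h K))) = v K' - scal ?m (v K)"
      unfolding v_def scal_diff by (rule diff_add_diff)
    have "j \<in> B \<and> key (j, \<alpha>) \<le> X K' - 1" if nz: "(v K' - scal ?m (v K)) j \<alpha> \<noteq> 0" for j \<alpha>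
    proof -
      have eval: "(v K' - scal ?m (v K)) j \<alpha>
          = v K' j \<alpha> - (if \<gamma> \<le> \<alpha> then c * v K j (\<alpha> - \<gamma>) else 0)"
        by (simp add: scal_def mfps_mult_monom)
      have key_le: "j \<in> B \<and> key (j, \<alpha>) \<le> X K'"
      proof (cases "v K' j \<alpha> = 0")
        case False
        then show ?thesis using X[of K'] by (simp add: key_le_def v_def)
      next
        case True
        then have "\<gamma> \<le> \<alpha>" "v K j (\<alpha> - \<gamma>) \<noteq> 0" using nz eval by (auto split: if_splits)
        then have "j \<in> B" "key (j, \<alpha> - \<gamma>) \<le> X K" using X[of K] by (simp_all add: key_le_def v_def)
        moreover have "key (j, \<alpha>) = key (j, \<alpha> - \<gamma>) * mono_code \<gamma>" using \<open>\<gamma> \<le> \<alpha>\<close> by (rule key_diff)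
        moreover have "X K' = X K * mono_code \<gamma>"
        proof -
          have "X K' = key (fst (\<delta> K), snd (\<delta> K) + \<gamma>)" using \<delta> fst_eq snd_eq by (metis prod.collapse)
          also have "\<dots> = key (\<delta> K) * mono_code \<gamma>" unfolding key_add by simp
          finally show ?thesis using \<delta> by simp
        qed
        ultimately show ?thesis by simp
      qed
      have "key (j, \<alpha>) \<noteq> X K'"
      proof
        assume "key (j, \<alpha>) = X K'"
        then have "key (j, \<alpha>) = key (fst (\<delta> K'), snd (\<delta> K'))" using \<delta> by simp
        then have "j = fst (\<delta> K')" "\<alpha> = snd (\<delta> K')"
          using key_inj[of j "fst (\<delta> K')" \<alpha> "snd (\<delta> K')"] key_le \<delta> by auto
        then have "(v K' - scal ?m (v K)) j \<alpha> = 0"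
          unfolding eval using lead_ne snd_eq by (simp add: c_def fst_eq)
        then show False using nz by contradiction
      qed
      then show ?thesis using key_le by linarith
    qed
    then show ?thesis unfolding eq key_le_def by blast
  qed
  ultimately have "X K' \<le> X K' - 1" by (rule least)
  moreover have "0 < X K'" using \<delta> key_pos[of "\<delta> K'"] by metis
  ultimately show False by simp
qed

end

lemma common_denominator:
  fixes v :: "('b, 'k::field, 'n::finite) vec"
  assumes "finite B" "v \<in> vecs local_fractions B"
  obtains q where "q \<in> polynomials" "q 0 \<noteq> 0" "scal q v \<in> vecs polynomials B"
proof -
  have "\<exists>q\<in>polynomials. q 0 \<noteq> 0 \<and> (\<forall>j\<in>B'. mfps_mult q (v j) \<in> polynomials)" if "finite B'" for B'
    using that
  proof (induction B')
    case empty
    have "mfps_one 0 \<noteq> (0 :: 'k)" by (simp add: mfps_one_def)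
    then show ?case using one_polynomial by blast
  next
    case (insert j B')
    then obtain q where q: "q \<in> polynomials" "q 0 \<noteq> 0" "\<forall>j\<in>B'. mfps_mult q (v j) \<in> polynomials" by blast
    have "v j \<in> local_fractions" using assms(2) by (simp add: vecs_def)
    then obtain r where r: "r \<in> polynomials" "r 0 \<noteq> 0" "mfps_mult r (v j) \<in> polynomials" by (rule local_fractionsE)
    have "mfps_mult (mfps_mult q r) (v j) \<in> polynomials"
      unfolding mfps_mult_assoc using q(1) r(3) by (rule polynomials_mult)
    moreover have "mfps_mult (mfps_mult q r) (v i) \<in> polynomials" if "i \<in> B'" for i
      unfolding mfps_mult_commute[of q r] mfps_mult_assoc
      using r(1) bspec[OF q(3) that] by (rule polynomials_mult)
    moreover have "mfps_mult q r \<in> polynomials" "mfps_mult q r 0 \<noteq> 0"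
      using q r by (simp_all add: polynomials_mult mfps_mult_at_zero)
    ultimately show ?case by blast
  qed
  from this[OF assms(1)] obtain q where q: "q \<in> polynomials" "q 0 \<noteq> 0"
    "\<forall>j\<in>B. mfps_mult q (v j) \<in> polynomials" by blast
  have "mfps_mult q (v j) \<in> polynomials" for j
  proof (cases "j \<in> B")
    case False
    then have "v j = 0" using assms(2) by (simp add: vecs_def)
    then show ?thesis by (simp add: zero_polynomial)
  qed (use q in blast)
  moreover have "mfps_mult q (v j) = 0" if j: "j \<notin> B" for j
  proof -
    have eq: "v j = 0" using assms(2) j unfolding vecs_def by blast
    show ?thesis unfolding eq by (rule mfps_mult_zero)
  qed
  ultimately have "scal q v \<in> vecs polynomials B" by (simp add: vecs_def scal_def)
  then show ?thesis using q that by blast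
qed

text \<open>A vector \<open>F\<close> of polynomials that is congruent to an element \<open>n k\<close>
  of \<open>N\<close> up to order \<open>k\<close>, for every \<open>k\<close>, gives the sequence \<open>F - n k\<close>, of which some term is a
  combination of the previous ones with coefficients vanishing at the origin. Modulo \<open>N\<close> this says
  \<open>F = c F\<close> with \<open>c\<close> vanishing at the origin.\<close>

lemma local_fractions_closed:
  fixes N :: "('b, 'k::field, 'n::finite) vec set"
  assumes B: "finite B" and N: "N \<subseteq> vecs local_fractions B" and zero: "0 \<in> N"
    and add: "\<And>u v. u \<in> N \<Longrightarrow> v \<in> N \<Longrightarrow> u + v \<in> N"
    and scal: "\<And>c v. c \<in> local_fractions \<Longrightarrow> v \<in> N \<Longrightarrow> scal c v \<in> N"
    and f: "f \<in> vecs local_fractions B" and adh: "\<And>d. \<exists>h\<in>N. vagree d f h"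
  shows "f \<in> N"
proof -
  have scalp: "scal c v \<in> N" if "c \<in> polynomials" "v \<in> N" for c v
    using that polynomials_local_fractions by (intro scal) auto
  have diff: "u - v \<in> N" if "u \<in> N" "v \<in> N" for u v
  proof -
    have "u + scal (mfps_monom (-1) 0) v \<in> N" using that by (intro add scalp monom_polynomial)
    then show ?thesis by (simp add: scal_minus_one)
  qed
  obtain q where q: "q \<in> polynomials" "q 0 \<noteq> 0" "scal q f \<in> vecs polynomials B"
    using B f by (rule common_denominator)
  define F where "F = scal q f"
  have "\<exists>n\<in>N. n \<in> vecs polynomials B \<and> (\<forall>j. mfps_order_ge d (F j - n j))" for d
  proof -
    obtain h where h: "h \<in> N" "vagree d f h" using adh by blast
    have "h \<in> vecs local_fractions B" using h N by blast
    with B obtain r where r: "r \<in> polynomials" "r 0 \<noteq> 0" "scal r h \<in> vecs polynomials B"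
      by (rule common_denominator)
    obtain g where g: "mfps_mult r g = mfps_one" using r(2) by (rule mfps_inverse_exists)
    let ?t = "mfps_trunc d g"
    \<comment> \<open>clears the denominator \<open>r\<close> of \<open>h\<close> and replaces its inverse by a polynomial, modulo order \<open>d\<close>\<close>
    define c where "c = mfps_mult q ?t"
    have c: "c \<in> polynomials" unfolding c_def using q(1) mfps_trunc_polynomial by (rule polynomials_mult)
    have "scal c (scal r h) \<in> N" using c r h by (intro scalp)
    moreover have "scal c (scal r h) \<in> vecs polynomials B"
      using r(3) c by (auto simp: vecs_def scal_def[of c] intro: polynomials_mult)
    moreover have "mfps_order_ge d (F j - scal c (scal r h) j)" for j
    proof -
      have one: "mfps_mult q (f j) = mfps_mult q (mfps_mult g (mfps_mult r (f j)))"
        unfolding mfps_mult_assoc[symmetric, of g] mfps_mult_commute[of g r] g by simp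
      have "F j - scal c (scal r h) j = mfps_mult q
          (mfps_mult (g - ?t) (mfps_mult r (f j)) + mfps_mult ?t (mfps_mult r (f j - h j)))"
        unfolding F_def scal_def one c_def mfps_mult_assoc
        by (simp add: mfps_mult_add_right[symmetric] mfps_mult_diff_left mfps_mult_diff_right)
      moreover have "mfps_order_ge d (f j - h j)"
        using h(2) by (simp add: mfps_order_ge_def vagree_def)
      ultimately show ?thesis
        by (simp add: mfps_order_ge_mult_left mfps_order_ge_mult_right mfps_order_ge_add mfps_order_ge_trunc)
    qed
    ultimately show ?thesis by blast
  qed
  then have "\<forall>d. \<exists>n. n \<in> N \<and> n \<in> vecs polynomials B \<and> (\<forall>j. mfps_order_ge d (F j - n j))" by blast
  from choice[OF this] obtain n where n: "\<forall>d. n d \<in> N \<and> n d \<in> vecs polynomials B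
      \<and> (\<forall>j. mfps_order_ge d (F j - n d j))" by blast
  define w where "w d = F - n d" for d
  obtain p :: "'n \<Rightarrow> nat" and e where "monomial_order p e B" using monomial_order_exists[OF B] by blast
  then interpret monomial_order p e B .
  have "\<exists>K. rees w K (w K)"
  proof (rule rees_stationary)
    show "w i \<in> vecs polynomials B" for i
    proof -
      have "F \<in> vecs polynomials B" "n i \<in> vecs polynomials B" using q(3) n by (auto simp: F_def)
      then show ?thesis by (auto simp: vecs_def w_def intro: polynomials_diff)
    qed
    show "mfps_order_ge i (w i j)" for i j using n by (simp add: w_def)
  qed
  then obtain K where K: "rees w K (w K)" by blast
  have "\<exists>c\<in>polynomials. c 0 = 0 \<and> (\<exists>m\<in>N. w K = scal c F - m)"
    using K
  proof (rule rees.induct)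
    show "\<exists>c\<in>polynomials. c 0 = 0 \<and> (\<exists>m\<in>N. 0 = scal c F - m)"
      using zero by (intro bexI[of _ 0] conjI) (simp_all add: zero_polynomial)
  next
    fix v :: "('b, 'k, 'n) vec" and i and d :: "('k, 'n) mfps"
    assume "\<exists>c\<in>polynomials. c 0 = 0 \<and> (\<exists>m\<in>N. v = scal c F - m)" and i: "i < K"
      and d: "d \<in> polynomials" "mfps_order_ge (K - i) d"
    then obtain c m where c: "c \<in> polynomials" "c 0 = 0" and m: "m \<in> N" "v = scal c F - m" by blast
    have "d 0 = 0" using d(2) i by (simp add: mfps_order_ge_def)
    then have "(c + d) 0 = 0" using c by simp
    moreover have "c + d \<in> polynomials" using c d by (intro polynomials_add)
    moreover have "m + scal d (n i) \<in> N" using m d n by (intro add scalp) auto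
    moreover have "v + scal d (w i) = scal (c + d) F - (m + scal d (n i))"
      unfolding m(2) w_def scal_diff scal_add_left by (simp only: algebra_simps)
    ultimately show "\<exists>c\<in>polynomials. c 0 = 0 \<and> (\<exists>m\<in>N. v + scal d (w i) = scal c F - m)" by blast
  qed
  then obtain c m where c: "c \<in> polynomials" "c 0 = 0" and m: "m \<in> N" "w K = scal c F - m" by blast
  define r where "r = mfps_mult (mfps_one - c) q"
  have r: "r \<in> polynomials" unfolding r_def by (intro polynomials_mult polynomials_diff one_polynomial c q)
  have r0: "r 0 \<noteq> 0" using c q by (simp add: r_def mfps_mult_at_zero mfps_one_def)
  have "scal r f = F - scal c F" by (simp only: r_def scal_scal[symmetric] F_def scal_diff_left scal_one)
  also have "\<dots> = n K - m" using m(2) unfolding w_def by (simp add: algebra_simps)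
  finally have rf: "scal r f \<in> N" using diff[of "n K" m] n m(1) by simp
  obtain g where g: "mfps_mult r g = mfps_one" using r0 by (rule mfps_inverse_exists)
  have "g \<in> local_fractions" using r r0 one_polynomial by (intro local_fractionsI[of r]) (simp_all add: g)
  then have "scal g (scal r f) \<in> N" using rf by (rule scal)
  moreover have "scal g (scal r f) = f" unfolding scal_scal mfps_mult_commute[of g r] g by simp
  ultimately show ?thesis by simp
qed

lemma coefficient_ring_local_fractions:
  "coefficient_ring (local_fractions :: ('k::field, 'n::finite) mfps set)"
proof
  fix B :: "('n expo \<times> nat) set" and N :: "('k, 'n) hop set" and f
  assume B: "finite B" and H: "N \<subseteq> free local_fractions B" "submodule local_fractions N"
    "f \<in> free local_fractions B" "adherent N f"
  show "f \<in> N"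
    by (rule closed_of_vec_closed[OF _ H]) (rule local_fractions_closed[OF B])
next
  show "slice u e c \<in> local_fractions" if "c \<in> local_fractions" "\<And>i. u i \<le> 0"
    for c :: "('k, 'n) mfps" and u e using that by (rule local_fractions_slice)
qed (simp_all add: polynomials_local_fractions local_fractions_add local_fractions_mult local_fractions_deriv)

theorem proposition4p2p4:
  fixes I :: "('k::field, 'n::finite) dop set"
    and I' :: "(complex, 'n) dop set"
  shows "(left_ideal I (dop_ring local_fractions) \<longrightarrow>
            equiv_classes (hop_ring local_fractions) (homogenize_ideal local_fractions I)
            = equiv_classes (hop_ring formal_series)
                (homogenize_ideal formal_series (gen_left_ideal (dop_ring formal_series) I)))
       \<and> (left_ideal I' (dop_ring convergent_series) \<longrightarrow>
            equiv_classes (hop_ring convergent_series) (homogenize_ideal convergent_series I')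
            = equiv_classes (hop_ring formal_series)
                (homogenize_ideal formal_series (gen_left_ideal (dop_ring formal_series) I')))"
proof (intro conjI impI)
  have "formal_extension (local_fractions :: ('k, 'n) mfps set)"
    using coefficient_ring_local_fractions coefficient_ring_formal by (rule formal_extension.intro)
  then show "equiv_classes (hop_ring local_fractions) (homogenize_ideal local_fractions I)
      = equiv_classes (hop_ring formal_series)
          (homogenize_ideal formal_series (gen_left_ideal (dop_ring formal_series) I))"
    if "left_ideal I (dop_ring local_fractions)"
    using that by (rule formal_extension.equiv_classes_extension)
next
  have "formal_extension (convergent_series :: (complex, 'n) mfps set)"
    using coefficient_ring_convergent coefficient_ring_formal by (rule formal_extension.intro)
  then show "equiv_classes (hop_ring convergent_series) (homogenize_ideal convergent_series I')
      = equiv_classes (hop_ring formal_series)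
          (homogenize_ideal formal_series (gen_left_ideal (dop_ring formal_series) I'))"
    if "left_ideal I' (dop_ring convergent_series)"
    using that by (rule formal_extension.equiv_classes_extension)
qed

end
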